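(* Let $P_{X_iY_i}$, $i\in[1:m]$, be distributions on $\mathcal X\times\mathcal Y$ (finite alphabets), let $\nu_i>0$ with $\sum_i\nu_i=1$, and let the source in the WAK problem be $P_{X^nY^n}=\sum_{i=1}^m\nu_iP_{X_iY_i}^{\otimes n}$. Let $P_{\mathcal X,1},\dots,P_{\mathcal X,|\mathcal P_{\mathcal X}|}$ be the distinct $\mathcal X$-marginals of the $P_{X_iY_i}$, and $\mathfrak F_s=\{i:P_{\mathcal X,s}\text{ is the }\mathcal X\text{-marginal of }P_{X_iY_i}\}$. Then for every $R_c>0$ the minimum ($0$-)achievable compression rate for $Y^n$ is $$R^\star_{2,0}(R_c)=\max_{s\in[1:|\mathcal P_{\mathcal X}|]}\ \min_{P_{U|X}:\,I(X_s;U)\le R_c}\ \max_{i\in\mathfrak F_s}H(Y_i|U),$$ where $X_s\sim P_{\mathcal X,s}$, $U$ (in a finite alphabet) is generated from $X_s$ through $P_{U|X}$, and for $i\in\mathfrak F_s$, $(X_s,Y_i)\sim P_{X_iY_i}$ with $Y_i-X_s-U$ a Markov chain.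
   Context: WAK (Wyner–Ahlswede–Körner) problem: $(X^n,Y^n)\sim P_{X^nY^n}$ on $\mathcal X^n\times\mathcal Y^n$. A WAK-code is a triple of maps $\phi_{1n}:\mathcal X^n\to\mathcal M_1$, $\phi_{2n}:\mathcal Y^n\to\mathcal M_2$, $\bar\psi_n:\mathcal M_1\times\mathcal M_2\to\mathcal Y^n$ with $\mathcal M_1,\mathcal M_2$ finite sets (depending on $n$), $|\phi_{1n}|:=|\mathcal M_1|$, $|\phi_{2n}|:=|\mathcal M_2|$, and $\hat Y^n=\bar\psi_n(\phi_{1n}(X^n),\phi_{2n}(Y^n))$. For $\epsilon\in[0,1)$, $\mathcal R_{\mathrm{WAK},\epsilon}$ is the closure of the set of pairs $(R_c,R_2)$ for which there is a sequence of WAK-codes with $\limsup_n\frac1n\log|\phi_{1n}|\le R_c$, $\limsup_n\frac1n\log|\phi_{2n}|\le R_2$, $\limsup_n\Pr\{\hat Y^n\ne Y^n\}\le\epsilon$; and $R^\star_{2,\epsilon}(R_c)=\inf\{R_2:(R_c,R_2)\in\mathcal R_{\mathrm{WAK},\epsilon}\}$. $\log$ is natural, $H$ and $I$ are entropy and mutual information in nats. *)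

theory Defs
  imports "HOL-Probability.Probability"
begin

section \<open>Information measures of finitely supported laws, in nats\<close>

definition mutual_info :: "('a \<times> 'b) pmf \<Rightarrow> real" where
  "mutual_info J = prob_space.mutual_information (measure_pmf J) (exp 1)
     (count_space UNIV) (count_space UNIV) fst snd"

text \<open>Entropy of the first component given the second one.\<close>

definition cond_entropy :: "('a \<times> 'b) pmf \<Rightarrow> real" where
  "cond_entropy J = prob_space.conditional_entropy (measure_pmf J) (exp 1)
     (count_space UNIV) (count_space UNIV) fst snd"

lemma information_space_pmf: "information_space (measure_pmf J) (exp 1)"
  by (intro information_space.intro information_space_axioms.intro prob_space_measure_pmf) simp

lemma distributed_pmf:
  fixes f :: "'a \<Rightarrow> 'b"
  shows "distributed (measure_pmf J) (count_space UNIV) f (\<lambda>x. ennreal (pmf (map_pmf f J) x))"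
  unfolding distributed_def
  using measure_pmf_eq_density[of "map_pmf f J"]
  by (simp add: map_pmf_rep_eq distr_cong)

lemma cond_entropy_eq_sum:
  fixes J :: "('a::countable \<times> 'b::countable) pmf"
  assumes "finite (set_pmf J)"
  shows "cond_entropy J =
    - (\<Sum>(a, b)\<in>set_pmf J. pmf J (a, b) * ln (pmf J (a, b) / pmf (map_pmf snd J) b))"
proof -
  interpret information_space "measure_pmf J" "exp 1" by (rule information_space_pmf)
  have pair: "count_space (UNIV :: 'a set) \<Otimes>\<^sub>M count_space (UNIV :: 'b set) = count_space UNIV"
    by (simp add: pair_measure_countable)
  have id: "map_pmf (\<lambda>x. (fst x, snd x)) J = J"
    by (simp add: map_pmf_ident)
  have "cond_entropy J = - (\<integral>(a, b). pmf J (a, b) *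
      log (exp 1) (pmf J (a, b) / pmf (map_pmf snd J) b)
      \<partial>(count_space (UNIV :: 'a set) \<Otimes>\<^sub>M count_space (UNIV :: 'b set)))"
    unfolding cond_entropy_def
    using distributed_pmf[of J snd] distributed_pmf[of J "\<lambda>x. (fst x, snd x)"]
    by (intro conditional_entropy_generic_eq sigma_finite_measure_count_space)
      (auto simp: pair id)
  also have "\<dots> = - (\<integral>x. (case x of (a, b) \<Rightarrow> pmf J (a, b) *
      ln (pmf J (a, b) / pmf (map_pmf snd J) b)) \<partial>count_space UNIV)"
    by (simp add: pair log_def)
  also have "(\<integral>x. (case x of (a, b) \<Rightarrow> pmf J (a, b) *
      ln (pmf J (a, b) / pmf (map_pmf snd J) b)) \<partial>count_space UNIV) =
    (\<Sum>x\<in>set_pmf J. case x of (a, b) \<Rightarrow> pmf J (a, b) *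
      ln (pmf J (a, b) / pmf (map_pmf snd J) b))"
    by (subst infsetsum_def[symmetric], subst infsetsum_finite[symmetric, OF assms],
      rule infsetsum_cong_neutral) (auto simp: set_pmf_iff)
  finally show ?thesis .
qed

lemma mutual_info_eq_sum:
  fixes J :: "('a::countable \<times> 'b::countable) pmf"
  assumes "finite (set_pmf J)"
  shows "mutual_info J = (\<Sum>(a, b)\<in>set_pmf J.
    pmf J (a, b) * ln (pmf J (a, b) / (pmf (map_pmf fst J) a * pmf (map_pmf snd J) b)))"
proof -
  interpret information_space "measure_pmf J" "exp 1" by (rule information_space_pmf)
  have pair: "count_space (UNIV :: 'a set) \<Otimes>\<^sub>M count_space (UNIV :: 'b set) = count_space UNIV"
    by (simp add: pair_measure_countable)
  have id: "map_pmf (\<lambda>x. (fst x, snd x)) J = J"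
    by (simp add: map_pmf_ident)
  let ?f = "\<lambda>(a, b). pmf J (a, b) *
      log (exp 1) (pmf J (a, b) / (pmf (map_pmf fst J) a * pmf (map_pmf snd J) b))"
  have "mutual_info J = integral\<^sup>L
      (count_space (UNIV :: 'a set) \<Otimes>\<^sub>M count_space (UNIV :: 'b set)) ?f"
    unfolding mutual_info_def
    using distributed_pmf[of J fst] distributed_pmf[of J snd]
      distributed_pmf[of J "\<lambda>x. (fst x, snd x)"]
    by (subst mutual_information_distr[where Px = "pmf (map_pmf fst J)"
          and Py = "pmf (map_pmf snd J)" and Pxy = "pmf J"])
      (auto simp: pair id case_prod_unfold intro: sigma_finite_measure_count_space)
  also have "\<dots> = (\<integral>x. (case x of (a, b) \<Rightarrow> pmf J (a, b) *
      ln (pmf J (a, b) / (pmf (map_pmf fst J) a * pmf (map_pmf snd J) b))) \<partial>count_space UNIV)"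
    by (simp add: pair log_def)
  also have "\<dots> = (\<Sum>x\<in>set_pmf J. case x of (a, b) \<Rightarrow> pmf J (a, b) *
      ln (pmf J (a, b) / (pmf (map_pmf fst J) a * pmf (map_pmf snd J) b)))"
    by (subst infsetsum_def[symmetric], subst infsetsum_finite[symmetric, OF assms],
      rule infsetsum_cong_neutral) (auto simp: set_pmf_iff)
  finally show ?thesis .
qed


section \<open>The Wyner--Ahlswede--Koerner problem\<close>

text \<open>
  A word of length \<open>n\<close> is a list of length \<open>n\<close>. Message sets are finite sets of natural
  numbers; only their cardinality matters.
\<close>

record ('x, 'y) wak_code =
  msgs1 :: "nat set"
  msgs2 :: "nat set"
  enc1 :: "'x list \<Rightarrow> nat"
  enc2 :: "'y list \<Rightarrow> nat"
  dec :: "nat \<times> nat \<Rightarrow> 'y list"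

definition is_wak_code :: "nat \<Rightarrow> ('x, 'y) wak_code \<Rightarrow> bool" where
  "is_wak_code n c \<longleftrightarrow>
     finite (msgs1 c) \<and> finite (msgs2 c) \<and>
     enc1 c \<in> {xs. length xs = n} \<rightarrow> msgs1 c \<and>
     enc2 c \<in> {ys. length ys = n} \<rightarrow> msgs2 c \<and>
     dec c \<in> msgs1 c \<times> msgs2 c \<rightarrow> {ys. length ys = n}"

definition error_prob :: "('x list \<times> 'y list) pmf \<Rightarrow> ('x, 'y) wak_code \<Rightarrow> real" where
  "error_prob S c = measure_pmf.prob S {(xs, ys). dec c (enc1 c xs, enc2 c ys) \<noteq> ys}"

text \<open>A source is given by the law of \<open>(X\<^sup>n, Y\<^sup>n)\<close> for each \<open>n\<close>.\<close>

type_synonym ('x, 'y) source = "nat \<Rightarrow> ('x list \<times> 'y list) pmf"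

definition wak_achievable :: "real \<Rightarrow> ('x, 'y) source \<Rightarrow> (real \<times> real) set" where
  "wak_achievable \<epsilon> S = {(Rc, R2). \<exists>c.
     (\<forall>n. is_wak_code n (c n)) \<and>
     limsup (\<lambda>n. ereal (ln (real (card (msgs1 (c n)))) / real n)) \<le> ereal Rc \<and>
     limsup (\<lambda>n. ereal (ln (real (card (msgs2 (c n)))) / real n)) \<le> ereal R2 \<and>
     limsup (\<lambda>n. ereal (error_prob (S n) (c n))) \<le> ereal \<epsilon>}"

definition wak_region :: "real \<Rightarrow> ('x, 'y) source \<Rightarrow> (real \<times> real) set" where
  "wak_region \<epsilon> S = closure (wak_achievable \<epsilon> S)"

definition min_rate :: "real \<Rightarrow> ('x, 'y) source \<Rightarrow> real \<Rightarrow> real" where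
  "min_rate \<epsilon> S Rc = Inf {R2. (Rc, R2) \<in> wak_region \<epsilon> S}"


section \<open>Mixed memoryless sources\<close>

definition iid_source :: "('x \<times> 'y) pmf \<Rightarrow> ('x, 'y) source" where
  "iid_source p n = map_pmf (\<lambda>zs. (map fst zs, map snd zs)) (replicate_pmf n p)"

definition mixed_source ::
  "nat \<Rightarrow> (nat \<Rightarrow> real) \<Rightarrow> (nat \<Rightarrow> ('x \<times> 'y) pmf) \<Rightarrow> ('x, 'y) source" where
  "mixed_source m \<nu> P n = embed_pmf (\<lambda>z. \<Sum>i=1..m. \<nu> i * pmf (iid_source (P i) n) z)"

lemma pmf_mixed_source:
  assumes "\<And>i. i \<in> {1..m} \<Longrightarrow> 0 < \<nu> i" and "(\<Sum>i=1..m. \<nu> i) = 1"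
  shows "pmf (mixed_source m \<nu> P n) z = (\<Sum>i=1..m. \<nu> i * pmf (iid_source (P i) n) z)"
  unfolding mixed_source_def
proof (rule pmf_embed_pmf)
  have nu: "0 \<le> \<nu> i" if "Suc 0 \<le> i" "i \<le> m" for i
    using assms(1)[of i] that by simp
  show nn: "0 \<le> (\<Sum>i=1..m. \<nu> i * pmf (iid_source (P i) n) x)" for x
    by (intro sum_nonneg mult_nonneg_nonneg) (auto simp: nu)
  have "(\<integral>\<^sup>+x. ennreal (\<Sum>i=1..m. \<nu> i * pmf (iid_source (P i) n) x) \<partial>count_space UNIV)
      = (\<integral>\<^sup>+x. (\<Sum>i=1..m. ennreal (\<nu> i) * ennreal (pmf (iid_source (P i) n) x)) \<partial>count_space UNIV)"
    by (intro nn_integral_cong, subst sum_ennreal[symmetric])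
      (auto intro!: mult_nonneg_nonneg sum.cong simp: ennreal_mult' nu)
  also have "\<dots> = (\<Sum>i=1..m. ennreal (\<nu> i))"
    by (subst nn_integral_sum) (auto simp: nn_integral_cmult nn_integral_pmf)
  also have "\<dots> = 1"
    by (subst sum_ennreal) (use assms(2) in \<open>auto simp: nu\<close>)
  finally show "(\<integral>\<^sup>+x. ennreal (\<Sum>i=1..m. \<nu> i * pmf (iid_source (P i) n) x) \<partial>count_space UNIV) = 1" .
qed

text \<open>The set of distinct first marginals, and the components sharing a given marginal.\<close>

definition marginals :: "nat \<Rightarrow> (nat \<Rightarrow> ('x \<times> 'y) pmf) \<Rightarrow> 'x pmf set" where
  "marginals m P = (\<lambda>i. map_pmf fst (P i)) ` {1..m}"

definition components :: "nat \<Rightarrow> (nat \<Rightarrow> ('x \<times> 'y) pmf) \<Rightarrow> 'x pmf \<Rightarrow> nat set" where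
  "components m P Q = {i \<in> {1..m}. map_pmf fst (P i) = Q}"


section \<open>Auxiliary variable\<close>

text \<open>
  A channel from \<open>X\<close> to \<open>U\<close> is a function \<open>W\<close> with \<open>W x\<close> the law of \<open>U\<close> given \<open>X = x\<close>.
  Finite alphabets of \<open>U\<close> of every size are covered by finitely supported laws on \<open>nat\<close>,
  as \<open>X\<close> itself ranges over a finite type.
\<close>

definition joint_XU :: "'x pmf \<Rightarrow> ('x \<Rightarrow> nat pmf) \<Rightarrow> ('x \<times> nat) pmf" where
  "joint_XU Q W = do {x \<leftarrow> Q; u \<leftarrow> W x; return_pmf (x, u)}"

text \<open>The law of \<open>(Y, U)\<close> when \<open>(X, Y)\<close> has law \<open>p\<close> and \<open>Y - X - U\<close> is a Markov chain.\<close>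

definition joint_YU :: "('x \<times> 'y) pmf \<Rightarrow> ('x \<Rightarrow> nat pmf) \<Rightarrow> ('y \<times> nat) pmf" where
  "joint_YU p W = do {(x, y) \<leftarrow> p; u \<leftarrow> W x; return_pmf (y, u)}"

definition test_channels :: "real \<Rightarrow> 'x::finite pmf \<Rightarrow> ('x \<Rightarrow> nat pmf) set" where
  "test_channels Rc Q = {W. (\<forall>x. finite (set_pmf (W x))) \<and> mutual_info (joint_XU Q W) \<le> Rc}"

definition worst_cond_entropy ::
  "nat \<Rightarrow> (nat \<Rightarrow> ('x \<times> 'y) pmf) \<Rightarrow> 'x pmf \<Rightarrow> ('x \<Rightarrow> nat pmf) \<Rightarrow> real" where
  "worst_cond_entropy m P Q W = (MAX i\<in>components m P Q. cond_entropy (joint_YU (P i) W))"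

end

(*
  A test channel is a finite family of columns x |-> W(u|x) adding up to 1, and both the mutual
  information and the conditional entropies are sums over columns of functionals that are homogeneous
  of degree one. Column families can therefore be scaled and concatenated, which is time sharing.

  Converse: induction on the block length. Conditioning on the first letter X_1 = x turns an encoder
  on words of length n + 1 into encoders on words of length n, and the log-sum inequality lets one add
  up their column families together with the columns of X_1 -> M. The family so obtained depends only
  on the law of X^n, hence is the same for all components with a common X-marginal. Fano's inequality
  bounds the equivocation of a good code.

  Direct part: the helper picks the marginal of maximal likelihood (the error decays exponentially by
  the Bhattacharyya bound) and then covers X^n by a codeword of the corresponding test channel; the
  main encoder bins Y^n, and the decoder looks for a word of the bin that is conditionally typical for
  some component with that marginal. Both random choices are made greedily, against an average.

  The minimum is attained: by conic Caratheodory a bounded number of columns suffices, and then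
  compactness applies.
*)

theory Submission
  imports Defs "HOL-Real_Asymp.Real_Asymp"
begin

text \<open>The difficulty is uniformity in the component index. The helper sees only X^n, so one
  test channel has to serve every component with the same X-marginal: \<open>column_family\<close>
  ties a single list of columns to all values \<open>B i\<close> at once, and in the covering
  argument a codeword must be good for all these components simultaneously. The encoder of Y^n knows
  neither marginal nor component, so one binning rate must suit the worst marginal; this gives the
  outer maximum. Announcing the selected marginal multiplies the helper's message set by a bounded
  factor and costs no rate. In the converse all weights are positive, so a vanishing error of the
  mixture bounds the error of each component, and one sufficiently long block is enough. The region
  is a closure, hence the bound first appears with the larger helper rate
  \<open>Rc + 2 * \<epsilon>\<close>. Shrinking the family by
  \<open>\<theta> = Rc / (Rc + 2 * \<epsilon>)\<close> and filling up with the constant column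
  brings it back to \<open>Rc\<close>; the converse relies on \<open>0 < Rc\<close> here, since it
  makes \<theta> tend to 1.\<close>

section \<open>Entropy of finite measures\<close>

definition xl :: "real \<Rightarrow> real" where
  "xl t = t * ln t"

text \<open>Unnormalised entropy: the mass of \<open>f\<close> times the entropy of its normalisation.\<close>

definition ent :: "('a \<Rightarrow> real) \<Rightarrow> 'a set \<Rightarrow> real" where
  "ent f A = xl (sum f A) - (\<Sum>a\<in>A. xl (f a))"

lemma xl_0 [simp]: "xl 0 = 0" and xl_1 [simp]: "xl 1 = 0"
  by (simp_all add: xl_def)

text \<open>This Leibniz rule is the source of all homogeneity below: in \<open>ent\<close> and
  \<open>col_info\<close> the terms containing \<open>xl c\<close> cancel.\<close>

lemma xl_mult: "0 \<le> c \<Longrightarrow> 0 \<le> t \<Longrightarrow> xl (c * t) = c * xl t + t * xl c"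
  by (cases "c = 0 \<or> t = 0") (auto simp: xl_def ln_mult algebra_simps)

lemma continuous_xl: "continuous (at t within {0..}) xl"
proof (cases "t = 0")
  case True
  have "((\<lambda>t::real. t * ln t) \<longlongrightarrow> 0) (at_right 0)"
    by real_asymp
  then have "(xl \<longlongrightarrow> 0) (at 0 within {0..})"
    unfolding at_within_Ici_at_right xl_def .
  then show ?thesis
    unfolding continuous_within True xl_0 .
next
  case False
  show ?thesis
  proof (cases "0 < t")
    case True
    then show ?thesis
      unfolding xl_def by (intro continuous_intros) auto
  next
    \<comment> \<open>A negative point is outside the closed half-line, so the filter is trivial and
      continuity is vacuous.\<close>
    case neg: False
    with False have "at t within {0..} = bot"
      by (intro at_within_eq_bot_iff[THEN iffD2]) (auto simp: closure_closed)
    then show ?thesis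
      by (simp add: continuous_bot)
  qed
qed

lemma continuous_on_xl: "continuous_on {0..} xl"
  by (simp add: continuous_on_eq_continuous_within continuous_xl)

lemma continuous_on_xl_comp [continuous_intros]:
  assumes "continuous_on S f" and "\<And>s. s \<in> S \<Longrightarrow> 0 \<le> f s"
  shows "continuous_on S (\<lambda>s. xl (f s))"
  using continuous_on_compose2[OF continuous_on_xl assms(1)] assms(2) by auto

lemma ent_eq:
  "ent f A = (\<Sum>a\<in>A. f a * (ln (sum f A) - ln (f a)))"
  by (simp add: ent_def xl_def sum_distrib_right right_diff_distrib sum_subtractf)

lemma ent_cmult:
  assumes "0 \<le> c" and "\<And>a. a \<in> A \<Longrightarrow> 0 \<le> f a"
  shows "ent (\<lambda>a. c * f a) A = c * ent f A"
proof -
  have "xl (\<Sum>a\<in>A. c * f a) = c * xl (sum f A) + sum f A * xl c"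
    using assms by (simp add: sum_distrib_left[symmetric] xl_mult sum_nonneg)
  moreover have "(\<Sum>a\<in>A. xl (c * f a)) = (\<Sum>a\<in>A. c * xl (f a) + f a * xl c)"
    using assms by (intro sum.cong) (auto simp: xl_mult)
  ultimately show ?thesis
    by (simp add: ent_def sum.distrib sum_distrib_left sum_distrib_right right_diff_distrib)
qed

text \<open>This is ln z <= z - 1 at z = P r / p, multiplied by p. The correction
  \<open>P * r - p\<close> is kept because it sums to at most 0 over a sub-probability
  \<open>r\<close>, and to exactly 0 in the comparison with a normalised mixture.\<close>

lemma gibbs_term:
  fixes p P r :: real
  assumes "0 \<le> p" "p \<le> P" "0 < r"
  shows "p * (ln P - ln p) \<le> p * (- ln r) + (P * r - p)"
proof (cases "p = 0")
  case True
  then show ?thesis using assms by simp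
next
  case False
  then have p: "0 < p" "0 < P" using assms by auto
  have "ln (P * r / p) \<le> P * r / p - 1"
    using p assms by (intro ln_le_minus_one) simp
  then have "p * (ln P + ln r - ln p) \<le> p * (P * r / p - 1)"
    using p assms by (intro mult_left_mono) (auto simp: ln_mult ln_div)
  then show ?thesis using p by (simp add: algebra_simps)
qed

text \<open>Gibbs' inequality against a sub-probability \<open>r\<close>. A uniform \<open>r\<close>
  gives the cardinality bound, and a reference favouring the decoder's list gives Fano's
  inequality.\<close>

lemma ent_le_cross:
  assumes "finite A" and f: "\<And>a. a \<in> A \<Longrightarrow> 0 \<le> f a"
    and r: "\<And>a. a \<in> A \<Longrightarrow> 0 < r a" and "sum r A \<le> 1"
  shows "ent f A \<le> (\<Sum>a\<in>A. f a * (- ln (r a)))"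
proof -
  have "ent f A \<le> (\<Sum>a\<in>A. f a * (- ln (r a)) + (sum f A * r a - f a))"
    unfolding ent_eq using f r assms(1)
    by (intro sum_mono gibbs_term) (auto intro: member_le_sum)
  also have "\<dots> = (\<Sum>a\<in>A. f a * (- ln (r a))) + (sum f A * sum r A - sum f A)"
    unfolding sum.distrib sum_subtractf sum_distrib_left ..
  also have "\<dots> \<le> (\<Sum>a\<in>A. f a * (- ln (r a)))"
    using mult_left_mono[OF assms(4), of "sum f A"] f by (simp add: sum_nonneg)
  finally show ?thesis .
qed

lemma ent_nonneg:
  assumes "finite A" and f: "\<And>a. a \<in> A \<Longrightarrow> 0 \<le> f a"
  shows "0 \<le> ent f A"
  unfolding ent_eq
proof (intro sum_nonneg)
  fix a assume a: "a \<in> A"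
  then have "f a \<le> sum f A" using assms by (intro member_le_sum) auto
  then show "0 \<le> f a * (ln (sum f A) - ln (f a))"
    using f[OF a] by (cases "f a = 0") (auto simp: ln_le_cancel_iff)
qed

lemma ent_le_ln_card:
  assumes "finite A" "A \<noteq> {}" and f: "\<And>a. a \<in> A \<Longrightarrow> 0 \<le> f a"
  shows "ent f A \<le> sum f A * ln (card A)"
proof -
  have "0 < card A" using assms by (simp add: card_gt_0_iff)
  then have "ent f A \<le> (\<Sum>a\<in>A. f a * (- ln (1 / real (card A))))"
    using assms by (intro ent_le_cross) auto
  also have "\<dots> = sum f A * ln (card A)"
    using \<open>0 < card A\<close> by (simp add: sum_distrib_right ln_div)
  finally show ?thesis .
qed

text \<open>The log-sum inequality, that is, concavity of entropy in unnormalised form: both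
  summands are compared with the same reference, for which the cross entropy of their sum is its
  entropy.\<close>

lemma ent_superadd2:
  assumes "finite A" and f: "\<And>a. a \<in> A \<Longrightarrow> 0 \<le> f a" and g: "\<And>a. a \<in> A \<Longrightarrow> 0 \<le> g a"
  shows "ent f A + ent g A \<le> ent (\<lambda>a. f a + g a) A"
proof -
  let ?F = "sum f A" and ?G = "sum g A"
  have nn: "0 \<le> ?F" "0 \<le> ?G" using f g by (auto intro: sum_nonneg)
  have le: "f a \<le> ?F" "g a \<le> ?G" if "a \<in> A" for a
    using that assms by (auto intro: member_le_sum)
  have tm: "f a * (ln ?F - ln (f a)) + g a * (ln ?G - ln (g a))
      \<le> (f a + g a) * (ln (?F + ?G) - ln (f a + g a))" if a: "a \<in> A" for a
  proof (cases "f a + g a = 0")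
    case True
    then have "f a = 0" "g a = 0" using f[OF a] g[OF a] by auto
    then show ?thesis by simp
  next
    case False
    then have pos: "0 < f a + g a" using f[OF a] g[OF a] by auto
    then have FG: "0 < ?F + ?G" using le[OF a] by linarith
    \<comment> \<open>The normalised mixture as reference makes the two corrections from
      \<open>gibbs_term\<close> cancel.\<close>
    define r where "r = (f a + g a) / (?F + ?G)"
    have r: "0 < r" and lnr: "ln r = ln (f a + g a) - ln (?F + ?G)"
      using pos FG by (auto simp: r_def ln_div)
    have "f a * (ln ?F - ln (f a)) + g a * (ln ?G - ln (g a))
        \<le> (f a * (- ln r) + (?F * r - f a)) + (g a * (- ln r) + (?G * r - g a))"
      using f[OF a] g[OF a] le[OF a] r by (intro add_mono gibbs_term)
    also have "\<dots> = (f a + g a) * (- ln r) + ((?F + ?G) * r - (f a + g a))"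
      by (simp add: algebra_simps)
    also have "(?F + ?G) * r - (f a + g a) = 0" using FG by (simp add: r_def)
    finally show ?thesis by (simp add: lnr)
  qed
  show ?thesis
    unfolding ent_eq sum.distrib by (subst sum.distrib[symmetric], intro sum_mono tm)
qed

lemma ent_superadd:
  assumes "finite A" "finite J" and "\<And>j. j \<in> J \<Longrightarrow> 0 \<le> c j"
    and "\<And>j a. j \<in> J \<Longrightarrow> a \<in> A \<Longrightarrow> 0 \<le> f j a"
  shows "(\<Sum>j\<in>J. c j * ent (f j) A) \<le> ent (\<lambda>a. \<Sum>j\<in>J. c j * f j a) A"
  using assms(2-4)
proof (induction J rule: finite_induct)
  case empty
  then show ?case by (simp add: ent_def)
next
  case (insert j J)
  have "(\<Sum>j\<in>insert j J. c j * ent (f j) A)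
      \<le> ent (\<lambda>a. c j * f j a) A + ent (\<lambda>a. \<Sum>j\<in>J. c j * f j a) A"
    using insert by (simp add: ent_cmult)
  also have "\<dots> \<le> ent (\<lambda>a. c j * f j a + (\<Sum>j\<in>J. c j * f j a)) A"
    using insert assms(1) by (intro ent_superadd2) (auto intro!: sum_nonneg)
  finally show ?case using insert by simp
qed


section \<open>Words and product laws\<close>

definition words :: "'a set \<Rightarrow> nat \<Rightarrow> 'a list set" where
  "words A n = {zs. set zs \<subseteq> A \<and> length zs = n}"

text \<open>Not restricted to probabilities: conditional laws and likelihood ratios are extended to
  words by the same product.\<close>

definition iid :: "('a \<Rightarrow> real) \<Rightarrow> 'a list \<Rightarrow> real" where
  "iid f zs = prod_list (map f zs)"

lemma iid_simps [simp]: "iid f [] = 1" "iid f (z # zs) = f z * iid f zs"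
  by (simp_all add: iid_def)

lemma words_UNIV: "words UNIV n = {zs. length zs = n}"
  by (simp add: words_def)

lemma finite_words [simp]: "finite A \<Longrightarrow> finite (words A n)"
  by (simp add: words_def finite_lists_length_eq)

lemma words_0 [simp]: "words A 0 = {[]}"
  by (auto simp: words_def)

lemma words_Suc: "words A (Suc n) = (\<lambda>(z, zs). z # zs) ` (A \<times> words A n)"
  by (auto simp: words_def image_iff length_Suc_conv)

lemma sum_words_Suc: "sum h (words A (Suc n)) = (\<Sum>z\<in>A. \<Sum>zs\<in>words A n. h (z # zs))"
proof -
  have "sum h (words A (Suc n)) = (\<Sum>(z, zs)\<in>A \<times> words A n. h (z # zs))"
    unfolding words_Suc by (subst sum.reindex) (auto simp: inj_on_def case_prod_unfold)
  then show ?thesis by (simp add: sum.cartesian_product)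
qed

lemma iid_nonneg: "(\<And>z. z \<in> set zs \<Longrightarrow> 0 \<le> f z) \<Longrightarrow> 0 \<le> iid f zs"
  by (induction zs) auto

lemma iid_pos: "(\<And>z. z \<in> set zs \<Longrightarrow> 0 < f z) \<Longrightarrow> 0 < iid f zs"
  by (induction zs) auto

lemma iid_mono:
  "(\<And>z. z \<in> set zs \<Longrightarrow> 0 \<le> f z) \<Longrightarrow> (\<And>z. z \<in> set zs \<Longrightarrow> f z \<le> g z) \<Longrightarrow> iid f zs \<le> iid g zs"
proof (induction zs)
  case (Cons z zs)
  then have "0 \<le> g z" using order_trans[of 0 "f z" "g z"] by simp
  with Cons show ?case by (auto intro!: mult_mono iid_nonneg)
qed simp

lemma iid_le_1:
  assumes "\<And>z. z \<in> set zs \<Longrightarrow> 0 \<le> f z" and "\<And>z. z \<in> set zs \<Longrightarrow> f z \<le> 1"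
  shows "iid f zs \<le> 1"
proof -
  have "iid (\<lambda>_. 1) zs = (1::real)" by (induction zs) auto
  then show ?thesis using assms iid_mono[of zs f "\<lambda>_. 1"] by simp
qed

lemma iid_mult: "iid (\<lambda>z. f z * g z) zs = iid f zs * iid g zs"
  by (induction zs) auto

lemma ln_iid: "(\<And>z. z \<in> set zs \<Longrightarrow> 0 < f z) \<Longrightarrow> ln (iid f zs) = (\<Sum>z\<leftarrow>zs. ln (f z))"
proof (induction zs)
  case (Cons z zs)
  then have "0 < f z" "0 < iid f zs" by (auto intro: iid_pos)
  with Cons show ?case by (simp add: ln_mult less_imp_neq[THEN not_sym])
qed simp

lemma iid_zero: "z \<in> set zs \<Longrightarrow> f z = 0 \<Longrightarrow> iid f zs = 0"
  by (induction zs) auto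

lemma sum_iid: "(\<Sum>zs\<in>words A n. iid f zs) = sum f A ^ n"
  by (induction n) (simp_all add: sum_words_Suc sum_distrib_left[symmetric] sum_distrib_right[symmetric])

lemma iid_fst_zip:
  "length xs = length ys \<Longrightarrow> iid (\<lambda>(x, y). f x * g (x, y)) (zip xs ys) = iid f xs * iid g (zip xs ys)"
  by (induction xs ys rule: list_induct2) auto

lemma sum_iid_zip:
  "length xs = n \<Longrightarrow> (\<Sum>ys\<in>words B n. iid f (zip xs ys)) = iid (\<lambda>x. \<Sum>y\<in>B. f (x, y)) xs"
  by (induction xs arbitrary: n)
    (auto simp: sum_words_Suc sum_distrib_left[symmetric] sum_distrib_right[symmetric])

lemma iid_zip_swap:
  "length xs = length ys \<Longrightarrow> iid f (zip xs ys) = iid (\<lambda>(y, x). f (x, y)) (zip ys xs)"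
  by (induction xs ys rule: list_induct2) auto

lemma sum_iid_zip':
  "length ys = n \<Longrightarrow> (\<Sum>xs\<in>words A n. iid f (zip xs ys)) = iid (\<lambda>y. \<Sum>x\<in>A. f (x, y)) ys"
proof -
  assume ys: "length ys = n"
  have "(\<Sum>xs\<in>words A n. iid f (zip xs ys)) = (\<Sum>xs\<in>words A n. iid (\<lambda>(y, x). f (x, y)) (zip ys xs))"
    by (intro sum.cong refl iid_zip_swap) (auto simp: words_def ys)
  then show ?thesis using sum_iid_zip[OF ys, of "\<lambda>(y, x). f (x, y)" A] by simp
qed

text \<open>Sources are laws on pairs of words, while the moment bounds concern words over a product
  alphabet; this translates between the two.\<close>

lemma sum_words_zip:
  "(\<Sum>zs\<in>words (A \<times> B) n. h zs) = (\<Sum>xs\<in>words A n. \<Sum>ys\<in>words B n. h (zip xs ys))"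
proof (induction n arbitrary: h)
  case (Suc n)
  have "(\<Sum>zs\<in>words (A \<times> B) (Suc n). h zs)
      = (\<Sum>z\<in>A \<times> B. \<Sum>xs\<in>words A n. \<Sum>ys\<in>words B n. h (z # zip xs ys))"
    unfolding sum_words_Suc Suc ..
  also have "\<dots> = (\<Sum>x\<in>A. \<Sum>y\<in>B. \<Sum>xs\<in>words A n. \<Sum>ys\<in>words B n. h ((x, y) # zip xs ys))"
    by (rule sum.cartesian_product')
  also have "\<dots> = (\<Sum>x\<in>A. \<Sum>xs\<in>words A n. \<Sum>y\<in>B. \<Sum>ys\<in>words B n. h ((x, y) # zip xs ys))"
    by (intro sum.cong refl sum.swap)
  also have "\<dots> = (\<Sum>xs\<in>words A (Suc n). \<Sum>ys\<in>words B (Suc n). h (zip xs ys))"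
    by (simp add: sum_words_Suc)
  finally show ?case .
qed simp

lemma pmf_replicate_pmf: "pmf (replicate_pmf n p) zs = (if length zs = n then iid (pmf p) zs else 0)"
proof (induction n arbitrary: zs)
  case 0
  then show ?case by (auto simp: pmf_return)
next
  case (Suc n)
  have eq: "replicate_pmf (Suc n) p = map_pmf (\<lambda>(x, xs). x # xs) (pair_pmf p (replicate_pmf n p))"
    by (simp add: map_pmf_def pair_pmf_def bind_assoc_pmf bind_return_pmf)
  show ?case
  proof (cases zs)
    case Nil
    then have "zs \<notin> set_pmf (replicate_pmf (Suc n) p)"
      unfolding set_replicate_pmf by simp
    then show ?thesis using Nil by (simp add: set_pmf_iff del: replicate_pmf.simps)
  next
    case (Cons z zs')
    have "pmf (replicate_pmf (Suc n) p) zs = pmf (pair_pmf p (replicate_pmf n p)) (z, zs')"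
      unfolding eq using pmf_map_inj'[of "\<lambda>(x, xs). x # xs" _ "(z, zs')"]
      by (simp add: Cons inj_def)
    then show ?thesis by (simp add: pmf_pair Suc Cons)
  qed
qed

lemma pmf_iid_source:
  "pmf (iid_source p n) (xs, ys) =
    (if length xs = n \<and> length ys = n then iid (pmf p) (zip xs ys) else 0)"
proof (cases "length xs = n \<and> length ys = n")
  case True
  let ?f = "\<lambda>zs. (map fst zs, map snd zs)"
  have inj: "inj ?f"
    by (rule injI) (metis prod.inject zip_map_fst_snd)
  have "?f (zip xs ys) = (xs, ys)" using True by simp
  then have "pmf (iid_source p n) (xs, ys) = pmf (replicate_pmf n p) (zip xs ys)"
    unfolding iid_source_def using pmf_map_inj'[OF inj, of "replicate_pmf n p" "zip xs ys"] by simp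
  then show ?thesis using True by (simp add: pmf_replicate_pmf)
next
  case False
  have "(xs, ys) \<notin> set_pmf (iid_source p n)"
    unfolding iid_source_def using False by (auto simp: set_replicate_pmf)
  then show ?thesis using False by (auto simp: set_pmf_iff)
qed


section \<open>Test channels as families of columns\<close>

text \<open>
  A channel \<open>W\<close> is the family of its columns \<open>\<lambda>x. W(u|x)\<close>, which sum to the constant \<open>1\<close>.
  Mutual information and conditional entropy are sums over columns of
  functionals that are homogeneous of degree one, so families may be rescaled and concatenated.
\<close>

definition col_info :: "'x::finite pmf \<Rightarrow> ('x \<Rightarrow> real) \<Rightarrow> real" where
  "col_info Q v = (\<Sum>x\<in>UNIV. pmf Q x * xl (v x)) - xl (\<Sum>x\<in>UNIV. pmf Q x * v x)"

text \<open>If \<open>v\<close> is the column of a value u, this is Pr(U = u) H(Y | U = u). Likewise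
  \<open>col_info\<close> is Pr(U = u) times the divergence of the posterior of X given u from
  \<open>Q\<close>.\<close>

definition col_ent :: "('x::finite \<times> 'y::finite) pmf \<Rightarrow> ('x \<Rightarrow> real) \<Rightarrow> real" where
  "col_ent p v = ent (\<lambda>y. \<Sum>x\<in>UNIV. pmf p (x, y) * v x) UNIV"

text \<open>The list \<open>vs\<close> is chosen before \<open>i\<close>, so the same channel has to
  realise all \<open>B i\<close>. The total \<open>c\<close> is free: it counts letters in the
  converse and is normalised to 1 only at the end. Lists allow repeated columns.\<close>

definition column_family ::
  "'x::finite pmf \<Rightarrow> ('i \<Rightarrow> ('x \<times> 'y::finite) pmf) \<Rightarrow> real \<Rightarrow> real \<Rightarrow> ('i \<Rightarrow> real) \<Rightarrow> bool" where
  "column_family Q P c A B \<longleftrightarrow> (\<exists>vs. (\<forall>v\<in>set vs. \<forall>x. 0 \<le> v x) \<and> (\<forall>x. (\<Sum>v\<leftarrow>vs. v x) = c) \<and>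
     (\<Sum>v\<leftarrow>vs. col_info Q v) = A \<and> (\<forall>i. (\<Sum>v\<leftarrow>vs. col_ent (P i) v) = B i))"

lemma sum_pmf_UNIV [simp]: "(\<Sum>x\<in>UNIV. pmf (Q :: 'a::finite pmf) x) = 1"
  by (rule sum_pmf_eq_1) auto

lemma pmf_map_snd_sum:
  fixes J :: "('a::finite \<times> 'b) pmf"
  shows "pmf (map_pmf snd J) b = (\<Sum>a\<in>UNIV. pmf J (a, b))"
proof -
  have "pmf (map_pmf snd J) b = measure_pmf.prob J ((\<lambda>a. (a, b)) ` UNIV)"
    by (auto simp: pmf_map intro!: arg_cong[where f = "measure_pmf.prob J"])
  also have "\<dots> = (\<Sum>a\<in>UNIV. pmf J (a, b))"
    by (subst measure_measure_pmf_finite) (auto simp: sum.reindex inj_on_def)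
  finally show ?thesis .
qed

lemma pmf_map_fst_sum:
  fixes J :: "('a \<times> 'b::finite) pmf"
  shows "pmf (map_pmf fst J) a = (\<Sum>b\<in>UNIV. pmf J (a, b))"
proof -
  have "pmf (map_pmf fst J) a = measure_pmf.prob J ((\<lambda>b. (a, b)) ` UNIV)"
    by (auto simp: pmf_map intro!: arg_cong[where f = "measure_pmf.prob J"])
  also have "\<dots> = (\<Sum>b\<in>UNIV. pmf J (a, b))"
    by (subst measure_measure_pmf_finite) (auto simp: sum.reindex inj_on_def)
  finally show ?thesis .
qed

lemma col_info_cmult:
  assumes "0 \<le> c" and "\<And>x. 0 \<le> v x"
  shows "col_info Q (\<lambda>x. c * v x) = c * col_info Q v"
proof -
  have "(\<Sum>x\<in>UNIV. pmf Q x * xl (c * v x))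
      = (\<Sum>x\<in>UNIV. c * (pmf Q x * xl (v x)) + pmf Q x * v x * xl c)"
    using assms by (intro sum.cong) (auto simp: xl_mult algebra_simps)
  moreover have "xl (\<Sum>x\<in>UNIV. pmf Q x * (c * v x))
      = c * xl (\<Sum>x\<in>UNIV. pmf Q x * v x) + (\<Sum>x\<in>UNIV. pmf Q x * v x) * xl c"
    using xl_mult[of c "\<Sum>x\<in>UNIV. pmf Q x * v x"] assms
    by (simp add: sum_distrib_left sum_nonneg mult.left_commute)
  ultimately show ?thesis
    by (simp add: col_info_def sum.distrib sum_distrib_left[symmetric] sum_distrib_right[symmetric]
        right_diff_distrib)
qed

lemma col_ent_cmult:
  assumes "0 \<le> c" and "\<And>x. 0 \<le> v x"
  shows "col_ent p (\<lambda>x. c * v x) = c * col_ent p v"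
  using ent_cmult[of c UNIV "\<lambda>y. \<Sum>x\<in>UNIV. pmf p (x, y) * v x"] assms
  by (simp add: col_ent_def sum_distrib_left sum_nonneg mult.left_commute)

lemma col_ent_nonneg: "(\<And>x. 0 \<le> v x) \<Longrightarrow> 0 \<le> col_ent p v"
  unfolding col_ent_def by (intro ent_nonneg) (auto intro!: sum_nonneg)

lemma col_info_const: "col_info Q (\<lambda>x. 1) = 0"
  by (simp add: col_info_def)

lemma column_family_finite:
  assumes "finite J" and "\<And>j x. j \<in> J \<Longrightarrow> 0 \<le> v j x" and "\<And>x. (\<Sum>j\<in>J. v j x) = c"
  shows "column_family Q P c (\<Sum>j\<in>J. col_info Q (v j)) (\<lambda>i. \<Sum>j\<in>J. col_ent (P i) (v j))"
proof -
  obtain js where js: "set js = J" "distinct js"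
    using finite_distinct_list[OF assms(1)] by auto
  show ?thesis
    unfolding column_family_def using assms js
    by (intro exI[of _ "map v js"]) (auto simp: sum_list_distinct_conv_sum_set o_def)
qed

lemma column_family_add:
  assumes "column_family Q P c A B" and "column_family Q P c' A' B'"
  shows "column_family Q P (c + c') (A + A') (\<lambda>i. B i + B' i)"
proof -
  obtain vs vs' where
    "\<forall>v\<in>set vs. \<forall>x. 0 \<le> v x" "\<forall>x. (\<Sum>v\<leftarrow>vs. v x) = c"
    "(\<Sum>v\<leftarrow>vs. col_info Q v) = A" "\<forall>i. (\<Sum>v\<leftarrow>vs. col_ent (P i) v) = B i"
    "\<forall>v\<in>set vs'. \<forall>x. 0 \<le> v x" "\<forall>x. (\<Sum>v\<leftarrow>vs'. v x) = c'"
    "(\<Sum>v\<leftarrow>vs'. col_info Q v) = A'" "\<forall>i. (\<Sum>v\<leftarrow>vs'. col_ent (P i) v) = B' i"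
    using assms unfolding column_family_def by blast
  then show ?thesis
    unfolding column_family_def by (intro exI[of _ "vs @ vs'"]) auto
qed

lemma column_family_scale:
  assumes "column_family Q P c A B" and a: "0 \<le> a"
  shows "column_family Q P (a * c) (a * A) (\<lambda>i. a * B i)"
proof -
  obtain vs where vs: "\<forall>v\<in>set vs. \<forall>x. 0 \<le> v x" "\<forall>x. (\<Sum>v\<leftarrow>vs. v x) = c"
    "(\<Sum>v\<leftarrow>vs. col_info Q v) = A" "\<forall>i. (\<Sum>v\<leftarrow>vs. col_ent (P i) v) = B i"
    using assms unfolding column_family_def by blast
  let ?ws = "map (\<lambda>v x. a * v x) vs"
  have "(\<Sum>w\<leftarrow>?ws. col_info Q w) = (\<Sum>v\<leftarrow>vs. a * col_info Q v)"
    using vs(1) a by (auto simp: o_def col_info_cmult intro!: arg_cong[where f = sum_list])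
  moreover have "(\<Sum>w\<leftarrow>?ws. col_ent (P i) w) = (\<Sum>v\<leftarrow>vs. a * col_ent (P i) v)" for i
    using vs(1) a by (auto simp: o_def col_ent_cmult intro!: arg_cong[where f = sum_list])
  ultimately show ?thesis
    unfolding column_family_def using vs a
    by (intro exI[of _ ?ws]) (auto simp: o_def sum_list_const_mult)
qed

lemma column_family_sum:
  assumes "finite K" and "\<And>k. k \<in> K \<Longrightarrow> 0 \<le> a k"
    and "\<And>k. k \<in> K \<Longrightarrow> column_family Q P c (A k) (B k)"
  shows "column_family Q P (sum a K * c) (\<Sum>k\<in>K. a k * A k) (\<lambda>i. \<Sum>k\<in>K. a k * B k i)"
  using assms
proof (induction K rule: finite_induct)
  case empty
  show ?case unfolding column_family_def by (intro exI[of _ "[]"]) auto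
next
  case (insert k K)
  then show ?case
    using column_family_add[OF column_family_scale[of Q P c "A k" "B k" "a k"], of "sum a K * c"]
    by (simp add: distrib_right)
qed

section \<open>Dictionary between finitely supported channels and families of columns\<close>

lemma pmf_joint_XU:
  fixes Q :: "'x::finite pmf"
  shows "pmf (joint_XU Q W) (x, u) = pmf Q x * pmf (W x) u"
proof -
  have cs: "pmf (W x' \<bind> (\<lambda>u. return_pmf (x', u))) (x, u) = (if x' = x then pmf (W x) u else 0)" for x'
  proof -
    have eq: "W x' \<bind> (\<lambda>u. return_pmf (x', u)) = map_pmf (Pair x') (W x')"
      by (simp add: map_pmf_def)
    show ?thesis
    proof (cases "x' = x")
      case True
      then show ?thesis unfolding eq by (simp add: pmf_map_inj' inj_def)
    next
      case False
      then have "(x, u) \<notin> set_pmf (map_pmf (Pair x') (W x'))" by auto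
      then have "pmf (map_pmf (Pair x') (W x')) (x, u) = 0"
        by (rule pmf_eq_0_set_pmf[THEN iffD2])
      with False show ?thesis unfolding eq by simp
    qed
  qed
  show ?thesis
    unfolding joint_XU_def pmf_bind[of Q] cs
    by (subst integral_measure_pmf_real[of UNIV])
      (auto simp: if_distrib[where f = "\<lambda>t. t * _"] cong: if_cong)
qed

lemma pmf_joint_YU:
  fixes p :: "('x::finite \<times> 'y::finite) pmf"
  shows "pmf (joint_YU p W) (y, u) = (\<Sum>x\<in>UNIV. pmf p (x, y) * pmf (W x) u)"
proof -
  \<comment> \<open>The pair (X, Y) is treated as the input letter of a channel that ignores Y;
    afterwards X is forgotten.\<close>
  have "joint_YU p W = map_pmf (\<lambda>((x, y), u). (y, u)) (joint_XU p (\<lambda>(x, y). W x))"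
    by (simp add: joint_YU_def joint_XU_def map_bind_pmf case_prod_unfold)
  then have "pmf (joint_YU p W) (y, u)
      = measure_pmf.prob (joint_XU p (\<lambda>(x, y). W x)) ((\<lambda>x. ((x, y), u)) ` UNIV)"
    by (auto simp: pmf_map intro!: arg_cong[where f = "measure_pmf.prob _"])
  also have "\<dots> = (\<Sum>x\<in>UNIV. pmf p (x, y) * pmf (W x) u)"
    by (subst measure_measure_pmf_finite) (auto simp: sum.reindex inj_on_def pmf_joint_XU)
  finally show ?thesis .
qed

text \<open>Zero columns contribute nothing, so \<open>J\<close> may be any finite superset of the
  supports. The union of the supports and the ranges \<open>{..<k}\<close> are both used.\<close>

lemma mutual_info_columns:
  fixes Q :: "'x::finite pmf"
  assumes J: "finite J" and sub: "\<And>x. set_pmf (W x) \<subseteq> J"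
  shows "mutual_info (joint_XU Q W) = (\<Sum>u\<in>J. col_info Q (\<lambda>x. pmf (W x) u))"
proof -
  let ?J = "joint_XU Q W"
  let ?p = "\<lambda>u. \<Sum>x\<in>UNIV. pmf Q x * pmf (W x) u"
  have set: "set_pmf ?J \<subseteq> UNIV \<times> J"
    using sub by (auto simp: joint_XU_def)
  then have fin: "finite (set_pmf ?J)" by (rule finite_subset) (simp add: J)
  have fst: "map_pmf fst ?J = Q"
    by (simp add: joint_XU_def map_bind_pmf bind_return_pmf')
  have snd: "pmf (map_pmf snd ?J) u = ?p u" for u
    by (simp add: pmf_map_snd_sum pmf_joint_XU)
  have tm: "pmf ?J (x, u) * ln (pmf ?J (x, u) / (pmf Q x * ?p u))
      = pmf Q x * xl (pmf (W x) u) - pmf Q x * pmf (W x) u * ln (?p u)" for x u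
  proof (cases "pmf Q x = 0 \<or> pmf (W x) u = 0")
    case False
    then have pos: "0 < pmf Q x" "0 < pmf (W x) u" by (simp_all add: pmf_pos)
    then have "0 < ?p u" by (intro sum_pos2[of _ x]) auto
    have "a * w * ln (a * w / (a * p)) = a * xl w - a * w * ln p"
      if "0 < a" "0 < w" "0 < p" for a w p :: real
      using that by (simp add: ln_div xl_def right_diff_distrib)
    from this[OF pos \<open>0 < ?p u\<close>] show ?thesis
      unfolding pmf_joint_XU .
  qed (auto simp: pmf_joint_XU)
  have "mutual_info ?J = (\<Sum>(x, u)\<in>UNIV \<times> J.
      pmf ?J (x, u) * ln (pmf ?J (x, u) / (pmf Q x * ?p u)))"
    unfolding mutual_info_eq_sum[OF fin] fst snd using set J
    by (intro sum.mono_neutral_left) (auto simp: set_pmf_iff)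
  also have "\<dots> = (\<Sum>u\<in>J. \<Sum>x\<in>UNIV. pmf Q x * xl (pmf (W x) u) - pmf Q x * pmf (W x) u * ln (?p u))"
    unfolding tm by (subst sum.cartesian_product[symmetric]) (rule sum.swap)
  also have "\<dots> = (\<Sum>u\<in>J. col_info Q (\<lambda>x. pmf (W x) u))"
    by (simp add: col_info_def sum_subtractf sum_distrib_right[symmetric] xl_def)
  finally show ?thesis .
qed

lemma cond_entropy_columns:
  fixes p :: "('x::finite \<times> 'y::finite) pmf"
  assumes J: "finite J" and sub: "\<And>x. set_pmf (W x) \<subseteq> J"
  shows "cond_entropy (joint_YU p W) = (\<Sum>u\<in>J. col_ent p (\<lambda>x. pmf (W x) u))"
proof -
  let ?J = "joint_YU p W"
  let ?k = "\<lambda>y u. \<Sum>x\<in>UNIV. pmf p (x, y) * pmf (W x) u"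
  let ?p = "\<lambda>u. \<Sum>y\<in>UNIV. ?k y u"
  have set: "set_pmf ?J \<subseteq> UNIV \<times> J"
    using subsetD[OF sub] by (auto simp: joint_YU_def)
  then have fin: "finite (set_pmf ?J)" by (rule finite_subset) (simp add: J)
  have snd: "pmf (map_pmf snd ?J) u = ?p u" for u
    by (simp add: pmf_map_snd_sum pmf_joint_YU)
  have tm: "pmf ?J (y, u) * ln (pmf ?J (y, u) / ?p u) = - (?k y u * (ln (?p u) - ln (?k y u)))" for y u
  proof (cases "?k y u = 0")
    case False
    have nn: "0 \<le> ?k y u" for y by (intro sum_nonneg) auto
    with False have pos: "0 < ?k y u" using nn[of y] by linarith
    then have "0 < ?p u" using nn by (intro sum_pos2[of _ y]) auto
    have "k * ln (k / p) = - (k * (ln p - ln k))" if "0 < k" "0 < p" for k p :: real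
      using that by (simp add: ln_div right_diff_distrib)
    from this[OF pos \<open>0 < ?p u\<close>] show ?thesis
      unfolding pmf_joint_YU .
  qed (simp add: pmf_joint_YU)
  have "cond_entropy ?J = - (\<Sum>(y, u)\<in>UNIV \<times> J. pmf ?J (y, u) * ln (pmf ?J (y, u) / ?p u))"
    unfolding cond_entropy_eq_sum[OF fin] snd using set J
    by (intro arg_cong[where f = uminus] sum.mono_neutral_left) (auto simp: set_pmf_iff)
  also have "\<dots> = (\<Sum>(y, u)\<in>UNIV \<times> J. ?k y u * (ln (?p u) - ln (?k y u)))"
    unfolding tm by (simp add: sum_negf case_prod_unfold)
  also have "\<dots> = (\<Sum>u\<in>J. \<Sum>y\<in>UNIV. ?k y u * (ln (?p u) - ln (?k y u)))"
    by (subst sum.cartesian_product[symmetric]) (rule sum.swap)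
  finally show ?thesis by (simp add: col_ent_def ent_eq)
qed

lemma column_family_of_channel:
  fixes Q :: "'x::finite pmf" and P :: "'i \<Rightarrow> ('x \<times> 'y::finite) pmf"
  assumes fin: "\<And>x. finite (set_pmf (W x))"
  shows "column_family Q P 1 (mutual_info (joint_XU Q W)) (\<lambda>i. cond_entropy (joint_YU (P i) W))"
proof -
  let ?J = "\<Union>x. set_pmf (W x)"
  have J: "finite ?J" "\<And>x. set_pmf (W x) \<subseteq> ?J" using fin by auto
  have "(\<Sum>u\<in>?J. pmf (W x) u) = 1" for x
    using J by (intro sum_pmf_eq_1) auto
  then show ?thesis
    unfolding mutual_info_columns[OF J] cond_entropy_columns[OF J]
    using J by (intro column_family_finite) auto
qed

lemma channel_of_columns:
  fixes v :: "nat \<Rightarrow> 'x::finite \<Rightarrow> real"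
  assumes nn: "\<And>j x. j < k \<Longrightarrow> 0 \<le> v j x" and one: "\<And>x. (\<Sum>j<k. v j x) = 1"
  obtains W where "\<And>x. set_pmf (W x) \<subseteq> {..<k}" and "\<And>x j. j < k \<Longrightarrow> pmf (W x) j = v j x"
    and "\<And>Q. mutual_info (joint_XU Q W) = (\<Sum>j<k. col_info Q (v j))"
    and "\<And>p :: ('x \<times> 'y::finite) pmf. cond_entropy (joint_YU p W) = (\<Sum>j<k. col_ent p (v j))"
proof -
  define W where "W x = embed_pmf (\<lambda>j. if j < k then v j x else 0)" for x
  have pmf: "pmf (W x) j = (if j < k then v j x else 0)" for x j
    unfolding W_def
  proof (rule pmf_embed_pmf)
    show "0 \<le> (if j < k then v j x else 0)" for j using nn by auto
    have "(\<integral>\<^sup>+ j. ennreal (if j < k then v j x else 0) \<partial>count_space UNIV)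
        = (\<Sum>j<k. ennreal (if j < k then v j x else 0))"
      by (intro nn_integral_count_space'[of "{..<k}"]) auto
    also have "\<dots> = ennreal (\<Sum>j<k. v j x)"
      using nn by (subst sum_ennreal[symmetric]) auto
    finally show "(\<integral>\<^sup>+ j. ennreal (if j < k then v j x else 0) \<partial>count_space UNIV) = 1"
      by (simp add: one)
  qed
  have set: "set_pmf (W x) \<subseteq> {..<k}" for x
    by (auto simp: set_pmf_iff pmf split: if_splits)
  show ?thesis
  proof
    show "mutual_info (joint_XU Q W) = (\<Sum>j<k. col_info Q (v j))" for Q
      by (subst mutual_info_columns[OF finite_lessThan set]) (auto simp: pmf intro!: sum.cong)
    show "cond_entropy (joint_YU p W) = (\<Sum>j<k. col_ent p (v j))" for p :: "('x \<times> 'y) pmf"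
      by (subst cond_entropy_columns[OF finite_lessThan set]) (auto simp: pmf intro!: sum.cong)
  qed (use set pmf in auto)
qed

text \<open>The values of U are the positions in the list, which keeps equal columns apart.\<close>

lemma channel_of_column_family:
  fixes Q :: "'x::finite pmf" and P :: "'i \<Rightarrow> ('x \<times> 'y::finite) pmf"
  assumes "column_family Q P 1 A B"
  obtains W where "\<And>x. finite (set_pmf (W x))" and "mutual_info (joint_XU Q W) = A"
    and "\<And>i. cond_entropy (joint_YU (P i) W) = B i"
proof -
  obtain vs where vs: "\<forall>v\<in>set vs. \<forall>x. 0 \<le> v x" "\<forall>x. (\<Sum>v\<leftarrow>vs. v x) = 1"
    "(\<Sum>v\<leftarrow>vs. col_info Q v) = A" "\<forall>i. (\<Sum>v\<leftarrow>vs. col_ent (P i) v) = B i"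
    using assms unfolding column_family_def by blast
  have sum: "(\<Sum>v\<leftarrow>vs. f v) = (\<Sum>j<length vs. f (vs ! j))" for f :: "('x \<Rightarrow> real) \<Rightarrow> real"
    by (simp add: sum_list_sum_nth atLeast0LessThan)
  show ?thesis
  proof (rule channel_of_columns[of "length vs" "(!) vs"])
    show "0 \<le> (vs ! j) x" if "j < length vs" for j x using vs(1) that by auto
    show "(\<Sum>j<length vs. (vs ! j) x) = 1" for x using vs(2) sum[of "\<lambda>v. v x"] by simp
  next
    fix W assume W: "\<And>x. set_pmf (W x) \<subseteq> {..<length vs}"
      "\<And>Q. mutual_info (joint_XU Q W) = (\<Sum>j<length vs. col_info Q (vs ! j))"
      "\<And>p :: ('x \<times> 'y) pmf. cond_entropy (joint_YU p W) = (\<Sum>j<length vs. col_ent p (vs ! j))"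
    show thesis
    proof (rule that[of W])
      show "finite (set_pmf (W x))" for x using W(1) finite_subset by blast
      show "mutual_info (joint_XU Q W) = A" using W(2) vs(3) sum[of "col_info Q"] by simp
      show "cond_entropy (joint_YU (P i) W) = B i" for i
        using W(3) vs(4) sum[of "col_ent (P i)"] by simp
    qed
  qed
qed


section \<open>Converse\<close>

declare sum_mult_of_bool_eq [simp del] sum_of_bool_mult_eq [simp del] sum_of_bool_eq [simp del]

definition msg_law :: "'x::finite pmf \<Rightarrow> nat \<Rightarrow> ('x list \<Rightarrow> 'm) \<Rightarrow> 'm \<Rightarrow> real" where
  "msg_law Q n e m = (\<Sum>xs\<in>words UNIV n. iid (pmf Q) xs * of_bool (e xs = m))"

definition msg_joint ::
  "('x::finite \<times> 'y::finite) pmf \<Rightarrow> nat \<Rightarrow> ('x list \<Rightarrow> 'm) \<Rightarrow> 'm \<Rightarrow> 'y list \<Rightarrow> real" where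
  "msg_joint p n e m ys = (\<Sum>xs\<in>words UNIV n. iid (pmf p) (zip xs ys) * of_bool (e xs = m))"

lemma msg_law_nonneg: "0 \<le> msg_law Q n e m"
  unfolding msg_law_def by (intro sum_nonneg mult_nonneg_nonneg iid_nonneg) auto

lemma msg_joint_nonneg: "0 \<le> msg_joint p n e m ys"
  unfolding msg_joint_def by (intro sum_nonneg mult_nonneg_nonneg iid_nonneg) auto

text \<open>After conditioning on the first letter, \<open>\<lambda>xs. e (x # xs)\<close> is again
  an encoder into the same message set; this drives the induction of the converse.\<close>

lemma msg_law_Suc: "msg_law Q (Suc n) e m = (\<Sum>x\<in>UNIV. pmf Q x * msg_law Q n (\<lambda>xs. e (x # xs)) m)"
  by (simp add: msg_law_def sum_words_Suc sum_distrib_left mult.assoc)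

lemma msg_joint_Suc:
  "msg_joint p (Suc n) e m (y # ys)
    = (\<Sum>x\<in>UNIV. pmf p (x, y) * msg_joint p n (\<lambda>xs. e (x # xs)) m ys)"
  by (simp add: msg_joint_def sum_words_Suc sum_distrib_left mult.assoc)

lemma sum_msg_law:
  assumes "finite K" and "e \<in> words UNIV n \<rightarrow> K"
  shows "(\<Sum>m\<in>K. msg_law Q n e m) = 1"
proof -
  have "(\<Sum>m\<in>K. msg_law Q n e m)
      = (\<Sum>xs\<in>words UNIV n. iid (pmf Q) xs * (\<Sum>m\<in>K. of_bool (e xs = m)))"
    unfolding msg_law_def by (subst sum.swap) (simp add: sum_distrib_left)
  also have "\<dots> = (\<Sum>xs\<in>words UNIV n. iid (pmf Q) xs)"
    using assms by (intro sum.cong) (auto simp: Pi_iff of_bool_def)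
  finally show ?thesis by (simp add: sum_iid)
qed

text \<open>The message depends on X^n alone, so its law sees only the X-marginal of
  \<open>p\<close>. Hence all components with that marginal share their columns.\<close>

lemma sum_msg_joint:
  fixes p :: "('x::finite \<times> 'y::finite) pmf"
  shows "(\<Sum>ys\<in>words UNIV n. msg_joint p n e m ys) = msg_law (map_pmf fst p) n e m"
proof -
  have "(\<Sum>ys\<in>words UNIV n. msg_joint p n e m ys)
      = (\<Sum>xs\<in>words UNIV n. (\<Sum>ys\<in>words UNIV n. iid (pmf p) (zip xs ys)) * of_bool (e xs = m))"
    unfolding msg_joint_def by (subst sum.swap) (simp add: sum_distrib_right)
  also have "\<dots> = msg_law (map_pmf fst p) n e m"
    unfolding msg_law_def
  proof (intro sum.cong refl)
    fix xs :: "'x list" assume "xs \<in> words UNIV n"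
    then show "(\<Sum>ys\<in>words UNIV n. iid (pmf p) (zip xs ys)) * of_bool (e xs = m)
        = iid (pmf (map_pmf fst p)) xs * of_bool (e xs = m)"
      by (subst sum_iid_zip) (simp_all add: words_def pmf_map_fst_sum[abs_def])
  qed
  finally show ?thesis .
qed

text \<open>The chain rule; unnormalised conditional entropies enter without weights.\<close>

lemma ent_words_Suc:
  "ent f (words A (Suc n))
    = ent (\<lambda>y. \<Sum>ys\<in>words A n. f (y # ys)) A + (\<Sum>y\<in>A. ent (\<lambda>ys. f (y # ys)) (words A n))"
  by (simp add: ent_def sum_words_Suc sum_subtractf)

text \<open>The invariant is A <= H(M) and B i <= H(Y^n | M). In the step H(M) = I(X_1; M) + H(M |
  X_1) holds exactly, while H(Y^{n+1} | M) is H(Y_1 | M) plus an entropy given M and Y_1, which can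
  only decrease when X_1 joins the condition. Each letter contributes columns of total 1, hence the
  total \<open>n\<close>.\<close>

lemma column_family_of_code:
  fixes P :: "'i \<Rightarrow> ('x::finite \<times> 'y::finite) pmf"
  assumes K: "finite K" and PQ: "\<And>i. i \<in> I \<Longrightarrow> map_pmf fst (P i) = Q"
    and e: "e \<in> words UNIV n \<rightarrow> K"
  shows "\<exists>A B. column_family Q P (real n) A B \<and> A \<le> ent (msg_law Q n e) K \<and>
    (\<forall>i\<in>I. B i \<le> (\<Sum>m\<in>K. ent (msg_joint (P i) n e m) (words UNIV n)))"
  using e
proof (induction n arbitrary: e)
  case 0
  have "column_family Q P 0 0 (\<lambda>i. 0)"
    unfolding column_family_def by (intro exI[of _ "[]"]) auto
  moreover have "0 \<le> ent (msg_law Q 0 e) K"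
    by (intro ent_nonneg K msg_law_nonneg)
  moreover have "0 \<le> (\<Sum>m\<in>K. ent (msg_joint (P i) 0 e m) (words UNIV 0))" for i
    by (intro sum_nonneg ent_nonneg msg_joint_nonneg) auto
  ultimately show ?case by (intro exI[of _ 0] exI[of _ "\<lambda>i. 0"]) simp
next
  case (Suc n)
  define ex where "ex x xs = e (x # xs)" for x xs
  have ex: "ex x \<in> words UNIV n \<rightarrow> K" for x
    using Suc.prems by (auto simp: ex_def words_def Pi_iff)
  obtain A B where AB: "\<And>x. column_family Q P (real n) (A x) (B x)"
      "\<And>x. A x \<le> ent (msg_law Q n (ex x)) K"
      "\<And>x i. i \<in> I \<Longrightarrow> B x i \<le> (\<Sum>m\<in>K. ent (msg_joint (P i) n (ex x) m) (words UNIV n))"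
    using Suc.IH[OF ex] by metis
  \<comment> \<open>The conditional probability of message \<open>m\<close> given X_1 =
    \<open>x\<close>: the channel from the first letter to the message.\<close>
  define v where "v m x = msg_law Q n (ex x) m" for m x
  have v1: "(\<Sum>m\<in>K. v m x) = 1" for x
    unfolding v_def by (rule sum_msg_law[OF K ex])
  have mSuc: "msg_law Q (Suc n) e m = (\<Sum>x\<in>UNIV. pmf Q x * v m x)" for m
    by (simp add: msg_law_Suc v_def ex_def[abs_def])
  let ?A = "(\<Sum>m\<in>K. col_info Q (v m)) + (\<Sum>x\<in>UNIV. pmf Q x * A x)"
  let ?B = "\<lambda>i. (\<Sum>m\<in>K. col_ent (P i) (v m)) + (\<Sum>x\<in>UNIV. pmf Q x * B x i)"
  have "column_family Q P (1 + (\<Sum>x\<in>UNIV. pmf Q x) * real n) ?A ?B"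
    using v1 AB(1) by (intro column_family_add column_family_finite column_family_sum K)
      (auto simp: v_def msg_law_nonneg)
  then have fam: "column_family Q P (real (Suc n)) ?A ?B" by simp
  \<comment> \<open>Information side: I(X_1; M) + H(M | X_1) = H(M).\<close>
  have "?A \<le> (\<Sum>m\<in>K. col_info Q (v m)) + (\<Sum>x\<in>UNIV. pmf Q x * ent (msg_law Q n (ex x)) K)"
    using AB(2) by (intro add_mono sum_mono mult_left_mono) auto
  also have "(\<Sum>x\<in>UNIV. pmf Q x * ent (msg_law Q n (ex x)) K)
      = - (\<Sum>m\<in>K. \<Sum>x\<in>UNIV. pmf Q x * xl (v m x))"
    using v1 unfolding ent_def v_def
    by (subst sum.swap) (simp add: sum_distrib_left sum_negf)
  also have "(\<Sum>m\<in>K. col_info Q (v m)) + - (\<Sum>m\<in>K. \<Sum>x\<in>UNIV. pmf Q x * xl (v m x))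
      = ent (msg_law Q (Suc n) e) K"
    unfolding ent_def sum_msg_law[OF K Suc.prems] mSuc
    by (simp add: col_info_def sum_subtractf)
  finally have A: "?A \<le> ent (msg_law Q (Suc n) e) K" .
  have B: "?B i \<le> (\<Sum>m\<in>K. ent (msg_joint (P i) (Suc n) e m) (words UNIV (Suc n)))" if i: "i \<in> I" for i
  proof -
    let ?J = "\<lambda>x m. msg_joint (P i) n (ex x) m"
    have Q: "pmf Q x = (\<Sum>y\<in>UNIV. pmf (P i) (x, y))" for x
      using PQ[OF i] pmf_map_fst_sum by metis
    have step: "col_ent (P i) (v m) + (\<Sum>x\<in>UNIV. pmf Q x * ent (?J x m) (words UNIV n))
        \<le> ent (msg_joint (P i) (Suc n) e m) (words UNIV (Suc n))" for m
    proof -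
      have J: "msg_joint (P i) (Suc n) e m (y # ys) = (\<Sum>x\<in>UNIV. pmf (P i) (x, y) * ?J x m ys)" for y ys
        by (simp add: msg_joint_Suc ex_def[abs_def])
      have "(\<Sum>ys\<in>words UNIV n. \<Sum>x\<in>UNIV. pmf (P i) (x, y) * ?J x m ys)
          = (\<Sum>x\<in>UNIV. pmf (P i) (x, y) * v m x)" for y
        by (subst sum.swap) (simp add: sum_distrib_left[symmetric] sum_msg_joint PQ[OF i] v_def)
      then have split: "ent (msg_joint (P i) (Suc n) e m) (words UNIV (Suc n))
          = col_ent (P i) (v m)
            + (\<Sum>y\<in>UNIV. ent (\<lambda>ys. \<Sum>x\<in>UNIV. pmf (P i) (x, y) * ?J x m ys) (words UNIV n))"
        by (simp add: ent_words_Suc J col_ent_def)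
      \<comment> \<open>Given X_1, the message and the later Y-letters do not depend on Y_1, so
        \<open>?J x m\<close> carries no \<open>y\<close> and the weight \<open>pmf Q x\<close> can
        be split over \<open>y\<close>. Superadditivity for each \<open>y\<close> then removes X_1
        from the condition.\<close>
      have "(\<Sum>x\<in>UNIV. pmf Q x * ent (?J x m) (words UNIV n))
          = (\<Sum>y\<in>UNIV. \<Sum>x\<in>UNIV. pmf (P i) (x, y) * ent (?J x m) (words UNIV n))"
        by (subst sum.swap) (simp add: Q sum_distrib_right)
      also have "\<dots> \<le> (\<Sum>y\<in>UNIV. ent (\<lambda>ys. \<Sum>x\<in>UNIV. pmf (P i) (x, y) * ?J x m ys) (words UNIV n))"
        by (intro sum_mono ent_superadd msg_joint_nonneg) auto
      finally show ?thesis by (simp add: split)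
    qed
    have "?B i \<le> (\<Sum>m\<in>K. col_ent (P i) (v m))
        + (\<Sum>x\<in>UNIV. pmf Q x * (\<Sum>m\<in>K. ent (?J x m) (words UNIV n)))"
      using AB(3)[OF i] by (intro add_mono sum_mono mult_left_mono) auto
    also have "\<dots> = (\<Sum>m\<in>K. col_ent (P i) (v m)
        + (\<Sum>x\<in>UNIV. pmf Q x * ent (?J x m) (words UNIV n)))"
      unfolding sum_distrib_left sum.distrib by (subst sum.swap) (rule refl)
    also have "\<dots> \<le> (\<Sum>m\<in>K. ent (msg_joint (P i) (Suc n) e m) (words UNIV (Suc n)))"
      by (intro sum_mono step)
    finally show ?thesis .
  qed
  show ?case using fam A B by blast
qed

section \<open>Fano's inequality and normalisation by the block length\<close>

lemma error_prob_sum: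
  fixes S :: "('x::finite list \<times> 'y::finite list) pmf"
  assumes "set_pmf S \<subseteq> words UNIV n \<times> words UNIV n"
  shows "error_prob S c = (\<Sum>xs\<in>words UNIV n. \<Sum>ys\<in>words UNIV n.
    pmf S (xs, ys) * of_bool (dec c (enc1 c xs, enc2 c ys) \<noteq> ys))"
proof -
  let ?E = "{(xs, ys). dec c (enc1 c xs, enc2 c ys) \<noteq> ys}"
  let ?W = "words UNIV n \<times> words UNIV n :: ('x list \<times> 'y list) set"
  have "error_prob S c = measure_pmf.prob S (?E \<inter> ?W)"
    unfolding error_prob_def by (rule measure_prob_cong_0) (use assms in \<open>auto simp: set_pmf_iff\<close>)
  also have "\<dots> = (\<Sum>z\<in>?W. pmf S z * of_bool (z \<in> ?E))"
    by (subst measure_measure_pmf_finite) (auto simp: sum_mult_of_bool_eq Int_commute)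
  finally show ?thesis
    by (simp add: sum.cartesian_product case_prod_unfold)
qed

lemma set_iid_source: "set_pmf (iid_source p n) \<subseteq> words UNIV n \<times> words UNIV n"
  by (auto simp: set_pmf_iff pmf_iid_source words_def split: if_splits)

text \<open>Given the helper's message m, the decoder can output at most |M_2| words. Gibbs'
  inequality is applied with a reference that favours this list; a word off the list is always
  decoded wrongly, so the off-list mass is bounded by the error probability.\<close>

lemma fano_code:
  fixes p :: "('x::finite \<times> 'y::finite) pmf"
  assumes c: "is_wak_code n c"
  shows "(\<Sum>m\<in>msgs1 c. ent (msg_joint p n (enc1 c) m) (words UNIV n))
    \<le> ln 2 + ln (card (msgs2 c)) + error_prob (iid_source p n) c * (real n * ln (CARD('y)))"
proof -
  let ?Y = "words UNIV n :: 'y list set"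
  let ?X = "words UNIV n :: 'x list set"
  have fin: "finite (msgs1 c)" "finite (msgs2 c)"
    and e1: "enc1 c \<in> words UNIV n \<rightarrow> msgs1 c" and e2: "enc2 c \<in> words UNIV n \<rightarrow> msgs2 c"
    and d: "dec c \<in> msgs1 c \<times> msgs2 c \<rightarrow> words UNIV n"
    using c unfolding is_wak_code_def words_UNIV by auto
  obtain ys0 :: "'y list" where "length ys0 = n" using Ex_list_of_length by blast
  then have "enc2 c ys0 \<in> msgs2 c" using e2 by (auto simp: words_UNIV)
  then have k: "1 \<le> card (msgs2 c)" using fin by (metis One_nat_def Suc_leI card_gt_0_iff empty_iff)
  define N where "N = real (card ?Y)"
  have N: "N = real CARD('y) ^ n"
    using card_lists_length_eq[of "UNIV :: 'y set" n] by (simp add: N_def words_def)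
  then have N1: "1 \<le> N" by (simp add: one_le_power Suc_leI)
  have lnN: "ln N = real n * ln (CARD('y))" unfolding N by (simp add: ln_realpow)
  define L where "L m = (\<lambda>b. dec c (m, b)) ` msgs2 c" for m
  \<comment> \<open>At most half of the reference mass lies on the list and at most half off it,
    where the density is that of the uniform law. The two halves account for the
    \<open>ln 2\<close>.\<close>
  define r where "r m ys = (if ys \<in> L m then 1 / (2 * real (card (msgs2 c))) else 1 / (2 * N))" for m ys
  let ?J = "msg_joint p n (enc1 c)"
  have bound: "ent (?J m) ?Y \<le> (\<Sum>ys\<in>?Y. ?J m ys * (ln 2 + ln (card (msgs2 c))))
      + (\<Sum>ys\<in>?Y. ?J m ys * of_bool (ys \<notin> L m)) * ln N" for m
  proof -
    have "sum (r m) ?Y \<le> (\<Sum>ys\<in>?Y. of_bool (ys \<in> L m) * (1 / (2 * real (card (msgs2 c)))) + 1 / (2 * N))"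
      using N1 k by (intro sum_mono) (auto simp: r_def)
    also have "\<dots> = (\<Sum>ys\<in>?Y. of_bool (ys \<in> L m)) * (1 / (2 * real (card (msgs2 c)))) + 1 / 2"
      unfolding sum.distrib sum_distrib_right using N1 by (simp add: N_def[symmetric])
    also have "(\<Sum>ys\<in>?Y. of_bool (ys \<in> L m)) = real (card (?Y \<inter> L m))"
      by (simp add: sum_of_bool_eq Collect_mem_eq)
    also have "\<dots> \<le> real (card (msgs2 c))"
      using card_mono[of "L m" "?Y \<inter> L m"] card_image_le[OF fin(2), of "\<lambda>b. dec c (m, b)"] fin
      by (simp add: L_def)
    finally have "sum (r m) ?Y \<le> 1" using k by (simp add: mult_right_mono field_simps)
    then have "ent (?J m) ?Y \<le> (\<Sum>ys\<in>?Y. ?J m ys * (- ln (r m ys)))"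
      using k N1 by (intro ent_le_cross) (auto simp: r_def msg_joint_nonneg)
    also have "\<dots> \<le> (\<Sum>ys\<in>?Y. ?J m ys * (ln 2 + ln (card (msgs2 c))) + ?J m ys * of_bool (ys \<notin> L m) * ln N)"
    proof (intro sum_mono)
      fix ys
      have "- ln (r m ys) \<le> ln 2 + ln (card (msgs2 c)) + of_bool (ys \<notin> L m) * ln N"
        using k N1 by (auto simp: r_def ln_div ln_mult)
      from mult_left_mono[OF this msg_joint_nonneg[of p n "enc1 c" m ys]]
      show "?J m ys * (- ln (r m ys))
          \<le> ?J m ys * (ln 2 + ln (card (msgs2 c))) + ?J m ys * of_bool (ys \<notin> L m) * ln N"
        by (simp add: distrib_left mult.assoc)
    qed
    finally show ?thesis by (simp add: sum.distrib sum_distrib_right)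
  qed
  have tot: "(\<Sum>m\<in>msgs1 c. \<Sum>ys\<in>?Y. ?J m ys) = 1"
    unfolding sum_msg_joint by (rule sum_msg_law[OF fin(1) e1])
  have "(\<Sum>m\<in>msgs1 c. \<Sum>ys\<in>?Y. ?J m ys * of_bool (ys \<notin> L m))
      = (\<Sum>xs\<in>?X. \<Sum>ys\<in>?Y. iid (pmf p) (zip xs ys) * (\<Sum>m\<in>msgs1 c. of_bool (enc1 c xs = m \<and> ys \<notin> L m)))"
  proof -
    have "(\<Sum>m\<in>msgs1 c. \<Sum>ys\<in>?Y. ?J m ys * of_bool (ys \<notin> L m))
        = (\<Sum>m\<in>msgs1 c. \<Sum>ys\<in>?Y. \<Sum>xs\<in>?X. iid (pmf p) (zip xs ys) * of_bool (enc1 c xs = m \<and> ys \<notin> L m))"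
      by (simp add: msg_joint_def sum_distrib_right mult.assoc of_bool_conj)
    also have "\<dots> = (\<Sum>m\<in>msgs1 c. \<Sum>xs\<in>?X. \<Sum>ys\<in>?Y. iid (pmf p) (zip xs ys) * of_bool (enc1 c xs = m \<and> ys \<notin> L m))"
      by (intro sum.cong refl sum.swap)
    also have "\<dots> = (\<Sum>xs\<in>?X. \<Sum>m\<in>msgs1 c. \<Sum>ys\<in>?Y. iid (pmf p) (zip xs ys) * of_bool (enc1 c xs = m \<and> ys \<notin> L m))"
      by (rule sum.swap)
    also have "\<dots> = (\<Sum>xs\<in>?X. \<Sum>ys\<in>?Y. \<Sum>m\<in>msgs1 c. iid (pmf p) (zip xs ys) * of_bool (enc1 c xs = m \<and> ys \<notin> L m))"
      by (intro sum.cong refl sum.swap)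
    finally show ?thesis by (simp add: sum_distrib_left)
  qed
  also have "\<dots> = (\<Sum>xs\<in>?X. \<Sum>ys\<in>?Y. iid (pmf p) (zip xs ys) * of_bool (ys \<notin> L (enc1 c xs)))"
  proof (intro sum.cong refl)
    fix xs ys assume "xs \<in> ?X"
    then have "enc1 c xs \<in> msgs1 c" using e1 by auto
    have "(\<Sum>m\<in>msgs1 c. of_bool (enc1 c xs = m \<and> ys \<notin> L m))
        = (\<Sum>m\<in>msgs1 c. if enc1 c xs = m then of_bool (ys \<notin> L (enc1 c xs)) else (0::real))"
      by (intro sum.cong) auto
    also have "\<dots> = of_bool (ys \<notin> L (enc1 c xs))"
      using \<open>enc1 c xs \<in> msgs1 c\<close> fin by simp
    finally show "iid (pmf p) (zip xs ys) * (\<Sum>m\<in>msgs1 c. of_bool (enc1 c xs = m \<and> ys \<notin> L m))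
        = iid (pmf p) (zip xs ys) * of_bool (ys \<notin> L (enc1 c xs))" by simp
  qed
  also have "\<dots> \<le> error_prob (iid_source p n) c"
    unfolding error_prob_sum[OF set_iid_source]
  proof (intro sum_mono)
    fix xs ys assume xy: "xs \<in> ?X" "ys \<in> ?Y"
    then have "dec c (enc1 c xs, enc2 c ys) \<in> L (enc1 c xs)"
      unfolding L_def using e2 by (intro imageI) auto
    then have "of_bool (ys \<notin> L (enc1 c xs)) \<le> (of_bool (dec c (enc1 c xs, enc2 c ys) \<noteq> ys) :: real)"
      by auto
    then show "iid (pmf p) (zip xs ys) * of_bool (ys \<notin> L (enc1 c xs))
        \<le> pmf (iid_source p n) (xs, ys) * of_bool (dec c (enc1 c xs, enc2 c ys) \<noteq> ys)"
      using xy by (auto simp: pmf_iid_source words_UNIV intro!: mult_left_mono iid_nonneg)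
  qed
  finally have err: "(\<Sum>m\<in>msgs1 c. \<Sum>ys\<in>?Y. ?J m ys * of_bool (ys \<notin> L m))
      \<le> error_prob (iid_source p n) c" .
  have "(\<Sum>m\<in>msgs1 c. ent (?J m) ?Y) \<le> (\<Sum>m\<in>msgs1 c. (\<Sum>ys\<in>?Y. ?J m ys * (ln 2 + ln (card (msgs2 c))))
      + (\<Sum>ys\<in>?Y. ?J m ys * of_bool (ys \<notin> L m)) * ln N)"
    by (intro sum_mono bound)
  also have "\<dots> = (\<Sum>m\<in>msgs1 c. \<Sum>ys\<in>?Y. ?J m ys) * (ln 2 + ln (card (msgs2 c)))
      + (\<Sum>m\<in>msgs1 c. \<Sum>ys\<in>?Y. ?J m ys * of_bool (ys \<notin> L m)) * ln N"
    by (simp only: sum.distrib sum_distrib_right)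
  also have "\<dots> \<le> ln 2 + ln (card (msgs2 c)) + error_prob (iid_source p n) c * ln N"
    using mult_right_mono[OF err, of "ln N"] N1 by (simp add: tot)
  finally show ?thesis by (simp add: lnN)
qed

lemma code_column_family:
  fixes P :: "'i \<Rightarrow> ('x::finite \<times> 'y::finite) pmf"
  assumes c: "is_wak_code n c" and n: "0 < n"
    and PQ: "\<And>i. i \<in> I \<Longrightarrow> map_pmf fst (P i) = Q"
  shows "\<exists>A B. column_family Q P 1 A B \<and> A \<le> ln (card (msgs1 c)) / n \<and>
    (\<forall>i\<in>I. B i \<le> ln 2 / n + ln (card (msgs2 c)) / n + error_prob (iid_source (P i) n) c * ln (CARD('y)))"
proof -
  have fin: "finite (msgs1 c)" and e1: "enc1 c \<in> words UNIV n \<rightarrow> msgs1 c"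
    using c unfolding is_wak_code_def words_UNIV by auto
  obtain xs0 :: "'x list" where "length xs0 = n" using Ex_list_of_length by blast
  then have "enc1 c xs0 \<in> msgs1 c" using e1 by (auto simp: words_UNIV)
  then have ne: "msgs1 c \<noteq> {}" by auto
  have "\<exists>A B. column_family Q P (real n) A B \<and> A \<le> ent (msg_law Q n (enc1 c)) (msgs1 c) \<and>
      (\<forall>i\<in>I. B i \<le> (\<Sum>m\<in>msgs1 c. ent (msg_joint (P i) n (enc1 c) m) (words UNIV n)))"
    by (rule column_family_of_code[OF fin _ e1]) (rule PQ)
  then obtain A B where AB: "column_family Q P (real n) A B" "A \<le> ent (msg_law Q n (enc1 c)) (msgs1 c)"
    "\<And>i. i \<in> I \<Longrightarrow> B i \<le> (\<Sum>m\<in>msgs1 c. ent (msg_joint (P i) n (enc1 c) m) (words UNIV n))"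
    by auto
  have "ent (msg_law Q n (enc1 c)) (msgs1 c) \<le> ln (card (msgs1 c))"
    using ent_le_ln_card[OF fin ne, of "msg_law Q n (enc1 c)"] sum_msg_law[OF fin e1, of Q]
    by (simp add: msg_law_nonneg)
  with AB(2) have A: "1 / real n * A \<le> ln (card (msgs1 c)) / n"
    using n by (simp add: divide_right_mono)
  have B: "1 / real n * B i \<le> ln 2 / n + ln (card (msgs2 c)) / n + error_prob (iid_source (P i) n) c * ln (CARD('y))"
    if "i \<in> I" for i
  proof -
    have "B i \<le> ln 2 + ln (card (msgs2 c)) + error_prob (iid_source (P i) n) c * (real n * ln (CARD('y)))"
      using AB(3)[OF that] fano_code[OF c, of "P i"] by linarith
    then have "B i / n \<le> (ln 2 + ln (card (msgs2 c)) + error_prob (iid_source (P i) n) c * (real n * ln (CARD('y)))) / n"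
      using n by (intro divide_right_mono) auto
    then show ?thesis using n by (simp add: add_divide_distrib)
  qed
  \<comment> \<open>Scaling by 1/n plays the part of a time-sharing variable uniform over the n
    letters.\<close>
  have "column_family Q P (1 / real n * real n) (1 / real n * A) (\<lambda>i. 1 / real n * B i)"
    by (rule column_family_scale[OF AB(1)]) simp
  then have "column_family Q P 1 (1 / real n * A) (\<lambda>i. 1 / real n * B i)" using n by simp
  with A B show ?thesis by blast
qed


section \<open>Attainment of the minimum\<close>

text \<open>Gaussian elimination, one equation at a time: there are fewer equations than
  unknowns.\<close>

lemma homogeneous_system_nontrivial:
  fixes g :: "'j \<Rightarrow> 'u \<Rightarrow> real"
  assumes "finite D" and "finite U" and "card D < card U"
  shows "\<exists>v. (\<exists>u\<in>U. v u \<noteq> 0) \<and> (\<forall>j\<in>D. (\<Sum>u\<in>U. v u * g j u) = 0)"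
  using assms
proof (induction D arbitrary: g U rule: finite_induct)
  case empty
  then have "U \<noteq> {}" by auto
  then show ?case by (intro exI[of _ "\<lambda>_. 1"]) auto
next
  case (insert j D)
  show ?case
  proof (cases "\<forall>u\<in>U. g j u = 0")
    case True
    obtain v where "\<exists>u\<in>U. v u \<noteq> 0" "\<forall>k\<in>D. (\<Sum>u\<in>U. v u * g k u) = 0"
      using insert.IH[of U g] insert.prems insert.hyps by (auto simp: card_insert_if)
    with True show ?thesis by (intro exI[of _ v]) auto
  next
    case False
    then obtain u0 where u0: "u0 \<in> U" "g j u0 \<noteq> 0" by auto
    let ?U = "U - {u0}"
    \<comment> \<open>Equation \<open>j\<close> is the pivot and \<open>u0\<close> the eliminated
      unknown; \<open>c\<close> below is the value of \<open>u0\<close> forced by equation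
      \<open>j\<close>.\<close>
    let ?g = "\<lambda>k u. g k u - g k u0 * g j u / g j u0"
    have "card D < card ?U" using insert u0 by (simp add: card_insert_if)
    then obtain v where v: "\<exists>u\<in>?U. v u \<noteq> 0" "\<forall>k\<in>D. (\<Sum>u\<in>?U. v u * ?g k u) = 0"
      using insert.IH[of ?U ?g] insert.prems by auto
    define c where "c = - (\<Sum>u\<in>?U. v u * g j u) / g j u0"
    define w where "w = v(u0 := c)"
    have sum: "(\<Sum>u\<in>U. w u * h u) = c * h u0 + (\<Sum>u\<in>?U. v u * h u)" for h
    proof -
      have "(\<Sum>u\<in>U. w u * h u) = w u0 * h u0 + (\<Sum>u\<in>?U. w u * h u)"
        by (rule sum.remove) (use insert u0 in auto)
      also have "(\<Sum>u\<in>?U. w u * h u) = (\<Sum>u\<in>?U. v u * h u)"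
        by (intro sum.cong) (auto simp: w_def)
      finally show ?thesis by (simp add: w_def)
    qed
    have "(\<Sum>u\<in>U. w u * g j u) = 0"
      using u0 by (simp add: sum c_def)
    moreover have "(\<Sum>u\<in>U. w u * g k u) = 0" if "k \<in> D" for k
    proof -
      have "0 = (\<Sum>u\<in>?U. v u * g k u - (v u * g j u) * (g k u0 / g j u0))"
      proof -
        have "v u * ?g k u = v u * g k u - (v u * g j u) * (g k u0 / g j u0)" for u
          by (simp add: right_diff_distrib)
        then show ?thesis using v(2) that by (metis (no_types, lifting) sum.cong)
      qed
      also have "\<dots> = (\<Sum>u\<in>?U. v u * g k u) - (\<Sum>u\<in>?U. v u * g j u) * (g k u0 / g j u0)"
        by (simp only: sum_subtractf sum_distrib_right)
      finally show ?thesis by (simp add: sum c_def)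
    qed
    moreover have "\<exists>u\<in>U. w u \<noteq> 0" using v(1) by (auto simp: w_def)
    ultimately show ?thesis by blast
  qed
qed

text \<open>While the support is larger than \<open>D\<close>, the functionals in \<open>D\<close>
  have a common kernel vector on it. Moving along this vector until a coefficient vanishes shrinks
  the support and changes no functional.\<close>

lemma conic_caratheodory:
  fixes c :: "'u \<Rightarrow> real" and g :: "'j \<Rightarrow> 'u \<Rightarrow> real"
  assumes "finite D" and "finite U" and "\<And>u. u \<in> U \<Longrightarrow> 0 \<le> c u"
  shows "\<exists>c'. (\<forall>u\<in>U. 0 \<le> c' u) \<and> card {u \<in> U. c' u \<noteq> 0} \<le> card D \<and>
    (\<forall>j\<in>D. (\<Sum>u\<in>U. c' u * g j u) = (\<Sum>u\<in>U. c u * g j u))"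
  using assms(3)
proof (induction "card {u \<in> U. c u \<noteq> 0}" arbitrary: c rule: less_induct)
  case less
  let ?S = "{u \<in> U. c u \<noteq> 0}"
  show ?case
  proof (cases "card ?S \<le> card D")
    case True
    then show ?thesis using less.prems by (intro exI[of _ c]) auto
  next
    case False
    have S: "finite ?S" using assms(2) by auto
    obtain v0 where v0: "\<exists>u\<in>?S. v0 u \<noteq> 0" "\<forall>j\<in>D. (\<Sum>u\<in>?S. v0 u * g j u) = 0"
      using homogeneous_system_nontrivial[OF assms(1) S, of g] False by auto
    \<comment> \<open>The sign is chosen so that some entry is positive; otherwise moving along
      -\<open>v\<close> would never reach the boundary of the cone.\<close>
    obtain v where v: "\<exists>u\<in>?S. 0 < v u" "\<forall>j\<in>D. (\<Sum>u\<in>?S. v u * g j u) = 0"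
    proof (cases "\<exists>u\<in>?S. 0 < v0 u")
      case True
      with v0 that show ?thesis by blast
    next
      case False
      with v0(1) have "\<exists>u\<in>?S. 0 < - v0 u" by force
      with v0(2) that[of "\<lambda>u. - v0 u"] show ?thesis by (auto simp: sum_negf)
    qed
    let ?T = "{u \<in> ?S. 0 < v u}"
    \<comment> \<open>The longest step that keeps all coefficients nonnegative; at a minimiser
      \<open>u1\<close> the coefficient becomes 0.\<close>
    define t where "t = Min ((\<lambda>u. c u / v u) ` ?T)"
    have fT: "finite ((\<lambda>u. c u / v u) ` ?T)" "(\<lambda>u. c u / v u) ` ?T \<noteq> {}"
      using assms(2) v(1) by auto
    have "t \<in> (\<lambda>u. c u / v u) ` ?T" unfolding t_def by (rule Min_in[OF fT])
    then obtain u1 where u1: "u1 \<in> ?T" "t = c u1 / v u1" by auto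
    have t0: "0 \<le> t" using u1 less.prems by auto
    define c' where "c' u = (if u \<in> ?S then c u - t * v u else 0)" for u
    have c'nn: "0 \<le> c' u" if "u \<in> U" for u
    proof (cases "u \<in> ?S \<and> 0 < v u")
      case True
      then have "t \<le> c u / v u" unfolding t_def by (intro Min_le fT) auto
      with True show ?thesis by (auto simp: c'_def field_simps)
    next
      case False
      then have "t * v u \<le> 0" if "u \<in> ?S" using that t0 by (auto intro: mult_nonneg_nonpos)
      then show ?thesis using less.prems[OF that] by (auto simp: c'_def)
    qed
    have "{u \<in> U. c' u \<noteq> 0} \<subseteq> ?S - {u1}" using u1 by (auto simp: c'_def)
    then have "card {u \<in> U. c' u \<noteq> 0} \<le> card (?S - {u1})" using S by (intro card_mono) auto
    also have "\<dots> < card ?S" using S u1 by (intro card_Diff1_less) auto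
    finally obtain d where d: "\<forall>u\<in>U. 0 \<le> d u" "card {u \<in> U. d u \<noteq> 0} \<le> card D"
        "\<forall>j\<in>D. (\<Sum>u\<in>U. d u * g j u) = (\<Sum>u\<in>U. c' u * g j u)"
      using less.hyps[of c'] c'nn by blast
    have "(\<Sum>u\<in>U. c' u * g j u) = (\<Sum>u\<in>U. c u * g j u)" if "j \<in> D" for j
    proof -
      have "(\<Sum>u\<in>U. c' u * g j u) = (\<Sum>u\<in>?S. c u * g j u - t * (v u * g j u))"
        using assms(2) by (intro sum.mono_neutral_cong_right) (auto simp: c'_def algebra_simps)
      also have "\<dots> = (\<Sum>u\<in>?S. c u * g j u)"
        using v(2) that by (simp add: sum_subtractf sum_distrib_left[symmetric])
      also have "\<dots> = (\<Sum>u\<in>U. c u * g j u)"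
        using assms(2) by (intro sum.mono_neutral_left) auto
      finally show ?thesis .
    qed
    with d show ?thesis by (intro exI[of _ d]) auto
  qed
qed

text \<open>Columns are only rescaled, so by homogeneity every quantity to be preserved is linear in
  the scaling weights and \<open>conic_caratheodory\<close> applies. Padding with zero columns makes
  the number exactly \<open>N\<close>, independently of the family.\<close>

lemma bounded_column_count:
  fixes Q :: "'x::finite pmf" and P :: "'i \<Rightarrow> ('x \<times> 'y::finite) pmf"
  assumes I: "finite I" and fam: "column_family Q P 1 A B"
    and N: "N = CARD('x) + 1 + card I"
  shows "\<exists>w :: nat \<Rightarrow> 'x \<Rightarrow> real. (\<forall>j x. 0 \<le> w j x) \<and> (\<forall>j\<ge>N. \<forall>x. w j x = 0) \<and>
    (\<forall>x. (\<Sum>j<N. w j x) = 1) \<and> (\<Sum>j<N. col_info Q (w j)) = A \<and>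
    (\<forall>i\<in>I. (\<Sum>j<N. col_ent (P i) (w j)) = B i)"
proof -
  obtain vs where vs: "\<forall>v\<in>set vs. \<forall>x. 0 \<le> v x" "\<forall>x. (\<Sum>v\<leftarrow>vs. v x) = 1"
    "(\<Sum>v\<leftarrow>vs. col_info Q v) = A" "\<forall>i. (\<Sum>v\<leftarrow>vs. col_ent (P i) v) = B i"
    using fam unfolding column_family_def by blast
  define U where "U = {..<length vs}"
  have sum: "(\<Sum>v\<leftarrow>vs. f v) = (\<Sum>u\<in>U. f (vs ! u))" for f :: "('x \<Rightarrow> real) \<Rightarrow> real"
    by (simp add: sum_list_sum_nth atLeast0LessThan U_def)
  have nn: "0 \<le> (vs ! u) x" if "u \<in> U" for u x using vs(1) that by (auto simp: U_def)
  \<comment> \<open>One constraint per letter of X (columns sum to 1), one for the information, one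
    per entropy: this is the origin of \<open>N\<close>.\<close>
  define D :: "('x + 'i option) set" where "D = Inl ` UNIV \<union> Inr ` insert None (Some ` I)"
  define g where "g d u = (case d of Inl x \<Rightarrow> (vs ! u) x | Inr None \<Rightarrow> col_info Q (vs ! u)
      | Inr (Some i) \<Rightarrow> col_ent (P i) (vs ! u))" for d u
  have D: "finite D" using I by (simp add: D_def)
  have "card D = card (Inl ` (UNIV :: 'x set) :: ('x + 'i option) set)
      + card (Inr ` insert None (Some ` I) :: ('x + 'i option) set)"
    unfolding D_def using I by (intro card_Un_disjoint) auto
  then have cardD: "card D = N"
    using I by (simp add: N card_image card_insert_if image_iff)
  have U: "finite U" by (simp add: U_def)
  obtain c where c: "\<forall>u\<in>U. 0 \<le> c u" "card {u \<in> U. c u \<noteq> 0} \<le> N"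
    "\<And>j. j \<in> D \<Longrightarrow> (\<Sum>u\<in>U. c u * g j u) = (\<Sum>u\<in>U. 1 * g j u)"
    using conic_caratheodory[OF D U, of "\<lambda>_. 1" g] cardD by auto
  let ?S = "{u \<in> U. c u \<noteq> 0}"
  have S: "finite ?S" using U by simp
  obtain h where h: "bij_betw h {..<card ?S} ?S"
    using ex_bij_betw_nat_finite[OF S] by (auto simp: atLeast0LessThan)
  define w where "w j x = (if j < card ?S then c (h j) * (vs ! h j) x else 0)" for j x
  have reindex: "(\<Sum>j<N. F (w j)) = (\<Sum>u\<in>U. F (\<lambda>x. c u * (vs ! u) x))"
    if F0: "F (\<lambda>x. 0) = 0" for F :: "('x \<Rightarrow> real) \<Rightarrow> real"
  proof -
    have w0: "w j = (\<lambda>x. 0)" if "\<not> j < card ?S" for j using that by (auto simp: w_def)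
    have "(\<Sum>j<N. F (w j)) = (\<Sum>j<card ?S. F (w j))"
      using c(2) by (intro sum.mono_neutral_right) (auto simp: w0 F0)
    also have "\<dots> = (\<Sum>j<card ?S. F (\<lambda>x. c (h j) * (vs ! h j) x))"
      by (intro sum.cong) (auto simp: w_def[abs_def])
    also have "\<dots> = (\<Sum>u\<in>?S. F (\<lambda>x. c u * (vs ! u) x))"
      by (rule sum.reindex_bij_betw[OF h])
    also have "\<dots> = (\<Sum>u\<in>U. F (\<lambda>x. c u * (vs ! u) x))"
      using U F0 by (intro sum.mono_neutral_left) auto
    finally show ?thesis .
  qed
  have "0 \<le> w j x" for j x
    using c(1) nn bij_betwE[OF h] by (auto simp: w_def)
  moreover have "w j x = 0" if "N \<le> j" for j x
    using c(2) that by (auto simp: w_def)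
  moreover have "(\<Sum>j<N. w j x) = 1" for x
  proof -
    have "(\<Sum>j<N. w j x) = (\<Sum>u\<in>U. c u * g (Inl x) u)"
      using reindex[of "\<lambda>v. v x"] by (simp add: g_def)
    also have "\<dots> = (\<Sum>u\<in>U. (vs ! u) x)" using c(3)[of "Inl x"] by (simp add: D_def g_def)
    finally show ?thesis using vs(2) sum[of "\<lambda>v. v x"] by simp
  qed
  moreover have "(\<Sum>j<N. col_info Q (w j)) = A"
  proof -
    have "(\<Sum>j<N. col_info Q (w j)) = (\<Sum>u\<in>U. col_info Q (\<lambda>x. c u * (vs ! u) x))"
      by (rule reindex) (simp add: col_info_def)
    also have "\<dots> = (\<Sum>u\<in>U. c u * g (Inr None) u)"
      using c(1) nn by (intro sum.cong refl) (simp add: g_def col_info_cmult)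
    also have "\<dots> = (\<Sum>u\<in>U. col_info Q (vs ! u))" using c(3)[of "Inr None"] by (simp add: D_def g_def)
    finally show ?thesis using vs(3) sum[of "col_info Q"] by simp
  qed
  moreover have "(\<Sum>j<N. col_ent (P i) (w j)) = B i" if "i \<in> I" for i
  proof -
    have "(\<Sum>j<N. col_ent (P i) (w j)) = (\<Sum>u\<in>U. col_ent (P i) (\<lambda>x. c u * (vs ! u) x))"
      by (rule reindex) (simp add: col_ent_def ent_def)
    also have "\<dots> = (\<Sum>u\<in>U. c u * g (Inr (Some i)) u)"
      using c(1) nn by (intro sum.cong refl) (simp add: g_def col_ent_cmult)
    also have "\<dots> = (\<Sum>u\<in>U. col_ent (P i) (vs ! u))"
      using c(3)[of "Inr (Some i)"] that by (simp add: D_def g_def)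
    finally show ?thesis using vs(4) sum[of "col_ent (P i)"] by simp
  qed
  ultimately show ?thesis by (intro exI[of _ w]) auto
qed

text \<open>Epigraph form: over pairs of a column array and a bound \<open>t\<close> on all
  entropies, \<open>t\<close> is minimised. This turns the maximum over \<open>i\<close> into
  finitely many closed constraints on a compact set.\<close>

lemma min_worst_cond_entropy_attained:
  fixes Q :: "'x::finite pmf" and P :: "'i \<Rightarrow> ('x \<times> 'y::finite) pmf"
  assumes I: "finite I" "I \<noteq> {}" and Rc: "0 \<le> Rc"
  shows "\<exists>W\<in>test_channels Rc Q. \<forall>W'\<in>test_channels Rc Q.
    (MAX i\<in>I. cond_entropy (joint_YU (P i) W)) \<le> (MAX i\<in>I. cond_entropy (joint_YU (P i) W'))"
proof -
  define N where "N = CARD('x) + 1 + card I"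
  \<comment> \<open>The value of a constant U, which is always feasible; it caps \<open>t\<close>
    and thus makes the epigraph bounded.\<close>
  define T where "T = (MAX i\<in>I. col_ent (P i) (\<lambda>_. 1))"
  \<comment> \<open>The index set is infinite, but each coordinate ranges over a compact set ({0}
    from row \<open>N\<close> on), so Tychonoff's theorem applies.\<close>
  define K :: "((nat \<times> 'x \<Rightarrow> real) \<times> real) set"
    where "K = (\<Pi>\<^sub>E jx\<in>UNIV. if fst jx < N then {0..1} else {0}) \<times> {0..T}"
  have "compact (\<Pi>\<^sub>E jx\<in>(UNIV :: (nat \<times> 'x) set). if fst jx < N then {0..1} else {0 :: real})"
    using compactin_PiE[of "\<lambda>_. euclidean :: real topology" "UNIV :: (nat \<times> 'x) set"
        "\<lambda>jx. if fst jx < N then {0..1} else {0}"]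
    by (simp add: euclidean_product_topology)
  then have K: "compact K" unfolding K_def by (intro compact_Times) auto
  have Knn: "0 \<le> fst z jx" if "z \<in> K" for z jx
  proof -
    have "fst z \<in> (\<Pi>\<^sub>E jx\<in>UNIV. if fst jx < N then {0..1} else {0})"
      using that by (simp only: K_def mem_Times_iff)
    then have "fst z jx \<in> (if fst jx < N then {0..1} else {0})"
      by (rule PiE_mem) simp
    then show ?thesis by (auto split: if_splits)
  qed
  have coord: "continuous_on K (\<lambda>z. fst z jx)" for jx
    by (rule continuous_on_compose2[OF continuous_on_product_coordinates[of jx] continuous_on_fst])
      (auto intro: continuous_on_id)
  have snd: "continuous_on K (\<lambda>z. snd z)" by (intro continuous_on_snd continuous_on_id)
  have ci: "continuous_on K (\<lambda>z. col_info Q (\<lambda>x. fst z (j, x)))" for j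
    unfolding col_info_def by (intro continuous_intros coord) (simp_all add: sum_nonneg Knn)
  have ce: "continuous_on K (\<lambda>z. col_ent (P i) (\<lambda>x. fst z (j, x)))" for i j
    unfolding col_ent_def ent_def
    by (intro continuous_intros coord) (simp_all add: sum_nonneg Knn)
  \<comment> \<open>Each column-sum equation is written as two inequalities, so that one closedness
    argument covers all constraints.\<close>
  define S where "S = K \<inter> (\<Inter>x. {z \<in> K. (\<Sum>j<N. fst z (j, x)) \<le> 1}) \<inter>
    (\<Inter>x. {z \<in> K. 1 \<le> (\<Sum>j<N. fst z (j, x))}) \<inter>
    {z \<in> K. (\<Sum>j<N. col_info Q (\<lambda>x. fst z (j, x))) \<le> Rc} \<inter>
    (\<Inter>i\<in>I. {z \<in> K. (\<Sum>j<N. col_ent (P i) (\<lambda>x. fst z (j, x))) \<le> snd z})"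
  note closed_le = continuous_on_closed_Collect_le[OF _ _ compact_imp_closed[OF K]]
  have "compact S"
    unfolding S_def
    by (intro compact_Int_closed K closed_INT ballI closed_le continuous_intros coord ci ce snd)
  have SI: "(\<lambda>(j, x). w j x, t) \<in> S"
    if w: "\<forall>j x. 0 \<le> w j x" "\<forall>j\<ge>N. \<forall>x. w j x = 0" "\<forall>x. (\<Sum>j<N. w j x) = 1"
      "(\<Sum>j<N. col_info Q (w j)) \<le> Rc" "\<And>i. i \<in> I \<Longrightarrow> (\<Sum>j<N. col_ent (P i) (w j)) \<le> t" "t \<le> T" for w t
  proof -
    have w1: "w j x \<le> 1" if "j < N" for j x
    proof -
      have "w j x \<le> (\<Sum>j<N. w j x)" using that w(1) by (intro member_le_sum) auto
      then show ?thesis using w(3) by simp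
    qed
    obtain i where i: "i \<in> I" using I by auto
    have "0 \<le> (\<Sum>j<N. col_ent (P i) (w j))" using w(1) by (intro sum_nonneg col_ent_nonneg) auto
    then have t0: "0 \<le> t" using w(5)[OF i] by linarith
    have "(\<lambda>(j, x). w j x, t) \<in> K"
      unfolding K_def using w(1,2,6) w1 t0 by auto
    then show ?thesis
      unfolding S_def using w(3,4,5) by auto
  qed
  \<comment> \<open>The constant U as an element of \<open>S\<close>: one column equal to 1, zero
    information.\<close>
  define w1 :: "nat \<Rightarrow> 'x \<Rightarrow> real" where "w1 j x = (if j = 0 then 1 else 0)" for j x
  have N0: "0 < N" by (simp add: N_def)
  have sum_w1: "(\<Sum>j<N. F (w1 j)) = F (\<lambda>x. 1)" if "F (\<lambda>x. 0) = 0" for F :: "('x \<Rightarrow> real) \<Rightarrow> real"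
  proof -
    have "(\<Sum>j<N. F (w1 j)) = (\<Sum>j<N. if j = 0 then F (\<lambda>x. 1) else 0)"
      by (intro sum.cong) (auto simp: w1_def[abs_def] that)
    then show ?thesis using N0 by simp
  qed
  have "(\<lambda>(j, x). w1 j x, T) \<in> S"
  proof (rule SI)
    show "\<forall>x. (\<Sum>j<N. w1 j x) = 1" using sum_w1[of "\<lambda>v. v x" for x] by simp
    show "(\<Sum>j<N. col_info Q (w1 j)) \<le> Rc"
      using sum_w1[of "col_info Q"] Rc by (simp add: col_info_const) (simp add: col_info_def)
    show "(\<Sum>j<N. col_ent (P i) (w1 j)) \<le> T" if "i \<in> I" for i
      using sum_w1[of "col_ent (P i)"] I that by (simp add: T_def) (simp add: col_ent_def ent_def)
  qed (use N0 in \<open>auto simp: w1_def\<close>)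
  then have "S \<noteq> {}" by auto
  have "continuous_on S snd"
    by (rule continuous_on_subset[OF snd]) (auto simp: S_def)
  then obtain z where z: "z \<in> S" "\<And>z'. z' \<in> S \<Longrightarrow> snd z \<le> snd z'"
    using continuous_attains_inf[OF \<open>compact S\<close> \<open>S \<noteq> {}\<close> \<open>continuous_on S snd\<close>] by blast
  have zK: "z \<in> K" and z1: "\<And>x. (\<Sum>j<N. fst z (j, x)) = 1"
    and zI: "(\<Sum>j<N. col_info Q (\<lambda>x. fst z (j, x))) \<le> Rc"
    and zE: "\<And>i. i \<in> I \<Longrightarrow> (\<Sum>j<N. col_ent (P i) (\<lambda>x. fst z (j, x))) \<le> snd z"
    using z(1) unfolding S_def by (auto intro: antisym)
  obtain W where W: "\<And>x. set_pmf (W x) \<subseteq> {..<N}"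
    "mutual_info (joint_XU Q W) = (\<Sum>j<N. col_info Q (\<lambda>x. fst z (j, x)))"
    "\<And>p :: ('x \<times> 'y) pmf. cond_entropy (joint_YU p W) = (\<Sum>j<N. col_ent p (\<lambda>x. fst z (j, x)))"
    using channel_of_columns[of N "\<lambda>j x. fst z (j, x)"] Knn[OF zK] z1 by metis
  have "finite (set_pmf (W x))" for x using W(1) finite_subset by blast
  then have "W \<in> test_channels Rc Q" using W(2) zI by (simp add: test_channels_def)
  moreover have "(MAX i\<in>I. cond_entropy (joint_YU (P i) W)) \<le> (MAX i\<in>I. cond_entropy (joint_YU (P i) W'))"
    if W': "W' \<in> test_channels Rc Q" for W'
  proof -
    let ?t = "MAX i\<in>I. cond_entropy (joint_YU (P i) W')"
    have "(MAX i\<in>I. cond_entropy (joint_YU (P i) W)) \<le> snd z"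
      using I by (subst Max_le_iff) (auto simp: W(3) zE)
    also have "snd z \<le> ?t"
    proof (cases "?t \<le> T")
      case True
      have "column_family Q P 1 (mutual_info (joint_XU Q W')) (\<lambda>i. cond_entropy (joint_YU (P i) W'))"
        using W' by (intro column_family_of_channel) (auto simp: test_channels_def)
      from bounded_column_count[OF I(1) this N_def]
      obtain w where w: "\<forall>j x. 0 \<le> w j x" "\<forall>j\<ge>N. \<forall>x. w j x = 0" "\<forall>x. (\<Sum>j<N. w j x) = 1"
        "(\<Sum>j<N. col_info Q (w j)) = mutual_info (joint_XU Q W')"
        "\<forall>i\<in>I. (\<Sum>j<N. col_ent (P i) (w j)) = cond_entropy (joint_YU (P i) W')"
        by blast
      have "(\<lambda>(j, x). w j x, ?t) \<in> S"
        using w W' True I by (intro SI) (auto simp: test_channels_def)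
      from z(2)[OF this] show ?thesis by simp
    next
      \<comment> \<open>A channel worse than the cap \<open>T\<close> need not have a point in
        \<open>S\<close>, but the bound \<le> \<open>T\<close> already beats it.\<close>
      case False
      then show ?thesis using zK by (auto simp: K_def)
    qed
    finally show ?thesis .
  qed
  ultimately show ?thesis by blast
qed


section \<open>Tools for the direct part\<close>

lemma iid_first_moment:
  assumes "sum f A = 1" and "(\<Sum>z\<in>A. f z * h z) = 0"
  shows "(\<Sum>zs\<in>words A n. iid f zs * (\<Sum>z\<leftarrow>zs. h z)) = (0 :: real)"
proof (induction n)
  case (Suc n)
  have "(\<Sum>zs\<in>words A (Suc n). iid f zs * (\<Sum>z\<leftarrow>zs. h z))
      = (\<Sum>z\<in>A. \<Sum>zs\<in>words A n. f z * h z * iid f zs + f z * (iid f zs * (\<Sum>z\<leftarrow>zs. h z)))"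
    by (simp add: sum_words_Suc algebra_simps)
  also have "\<dots> = (\<Sum>z\<in>A. f z * h z * (\<Sum>zs\<in>words A n. iid f zs)
      + f z * (\<Sum>zs\<in>words A n. iid f zs * (\<Sum>z\<leftarrow>zs. h z)))"
    by (simp add: sum.distrib sum_distrib_left)
  also have "\<dots> = 0"
    by (simp add: Suc sum_iid assms)
  finally show ?case .
qed simp

text \<open>Independence and centring kill the mixed terms, so variances add.\<close>

lemma iid_second_moment:
  assumes "sum f A = 1" and "(\<Sum>z\<in>A. f z * h z) = 0"
  shows "(\<Sum>zs\<in>words A n. iid f zs * (\<Sum>z\<leftarrow>zs. h z)\<^sup>2) = real n * (\<Sum>z\<in>A. f z * (h z)\<^sup>2)"
proof (induction n)
  case (Suc n)
  have "(\<Sum>zs\<in>words A (Suc n). iid f zs * (\<Sum>z\<leftarrow>zs. h z)\<^sup>2)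
      = (\<Sum>z\<in>A. \<Sum>zs\<in>words A n. f z * (h z)\<^sup>2 * iid f zs
          + 2 * (f z * h z) * (iid f zs * (\<Sum>z\<leftarrow>zs. h z)) + f z * (iid f zs * (\<Sum>z\<leftarrow>zs. h z)\<^sup>2))"
    by (simp add: sum_words_Suc power2_eq_square algebra_simps)
  also have "\<dots> = (\<Sum>z\<in>A. f z * (h z)\<^sup>2 * (\<Sum>zs\<in>words A n. iid f zs)
      + 2 * (f z * h z) * (\<Sum>zs\<in>words A n. iid f zs * (\<Sum>z\<leftarrow>zs. h z))
      + f z * (\<Sum>zs\<in>words A n. iid f zs * (\<Sum>z\<leftarrow>zs. h z)\<^sup>2))"
    by (simp add: sum.distrib sum_distrib_left)
  also have "\<dots> = (\<Sum>z\<in>A. f z * (h z)\<^sup>2) + real n * (\<Sum>z\<in>A. f z * (h z)\<^sup>2)"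
    by (simp add: Suc sum_iid assms iid_first_moment[OF assms] sum.distrib sum_distrib_right[symmetric])
  finally show ?case by (simp add: algebra_simps)
qed simp

text \<open>Chebyshev's inequality for the letter sum of -ln \<open>r\<close>, whose mean is at most
  \<open>H\<close>. The same bound is used for conditional typicality of Y given U and for the
  information density of X and U.\<close>

lemma iid_ge_exp_likely:
  fixes f r :: "'a \<Rightarrow> real"
  assumes f: "\<And>z. z \<in> A \<Longrightarrow> 0 \<le> f z" "sum f A = 1"
    and r: "\<And>z. z \<in> A \<Longrightarrow> 0 < f z \<Longrightarrow> 0 < r z"
    and H: "(\<Sum>z\<in>A. f z * (- ln (r z))) \<le> H" and \<delta>: "0 < \<delta>"
  shows "\<exists>V\<ge>0. \<forall>n>0.
    (\<Sum>zs\<in>words A n. iid f zs * of_bool (iid r zs < exp (- (real n * (H + \<delta>))))) \<le> V / n"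
proof -
  define \<mu> where "\<mu> = (\<Sum>z\<in>A. f z * (- ln (r z)))"
  define h where "h z = - ln (r z) - \<mu>" for z
  define V where "V = (\<Sum>z\<in>A. f z * (h z)\<^sup>2) / \<delta>\<^sup>2"
  have h0: "(\<Sum>z\<in>A. f z * h z) = 0"
  proof -
    have "(\<Sum>z\<in>A. f z * h z) = (\<Sum>z\<in>A. f z * (- ln (r z))) - (\<Sum>z\<in>A. f z) * \<mu>"
      unfolding h_def right_diff_distrib sum_subtractf sum_distrib_right ..
    then show ?thesis using f(2) by (simp add: \<mu>_def)
  qed
  have "(\<Sum>zs\<in>words A n. iid f zs * of_bool (iid r zs < exp (- (real n * (H + \<delta>))))) \<le> V / n"
    if n: "0 < n" for n
  proof -
    have "(\<Sum>zs\<in>words A n. iid f zs * of_bool (iid r zs < exp (- (real n * (H + \<delta>)))))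
        \<le> (\<Sum>zs\<in>words A n. iid f zs * (\<Sum>z\<leftarrow>zs. h z)\<^sup>2 / (real n * \<delta>)\<^sup>2)"
    proof (intro sum_mono)
      fix zs assume zs: "zs \<in> words A n"
      then have len: "length zs = n" and sub: "set zs \<subseteq> A" by (auto simp: words_def)
      have nn: "0 \<le> iid f zs" using f(1) sub by (intro iid_nonneg) auto
      show "iid f zs * of_bool (iid r zs < exp (- (real n * (H + \<delta>))))
          \<le> iid f zs * (\<Sum>z\<leftarrow>zs. h z)\<^sup>2 / (real n * \<delta>)\<^sup>2"
      \<comment> \<open>A word of positive probability has only letters with \<open>0 < r z\<close>,
        so its logarithm is a genuine sum.\<close>
      proof (cases "iid f zs \<noteq> 0 \<and> iid r zs < exp (- (real n * (H + \<delta>)))")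
        case False
        then show ?thesis using nn by auto
      next
        case True
        have "f z \<noteq> 0" if "z \<in> set zs" for z using iid_zero[OF that, of f] True by blast
        then have rpos: "0 < r z" if "z \<in> set zs" for z
          using that sub f(1) r by (metis less_le subsetD)
        have "ln (iid r zs) < ln (exp (- (real n * (H + \<delta>))))"
          using True iid_pos[of zs r, OF rpos] by (subst ln_less_cancel_iff) auto
        then have "ln (iid r zs) < - (real n * (H + \<delta>))" by (simp only: ln_exp)
        moreover have "(\<Sum>z\<leftarrow>zs. h z) = - ln (iid r zs) - real n * \<mu>"
        proof -
          have "(\<Sum>z\<leftarrow>ws. h z) = - (\<Sum>z\<leftarrow>ws. ln (r z)) - real (length ws) * \<mu>" for ws
            by (induction ws) (auto simp: h_def algebra_simps)
          then show ?thesis using len ln_iid[of zs r, OF rpos] by simp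
        qed
        ultimately have "real n * (H + \<delta> - \<mu>) \<le> (\<Sum>z\<leftarrow>zs. h z)"
          by (simp add: algebra_simps)
        moreover have "real n * \<delta> \<le> real n * (H + \<delta> - \<mu>)"
          using H by (intro mult_left_mono) (auto simp: \<mu>_def)
        ultimately have "(real n * \<delta>)\<^sup>2 \<le> (\<Sum>z\<leftarrow>zs. h z)\<^sup>2"
          using \<delta> by (intro power_mono) auto
        then have "1 \<le> (\<Sum>z\<leftarrow>zs. h z)\<^sup>2 / (real n * \<delta>)\<^sup>2" using n \<delta> by simp
        from mult_left_mono[OF this nn] True show ?thesis by simp
      qed
    qed
    also have "\<dots> = (\<Sum>zs\<in>words A n. iid f zs * (\<Sum>z\<leftarrow>zs. h z)\<^sup>2) / (real n * \<delta>)\<^sup>2"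
      by (simp add: sum_divide_distrib)
    also have "\<dots> = V / n"
      unfolding iid_second_moment[OF f(2) h0] V_def using n by (simp add: power_mult_distrib power2_eq_square[of "real n"])
    finally show ?thesis .
  qed
  moreover have "0 \<le> V" unfolding V_def using f(1)
    by (intro divide_nonneg_nonneg sum_nonneg mult_nonneg_nonneg) auto
  ultimately show ?thesis by blast
qed

section \<open>Averaging arguments in place of random codes\<close>

lemma exists_le_average:
  fixes q F :: "'u \<Rightarrow> real"
  assumes "finite U" and "\<And>u. u \<in> U \<Longrightarrow> 0 \<le> q u" and "sum q U = 1"
  shows "\<exists>u\<in>U. F u \<le> (\<Sum>u\<in>U. q u * F u)"
proof (rule ccontr)
  let ?m = "\<Sum>u\<in>U. q u * F u"
  assume "\<not> ?thesis"
  then have gt: "?m < F u" if "u \<in> U" for u using that by auto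
  obtain u0 where u0: "u0 \<in> U" "0 < q u0"
    using assms sum_nonpos[of U q] by (metis not_less zero_less_one)
  have "(\<Sum>u\<in>U. q u * ?m) < (\<Sum>u\<in>U. q u * F u)"
  proof (rule sum_strict_mono_ex1[OF assms(1)])
    show "\<forall>u\<in>U. q u * ?m \<le> q u * F u"
      using gt assms(2) by (simp add: less_imp_le mult_left_mono)
    show "\<exists>u\<in>U. q u * ?m < q u * F u"
      using gt u0 by (intro bexI[of _ u0]) (rule mult_strict_left_mono, auto)
  qed
  then show False using assms(3) by (simp add: sum_distrib_right[symmetric])
qed

text \<open>A random codebook, derandomised one codeword at a time.\<close>

lemma greedy_cover:
  fixes c :: "'a \<Rightarrow> real" and q :: "'u \<Rightarrow> real" and G :: "'a \<Rightarrow> 'u set"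
  assumes U: "finite U" "\<And>u. u \<in> U \<Longrightarrow> 0 \<le> q u" "sum q U = 1"
    and c: "\<And>x. x \<in> X \<Longrightarrow> 0 \<le> c x"
  shows "\<exists>C\<subseteq>U. card C \<le> M \<and> (\<Sum>x\<in>X. c x * of_bool (C \<inter> G x = {}))
    \<le> (\<Sum>x\<in>X. c x * (1 - (\<Sum>u\<in>U. q u * of_bool (u \<in> G x))) ^ M)"
  using c
proof (induction M arbitrary: c)
  case 0
  then show ?case by (intro exI[of _ "{}"]) auto
next
  case (Suc M)
  let ?a = "\<lambda>x. 1 - (\<Sum>u\<in>U. q u * of_bool (u \<in> G x))"
  have a: "?a x = (\<Sum>u\<in>U. q u * of_bool (u \<notin> G x))" for x
  proof -
    have "(\<Sum>u\<in>U. q u * of_bool (u \<notin> G x)) = (\<Sum>u\<in>U. q u - q u * of_bool (u \<in> G x))"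
      by (intro sum.cong) auto
    then show ?thesis using U(3) by (simp add: sum_subtractf)
  qed
  \<comment> \<open>Conditional expectations: the potential is the uncovered mass expected after
    \<open>M\<close> further random codewords, and \<open>u\<close> is chosen so as not to exceed
    its average.\<close>
  obtain u where u: "u \<in> U" "(\<Sum>x\<in>X. c x * ?a x ^ M * of_bool (u \<notin> G x))
      \<le> (\<Sum>u\<in>U. q u * (\<Sum>x\<in>X. c x * ?a x ^ M * of_bool (u \<notin> G x)))"
    using exists_le_average[OF U, of "\<lambda>u. \<Sum>x\<in>X. c x * ?a x ^ M * of_bool (u \<notin> G x)"] by auto
  obtain C where C: "C \<subseteq> U" "card C \<le> M"
    "(\<Sum>x\<in>X. c x * of_bool (u \<notin> G x) * of_bool (C \<inter> G x = {}))
      \<le> (\<Sum>x\<in>X. c x * of_bool (u \<notin> G x) * ?a x ^ M)"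
    using Suc.IH[of "\<lambda>x. c x * of_bool (u \<notin> G x)"] Suc.prems by auto
  have "(\<Sum>x\<in>X. c x * of_bool (insert u C \<inter> G x = {}))
      = (\<Sum>x\<in>X. c x * of_bool (u \<notin> G x) * of_bool (C \<inter> G x = {}))"
    by (intro sum.cong) auto
  also have "\<dots> \<le> (\<Sum>x\<in>X. c x * ?a x ^ M * of_bool (u \<notin> G x))"
  proof -
    have "(\<Sum>x\<in>X. c x * of_bool (u \<notin> G x) * ?a x ^ M) = (\<Sum>x\<in>X. c x * ?a x ^ M * of_bool (u \<notin> G x))"
      by (intro sum.cong refl) (simp only: mult_ac)
    then show ?thesis using C(3) by (simp only:)
  qed
  also have "\<dots> \<le> (\<Sum>u\<in>U. q u * (\<Sum>x\<in>X. c x * ?a x ^ M * of_bool (u \<notin> G x)))" by (rule u(2))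
  also have "\<dots> = (\<Sum>u\<in>U. \<Sum>x\<in>X. c x * ?a x ^ M * (q u * of_bool (u \<notin> G x)))"
    unfolding sum_distrib_left by (intro sum.cong refl) (simp only: mult_ac)
  also have "\<dots> = (\<Sum>x\<in>X. \<Sum>u\<in>U. c x * ?a x ^ M * (q u * of_bool (u \<notin> G x)))"
    by (rule sum.swap)
  also have "\<dots> = (\<Sum>x\<in>X. c x * ?a x ^ M * ?a x)"
    unfolding sum_distrib_left[symmetric] a[symmetric] ..
  also have "\<dots> = (\<Sum>x\<in>X. c x * ?a x ^ Suc M)"
    by (simp add: mult_ac)
  finally have "(\<Sum>x\<in>X. c x * of_bool (insert u C \<inter> G x = {})) \<le> (\<Sum>x\<in>X. c x * ?a x ^ Suc M)" .
  moreover have "card (insert u C) \<le> Suc M"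
    using C(2) card_insert_le_m1[of "Suc M" C u] by simp
  ultimately show ?case using C(1) u(1) by (intro exI[of _ "insert u C"]) auto
qed

text \<open>Random binning, derandomised one word at a time.\<close>

lemma greedy_binning:
  fixes w :: "'b \<Rightarrow> 'b \<Rightarrow> real" and M :: nat
  assumes "finite Y" and "\<And>y y'. 0 \<le> w y y'" and M: "0 < M"
  shows "\<exists>f :: 'b \<Rightarrow> nat. (\<forall>y. f y < M) \<and>
    (\<Sum>y\<in>Y. \<Sum>y'\<in>Y. of_bool (y \<noteq> y' \<and> f y = f y') * w y y') \<le> (\<Sum>y\<in>Y. \<Sum>y'\<in>Y. w y y') / M"
  using assms(1)
proof (induction Y rule: finite_induct)
  case empty
  show ?case using M by (intro exI[of _ "\<lambda>_. 0"]) auto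
next
  case (insert z Y)
  obtain f where f: "\<forall>y. f y < M"
    "(\<Sum>y\<in>Y. \<Sum>y'\<in>Y. of_bool (y \<noteq> y' \<and> f y = f y') * w y y') \<le> (\<Sum>y\<in>Y. \<Sum>y'\<in>Y. w y y') / M"
    using insert.IH by blast
  \<comment> \<open>\<open>w\<close> need not be symmetric, so a collision with \<open>z\<close> is
    charged in both orders.\<close>
  let ?w = "\<lambda>y. w z y + w y z"
  obtain b where b: "b < M" "(\<Sum>y\<in>Y. of_bool (f y = b) * ?w y)
      \<le> (\<Sum>b<M. 1 / M * (\<Sum>y\<in>Y. of_bool (f y = b) * ?w y))"
    using exists_le_average[of "{..<M}" "\<lambda>_. 1 / M" "\<lambda>b. \<Sum>y\<in>Y. of_bool (f y = b) * ?w y"] M by auto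
  have "(\<Sum>b<M. 1 / M * (\<Sum>y\<in>Y. of_bool (f y = b) * ?w y))
      = (\<Sum>y\<in>Y. \<Sum>b<M. of_bool (f y = b) * ?w y) / M"
    by (subst sum.swap) (simp add: sum_divide_distrib)
  also have "\<dots> = (\<Sum>y\<in>Y. ?w y) / M"
  proof -
    have "(\<Sum>b<M. of_bool (f y = b) * ?w y) = ?w y" for y
      using f(1) by (simp add: of_bool_def if_distrib[where f = "\<lambda>t. t * _"] cong: if_cong)
    then show ?thesis by simp
  qed
  finally have b': "(\<Sum>y\<in>Y. of_bool (f y = b) * ?w y) \<le> (\<Sum>y\<in>Y. ?w y) / M" using b(2) by simp
  define g where "g = f(z := b)"
  have gY: "g y = f y" if "y \<in> Y" for y
    using insert.hyps that by (auto simp: g_def)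
  have split: "(\<Sum>y\<in>insert z Y. \<Sum>y'\<in>insert z Y. F y y')
      = F z z + (\<Sum>y\<in>Y. F z y + F y z) + (\<Sum>y\<in>Y. \<Sum>y'\<in>Y. F y y')" for F :: "'b \<Rightarrow> 'b \<Rightarrow> real"
    using insert.hyps by (simp add: sum.distrib)
  have "(\<Sum>y\<in>insert z Y. \<Sum>y'\<in>insert z Y. of_bool (y \<noteq> y' \<and> g y = g y') * w y y')
      = (\<Sum>y\<in>Y. of_bool (f y = b) * ?w y)
        + (\<Sum>y\<in>Y. \<Sum>y'\<in>Y. of_bool (y \<noteq> y' \<and> f y = f y') * w y y')"
  proof -
    have "(\<Sum>y\<in>Y. of_bool (z \<noteq> y \<and> g z = g y) * w z y + of_bool (y \<noteq> z \<and> g y = g z) * w y z)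
        = (\<Sum>y\<in>Y. of_bool (f y = b) * ?w y)"
      using insert.hyps by (intro sum.cong refl) (auto simp: g_def)
    moreover have "(\<Sum>y\<in>Y. \<Sum>y'\<in>Y. of_bool (y \<noteq> y' \<and> g y = g y') * w y y')
        = (\<Sum>y\<in>Y. \<Sum>y'\<in>Y. of_bool (y \<noteq> y' \<and> f y = f y') * w y y')"
      by (intro sum.cong refl) (simp only: gY)
    ultimately show ?thesis unfolding split by simp
  qed
  also have "\<dots> \<le> (w z z + (\<Sum>y\<in>Y. ?w y) + (\<Sum>y\<in>Y. \<Sum>y'\<in>Y. w y y')) / M"
  proof -
    \<comment> \<open>The diagonal never collides; its share of the bound is slack.\<close>
    have "0 \<le> w z z / M" using assms(2) by simp
    with b' f(2) show ?thesis unfolding add_divide_distrib by linarith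
  qed
  finally show ?case
    unfolding split[of w] using f(1) b(1) by (intro exI[of _ g]) (auto simp: g_def)
qed

text \<open>The helper's message names a list, and the decoder returns the only list word in the
  received bin. An error requires the true word to be off the list or another list word to share its
  bin; lists of size at most \<open>L\<close> spread over \<open>M\<close> bins make the latter cost
  at most \<open>L / M\<close>.\<close>

lemma binning_code:
  fixes S :: "('x::finite list \<times> 'y::finite list) pmf" and \<phi> :: "'x list \<Rightarrow> 'c"
  assumes S: "set_pmf S \<subseteq> words UNIV n \<times> words UNIV n"
    and C: "finite C" "\<phi> \<in> words UNIV n \<rightarrow> C"
    and T: "\<And>c. c \<in> C \<Longrightarrow> T c \<subseteq> words UNIV n" "\<And>c. c \<in> C \<Longrightarrow> real (card (T c)) \<le> L"
    and M: "0 < M"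
  shows "\<exists>k. is_wak_code n k \<and> card (msgs1 k) = card C \<and> card (msgs2 k) = M \<and>
    error_prob S k \<le> (\<Sum>xs\<in>words UNIV n. \<Sum>ys\<in>words UNIV n. pmf S (xs, ys) * of_bool (ys \<notin> T (\<phi> xs))) + L / M"
proof -
  let ?X = "words UNIV n :: 'x list set" and ?Y = "words UNIV n :: 'y list set"
  \<comment> \<open>The probability that Y^n = \<open>y\<close> while \<open>y'\<close> is on the
    list; its sum over \<open>y'\<close> is an expected list size.\<close>
  define w where "w y y' = (\<Sum>xs\<in>?X. pmf S (xs, y) * of_bool (y' \<in> T (\<phi> xs)))" for y y'
  have w: "0 \<le> w y y'" for y y' unfolding w_def by (intro sum_nonneg) auto
  obtain f :: "'y list \<Rightarrow> nat" where f: "\<forall>y. f y < M"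
    "(\<Sum>y\<in>?Y. \<Sum>y'\<in>?Y. of_bool (y \<noteq> y' \<and> f y = f y') * w y y') \<le> (\<Sum>y\<in>?Y. \<Sum>y'\<in>?Y. w y y') / M"
    using greedy_binning[of ?Y w M] w M by auto
  obtain h where h: "bij_betw h C {..<card C}"
    using ex_bij_betw_finite_nat[OF C(1)] by (auto simp: atLeast0LessThan)
  define g where "g = the_inv_into C h"
  have gh: "g (h c) = c" if "c \<in> C" for c
    using h that by (simp add: g_def bij_betw_def the_inv_into_f_f)
  have gC: "g a \<in> C" if "a < card C" for a
    using h that bij_betw_the_inv_into[OF h] by (auto simp: g_def dest: bij_betwE)
  \<comment> \<open>The fallback word serves only to keep the output length equal to
    \<open>n\<close>.\<close>
  define d where "d = (\<lambda>(a, b). if \<exists>!y. y \<in> T (g a) \<and> f y = b then THE y. y \<in> T (g a) \<and> f y = b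
    else replicate n undefined)"
  define k where "k = \<lparr>msgs1 = {..<card C}, msgs2 = {..<M}, enc1 = h \<circ> \<phi>, enc2 = f, dec = d\<rparr>"
  have dlen: "length (d (a, b)) = n" if "a < card C" for a b
  proof (cases "\<exists>!y. y \<in> T (g a) \<and> f y = b")
    case True
    then have "d (a, b) \<in> T (g a)" using theI'[OF True] by (simp add: d_def)
    then show ?thesis using T(1)[OF gC[OF that]] by (auto simp: words_def)
  next
    case False
    then show ?thesis by (simp add: d_def)
  qed
  have code: "is_wak_code n k"
    unfolding is_wak_code_def k_def using C(2) f(1) dlen bij_betwE[OF h]
    by (auto simp: words_UNIV Pi_iff)
  have pt: "of_bool (dec k (enc1 k xs, enc2 k ys) \<noteq> ys)
      \<le> of_bool (ys \<notin> T (\<phi> xs)) + (\<Sum>y'\<in>?Y. of_bool (ys \<noteq> y' \<and> f ys = f y') * of_bool (y' \<in> T (\<phi> xs)) :: real)"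
    if xs: "xs \<in> ?X" for xs ys
  proof -
    have c: "\<phi> xs \<in> C" using C(2) xs by auto
    have nn: "0 \<le> (\<Sum>y'\<in>?Y. of_bool (ys \<noteq> y' \<and> f ys = f y') * of_bool (y' \<in> T (\<phi> xs)) :: real)"
      by (intro sum_nonneg) auto
    show ?thesis
    proof (cases "ys \<in> T (\<phi> xs)")
      case False
      then show ?thesis using nn by simp
    next
      case inT: True
      show ?thesis
      proof (cases "\<exists>y'\<in>T (\<phi> xs). ys \<noteq> y' \<and> f ys = f y'")
        case True
        then obtain y' where y': "y' \<in> T (\<phi> xs)" "ys \<noteq> y'" "f ys = f y'" by blast
        then have "y' \<in> ?Y" using T(1)[OF c] by auto
        then have "of_bool (ys \<noteq> y' \<and> f ys = f y') * of_bool (y' \<in> T (\<phi> xs))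
            \<le> (\<Sum>y'\<in>?Y. of_bool (ys \<noteq> y' \<and> f ys = f y') * of_bool (y' \<in> T (\<phi> xs)) :: real)"
          by (intro member_le_sum) auto
        then have "1 \<le> (\<Sum>y'\<in>?Y. of_bool (ys \<noteq> y' \<and> f ys = f y') * of_bool (y' \<in> T (\<phi> xs)) :: real)"
          using y' by simp
        then show ?thesis by (auto simp: of_bool_def)
      next
        case False
        then have u: "\<exists>!y. y \<in> T (\<phi> xs) \<and> f y = f ys"
          using inT False by (intro ex1I[of _ ys]) auto
        have "(THE y. y \<in> T (\<phi> xs) \<and> f y = f ys) = ys"
          using False inT by (intro the1_equality[OF u]) auto
        then have "d (h (\<phi> xs), f ys) = ys" using u by (simp add: d_def gh[OF c])
        then show ?thesis using nn by (simp add: k_def)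
      qed
    qed
  qed
  have "error_prob S k \<le> (\<Sum>xs\<in>?X. \<Sum>ys\<in>?Y. pmf S (xs, ys) * (of_bool (ys \<notin> T (\<phi> xs))
      + (\<Sum>y'\<in>?Y. of_bool (ys \<noteq> y' \<and> f ys = f y') * of_bool (y' \<in> T (\<phi> xs)))))"
    unfolding error_prob_sum[OF S] by (intro sum_mono mult_left_mono pt) auto
  also have "\<dots> = (\<Sum>xs\<in>?X. \<Sum>ys\<in>?Y. pmf S (xs, ys) * of_bool (ys \<notin> T (\<phi> xs)))
      + (\<Sum>xs\<in>?X. \<Sum>ys\<in>?Y. \<Sum>y'\<in>?Y. of_bool (ys \<noteq> y' \<and> f ys = f y') * (pmf S (xs, ys) * of_bool (y' \<in> T (\<phi> xs))))"
    by (simp only: distrib_left sum.distrib sum_distrib_left mult.left_commute)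
  also have "(\<Sum>xs\<in>?X. \<Sum>ys\<in>?Y. \<Sum>y'\<in>?Y. of_bool (ys \<noteq> y' \<and> f ys = f y') * (pmf S (xs, ys) * of_bool (y' \<in> T (\<phi> xs))))
      = (\<Sum>ys\<in>?Y. \<Sum>y'\<in>?Y. of_bool (ys \<noteq> y' \<and> f ys = f y') * w ys y')"
  proof -
    have "(\<Sum>xs\<in>?X. \<Sum>ys\<in>?Y. \<Sum>y'\<in>?Y. of_bool (ys \<noteq> y' \<and> f ys = f y') * (pmf S (xs, ys) * of_bool (y' \<in> T (\<phi> xs))))
        = (\<Sum>ys\<in>?Y. \<Sum>xs\<in>?X. \<Sum>y'\<in>?Y. of_bool (ys \<noteq> y' \<and> f ys = f y') * (pmf S (xs, ys) * of_bool (y' \<in> T (\<phi> xs))))"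
      by (rule sum.swap)
    also have "\<dots> = (\<Sum>ys\<in>?Y. \<Sum>y'\<in>?Y. \<Sum>xs\<in>?X. of_bool (ys \<noteq> y' \<and> f ys = f y') * (pmf S (xs, ys) * of_bool (y' \<in> T (\<phi> xs))))"
      by (intro sum.cong refl sum.swap)
    finally show ?thesis by (simp only: w_def sum_distrib_left)
  qed
  also have "\<dots> \<le> (\<Sum>y\<in>?Y. \<Sum>y'\<in>?Y. w y y') / M" by (rule f(2))
  also have "(\<Sum>y\<in>?Y. \<Sum>y'\<in>?Y. w y y') = (\<Sum>y\<in>?Y. \<Sum>xs\<in>?X. pmf S (xs, y) * real (card (T (\<phi> xs))))"
  proof (intro sum.cong refl)
    fix y
    have "(\<Sum>y'\<in>?Y. w y y') = (\<Sum>xs\<in>?X. \<Sum>y'\<in>?Y. pmf S (xs, y) * of_bool (y' \<in> T (\<phi> xs)))"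
      unfolding w_def by (rule sum.swap)
    also have "\<dots> = (\<Sum>xs\<in>?X. pmf S (xs, y) * real (card (T (\<phi> xs))))"
    proof (intro sum.cong refl)
      fix xs assume "xs \<in> ?X"
      then have "T (\<phi> xs) \<subseteq> ?Y" using C(2) T(1) by auto
      then have "?Y \<inter> T (\<phi> xs) = T (\<phi> xs)" by auto
      then show "(\<Sum>y'\<in>?Y. pmf S (xs, y) * of_bool (y' \<in> T (\<phi> xs))) = pmf S (xs, y) * real (card (T (\<phi> xs)))"
        by (simp add: sum_distrib_left[symmetric] sum_of_bool_eq Collect_mem_eq)
    qed
    finally show "(\<Sum>y'\<in>?Y. w y y') = (\<Sum>xs\<in>?X. pmf S (xs, y) * real (card (T (\<phi> xs))))" .
  qed
  also have "\<dots> \<le> (\<Sum>y\<in>?Y. \<Sum>xs\<in>?X. pmf S (xs, y) * L)"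
    using C(2) T(2) by (intro sum_mono mult_left_mono) auto
  also have "\<dots> = L"
  proof -
    have "(\<Sum>y\<in>?Y. \<Sum>xs\<in>?X. pmf S (xs, y)) = (\<Sum>xs\<in>?X. \<Sum>y\<in>?Y. pmf S (xs, y))"
      by (rule sum.swap)
    also have "\<dots> = sum (pmf S) (?X \<times> ?Y)" by (simp add: sum.cartesian_product)
    also have "\<dots> = 1" by (rule sum_pmf_eq_1[OF _ S]) simp
    finally show ?thesis by (simp add: sum_distrib_right[symmetric])
  qed
  finally have "error_prob S k \<le> (\<Sum>xs\<in>?X. \<Sum>ys\<in>?Y. pmf S (xs, ys) * of_bool (ys \<notin> T (\<phi> xs))) + L / M"
    using M by (simp add: divide_right_mono)
  with code show ?thesis by (intro exI[of _ k]) (simp add: k_def)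
qed

text \<open>Bhattacharyya bound for maximum-likelihood identification of the marginal.\<close>

lemma likelihood_error:
  fixes Q Q' :: "'x::finite pmf"
  assumes "Q \<noteq> Q'"
  shows "\<exists>\<rho>. 0 \<le> \<rho> \<and> \<rho> < 1 \<and>
    (\<forall>n. (\<Sum>xs\<in>words UNIV n. iid (pmf Q) xs * of_bool (iid (pmf Q) xs \<le> iid (pmf Q') xs)) \<le> \<rho> ^ n)"
proof -
  define s where "s x = sqrt (pmf Q x) * sqrt (pmf Q' x)" for x
  define \<rho> where "\<rho> = sum s UNIV"
  have s0: "0 \<le> s x" for x by (simp add: s_def)
  have "\<rho> < 1"
  proof -
    obtain x where "pmf Q x \<noteq> pmf Q' x" using assms by (auto simp: pmf_eq_iff)
    \<comment> \<open>The squared Hellinger distance equals 2 - 2 \<rho>, so distinct laws give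
      \<rho> < 1.\<close>
    then have "0 < (sqrt (pmf Q x) - sqrt (pmf Q' x))\<^sup>2" by simp
    then have "0 < (\<Sum>x\<in>UNIV. (sqrt (pmf Q x) - sqrt (pmf Q' x))\<^sup>2)"
      by (intro sum_pos2[of _ x]) auto
    also have "\<dots> = (\<Sum>x\<in>UNIV. pmf Q x + pmf Q' x - 2 * s x)"
      by (intro sum.cong) (auto simp: power2_diff s_def)
    also have "\<dots> = 2 - 2 * \<rho>"
      by (simp add: sum.distrib sum_subtractf sum_distrib_left[symmetric] \<rho>_def)
    finally show ?thesis by simp
  qed
  \<comment> \<open>On the error event the likelihood is at most the geometric mean of the two
    likelihoods. Ties count as errors, so later tie-breaking is arbitrary.\<close>
  moreover have "(\<Sum>xs\<in>words UNIV n. iid (pmf Q) xs * of_bool (iid (pmf Q) xs \<le> iid (pmf Q') xs)) \<le> \<rho> ^ n" for n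
  proof -
    have "(\<Sum>xs\<in>words UNIV n. iid (pmf Q) xs * of_bool (iid (pmf Q) xs \<le> iid (pmf Q') xs))
        \<le> (\<Sum>xs\<in>words UNIV n. iid s xs)"
    proof (intro sum_mono)
      fix xs :: "'x list"
      have sq: "(iid s xs)\<^sup>2 = iid (pmf Q) xs * iid (pmf Q') xs"
        unfolding power2_eq_square iid_mult[symmetric] by (simp add: s_def mult_ac)
      have nn: "0 \<le> iid (pmf Q) xs" "0 \<le> iid s xs" using s0 by (auto intro: iid_nonneg)
      show "iid (pmf Q) xs * of_bool (iid (pmf Q) xs \<le> iid (pmf Q') xs) \<le> iid s xs"
      proof (cases "iid (pmf Q) xs \<le> iid (pmf Q') xs")
        case True
        then have "(iid (pmf Q) xs)\<^sup>2 \<le> iid (pmf Q) xs * iid (pmf Q') xs"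
          using nn by (simp add: power2_eq_square mult_left_mono)
        then have "(iid (pmf Q) xs)\<^sup>2 \<le> (iid s xs)\<^sup>2" by (simp only: sq)
        then show ?thesis using True nn power2_le_imp_le by auto
      next
        case False
        then show ?thesis using nn by simp
      qed
    qed
    then show ?thesis by (simp add: sum_iid \<rho>_def)
  qed
  moreover have "0 \<le> \<rho>" using s0 by (simp add: \<rho>_def sum_nonneg)
  ultimately show ?thesis by blast
qed


section \<open>Covering\<close>

text \<open>With the law of (X, Y) and the test channel as \<open>f\<close> and \<open>g\<close>,
  this is the Markov chain Y - X - U on words: summing out X^n leaves a product law of (Y,
  U).\<close>

lemma sum_iid_zip2:
  assumes "length ys = n" "length us = n"
  shows "(\<Sum>xs\<in>words A n. iid f (zip xs ys) * iid g (zip xs us))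
    = iid (\<lambda>(y, u). \<Sum>x\<in>A. f (x, y) * g (x, u)) (zip ys us)"
proof -
  have "length ys = length us" using assms by simp
  then show ?thesis using assms
  proof (induction ys us arbitrary: n rule: list_induct2)
    case (Cons y ys u us)
    then obtain k where n: "n = Suc k" "length ys = k" "length us = k" by auto
    have "(\<Sum>xs\<in>words A n. iid f (zip xs (y # ys)) * iid g (zip xs (u # us)))
        = (\<Sum>x\<in>A. \<Sum>xs\<in>words A k. (f (x, y) * g (x, u)) * (iid f (zip xs ys) * iid g (zip xs us)))"
      unfolding n(1) sum_words_Suc by (intro sum.cong refl) (simp add: mult_ac)
    also have "\<dots> = (\<Sum>x\<in>A. f (x, y) * g (x, u)) * (\<Sum>xs\<in>words A k. iid f (zip xs ys) * iid g (zip xs us))"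
      unfolding sum_distrib_left sum_distrib_right by (rule sum.swap)
    finally show ?case using Cons.IH[OF n(2,3)] by simp
  qed simp
qed

lemma iid_divide: "iid (\<lambda>z. f z / g z :: real) zs = iid f zs / iid g zs"
  by (induction zs) auto

lemma iid_one: "iid (\<lambda>_. 1) zs = 1"
  by (induction zs) auto

lemma iid_zip_snd: "length xs = length ys \<Longrightarrow> iid (\<lambda>(x, y). f y) (zip xs ys) = iid f ys"
  by (induction xs ys rule: list_induct2) auto

text \<open>The chance that \<open>M\<close> independent codewords all miss. \<open>b\<close> is the
  probability of a good codeword under the test channel and \<open>t\<close> the loss on passing to
  the codebook law; the bound separates an atypical source word from an unlucky codebook.\<close>

lemma one_minus_mult_power_le:
  fixes a b t :: real
  assumes b: "0 \<le> b" "b \<le> 1" and a: "t * b \<le> a" "a \<le> 1" and M: "z \<le> real M * t"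
  shows "(1 - a) ^ M \<le> 1 - b + exp (- z)"
proof -
  have "(1 - a) ^ M \<le> exp (- (t * b)) ^ M"
    using a exp_ge_add_one_self[of "- (t * b)"] by (intro power_mono) auto
  also have "\<dots> = exp (b * (- (real M * t)))"
    by (simp add: exp_of_nat_mult[symmetric] mult_ac)
  also have "\<dots> \<le> exp (b * (- z))"
    using mult_left_mono[OF M b(1)] by simp
  \<comment> \<open>Convexity of exp between 0 and -\<open>z\<close>, with weight
    \<open>b\<close>.\<close>
  also have "\<dots> = exp ((1 - b) *\<^sub>R 0 + b *\<^sub>R (- z))" by simp
  also have "\<dots> \<le> (1 - b) * exp 0 + b * exp (- z)"
    using b by (intro convex_onD[OF exp_convex]) auto
  also have "\<dots> \<le> 1 - b + exp (- z)"
    using mult_right_mono[OF b(2), of "exp (- z)"] by simp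
  finally show ?thesis .
qed

text \<open>
  Soft covering in the style of Wyner: a pair \<open>(xs, us)\<close> is good if \<open>us\<close> has small information
  density with \<open>xs\<close> and, for each component, \<open>us\<close> is jointly typical with the side word with high
  conditional probability given \<open>xs\<close>. Only the common marginal \<open>Q\<close> enters the choice of the codebook.
\<close>

lemma covering_code:
  fixes Q :: "'x::finite pmf" and P :: "'i \<Rightarrow> ('x \<times> 'y::finite) pmf"
  assumes I: "finite I" and PQ: "\<And>i. i \<in> I \<Longrightarrow> map_pmf fst (P i) = Q"
    and W: "W \<in> test_channels R Q"
    and h: "\<And>i. i \<in> I \<Longrightarrow> cond_entropy (joint_YU (P i) W) \<le> h"
    and \<delta>: "0 < \<delta>"
  shows "\<exists>K\<ge>0. \<forall>n>0. \<exists>(C :: nat list set) \<phi> T. finite C \<and>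
    real (card C) \<le> exp (n * (R + 2 * \<delta>)) + 2 \<and> \<phi> \<in> words UNIV n \<rightarrow> C \<and>
    (\<forall>i\<in>I. \<forall>us. T i us \<subseteq> words UNIV n \<and> real (card (T i us)) \<le> exp (n * (h + \<delta>))) \<and>
    (\<forall>i\<in>I. (\<Sum>xs\<in>words UNIV n. \<Sum>ys\<in>words UNIV n. iid (pmf (P i)) (zip xs ys) * of_bool (ys \<notin> T i (\<phi> xs)))
      \<le> K / sqrt n + exp (- exp (n * \<delta>)))"
proof -
  define J where "J = (\<Union>x. set_pmf (W x))"
  have J: "finite J" and sub: "\<And>x. set_pmf (W x) \<subseteq> J"
    using W by (auto simp: J_def test_channels_def)
  define w where "w = (\<lambda>(x, u). pmf (W x) u)"
  define q where "q u = (\<Sum>x\<in>UNIV. pmf Q x * w (x, u))" for u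
  \<comment> \<open>\<open>v i\<close> is Y given X, \<open>k i\<close> the joint law of (Y, U) and
    \<open>r i\<close> is Y given U. Division by zero yields 0, so \<open>v i\<close> and
    \<open>r i\<close> are only sub-stochastic.\<close>
  define v where "v i = (\<lambda>(x, y). pmf (P i) (x, y) / pmf Q x)" for i
  define k where "k i = (\<lambda>(y, u). \<Sum>x\<in>UNIV. pmf (P i) (x, y) * w (x, u))" for i
  define r where "r i = (\<lambda>(y, u). k i (y, u) / q u)" for i
  have w0: "0 \<le> w z" for z by (simp add: w_def case_prod_unfold)
  have q0: "0 \<le> q u" for u unfolding q_def using w0 by (intro sum_nonneg) auto
  have k0: "0 \<le> k i z" for i z
    unfolding k_def case_prod_unfold using w0 by (intro sum_nonneg) auto
  have v0: "0 \<le> v i z" for i z by (simp add: v_def case_prod_unfold)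
  have r0: "0 \<le> r i z" for i z using k0 q0 by (simp add: r_def case_prod_unfold)
  have w1: "(\<Sum>u\<in>J. w (x, u)) = 1" for x
    unfolding w_def using J sub by (simp add: sum_pmf_eq_1)
  have q1: "sum q J = 1"
  proof -
    have "sum q J = (\<Sum>x\<in>UNIV. \<Sum>u\<in>J. pmf Q x * w (x, u))"
      unfolding q_def by (rule sum.swap)
    then show ?thesis by (simp add: sum_distrib_left[symmetric] w1)
  qed
  have Qp: "pmf Q x = (\<Sum>y\<in>UNIV. pmf (P i) (x, y))" if "i \<in> I" for i x
    using PQ[OF that] pmf_map_fst_sum by metis
  have Pv: "pmf (P i) (x, y) = pmf Q x * v i (x, y)" if "i \<in> I" for i x y
  proof (cases "pmf Q x = 0")
    case True
    then have "pmf (P i) (x, y) = 0"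
      using Qp[OF that, of x] sum_nonneg_eq_0_iff[of UNIV "\<lambda>y. pmf (P i) (x, y)"] by auto
    then show ?thesis using True by simp
  qed (simp add: v_def)
  have v1: "(\<Sum>y\<in>UNIV. v i (x, y)) \<le> 1" if "i \<in> I" for i x
    unfolding v_def using Qp[OF that, of x] by (simp add: sum_divide_distrib[symmetric])
  have kq: "(\<Sum>y\<in>UNIV. k i (y, u)) = q u" if "i \<in> I" for i u
  proof -
    have "(\<Sum>y\<in>UNIV. k i (y, u)) = (\<Sum>x\<in>UNIV. \<Sum>y\<in>UNIV. pmf (P i) (x, y) * w (x, u))"
      unfolding k_def by simp (rule sum.swap)
    then show ?thesis by (simp add: q_def Qp[OF that] sum_distrib_right)
  qed
  have r1: "(\<Sum>y\<in>UNIV. r i (y, u)) \<le> 1" if "i \<in> I" for i u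
    unfolding r_def using kq[OF that, of u] by (simp add: sum_divide_distrib[symmetric])
  have ksum: "sum (k i) (UNIV \<times> J) = 1" if "i \<in> I" for i
  proof -
    have "sum (k i) (UNIV \<times> J) = (\<Sum>y\<in>UNIV. \<Sum>u\<in>J. k i (y, u))" by (rule sum.cartesian_product')
    also have "\<dots> = (\<Sum>u\<in>J. \<Sum>y\<in>UNIV. k i (y, u))" by (rule sum.swap)
    finally show ?thesis by (simp add: kq[OF that] q1)
  qed
  have kr: "0 < r i z" if "i \<in> I" "0 < k i z" for i z
  proof -
    obtain y u where z: "z = (y, u)" by (cases z)
    have "k i (y, u) \<le> q u"
      unfolding kq[OF that(1), symmetric] using k0 by (intro member_le_sum) auto
    then show ?thesis using that(2) by (simp add: r_def z)
  qed
  have Hk: "(\<Sum>z\<in>UNIV \<times> J. k i z * (- ln (r i z))) \<le> h" if i: "i \<in> I" for i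
  proof -
    have tm: "k i (y, u) * (- ln (r i (y, u))) = k i (y, u) * (ln (q u) - ln (k i (y, u)))" for y u
    proof (cases "k i (y, u) = 0")
      case False
      then have "0 < k i (y, u)" using k0[of i "(y, u)"] by linarith
      moreover from kr[OF i this] have "0 < q u" using q0[of u] by (auto simp: r_def zero_less_divide_iff)
      ultimately show ?thesis by (simp add: r_def ln_div)
    qed simp
    have "(\<Sum>z\<in>UNIV \<times> J. k i z * (- ln (r i z))) = (\<Sum>y\<in>UNIV. \<Sum>u\<in>J. k i (y, u) * (ln (q u) - ln (k i (y, u))))"
      unfolding sum.cartesian_product' tm ..
    also have "\<dots> = (\<Sum>u\<in>J. \<Sum>y\<in>UNIV. k i (y, u) * (ln (q u) - ln (k i (y, u))))" by (rule sum.swap)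
    also have "\<dots> = (\<Sum>u\<in>J. ent (\<lambda>y. k i (y, u)) UNIV)"
      by (simp add: ent_eq kq[OF i])
    also have "\<dots> = cond_entropy (joint_YU (P i) W)"
      unfolding cond_entropy_columns[OF J sub] by (simp add: col_ent_def k_def w_def)
    finally show ?thesis using h[OF i] by simp
  qed
  have "\<forall>i\<in>I. \<exists>V\<ge>0. \<forall>n>0.
      (\<Sum>zs\<in>words (UNIV \<times> J) n. iid (k i) zs * of_bool (iid (r i) zs < exp (- (real n * (h + \<delta>))))) \<le> V / n"
    using iid_ge_exp_likely[OF k0 ksum kr Hk \<delta>] by blast
  from bchoice[OF this] obtain V where VV: "\<forall>i\<in>I. 0 \<le> V i \<and> (\<forall>n>0.
      (\<Sum>zs\<in>words (UNIV \<times> J) n. iid (k i) zs * of_bool (iid (r i) zs < exp (- (real n * (h + \<delta>))))) \<le> V i / n)" ..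
  then have V0: "\<And>i. i \<in> I \<Longrightarrow> 0 \<le> V i" and V: "\<And>i n. i \<in> I \<Longrightarrow> 0 < n \<Longrightarrow>
      (\<Sum>zs\<in>words (UNIV \<times> J) n. iid (k i) zs * of_bool (iid (r i) zs < exp (- (real n * (h + \<delta>))))) \<le> V i / n"
    by simp_all
  define f where "f = (\<lambda>(x, u). pmf Q x * w (x, u))"
  \<comment> \<open>The mean of -ln \<open>s\<close> under the law \<open>f\<close> of (X, U) is the
    mutual information.\<close>
  define s where "s = (\<lambda>z. (\<lambda>(x, u). q u) z / w z)"
  have f0: "0 \<le> f z" for z using w0 by (simp add: f_def case_prod_unfold)
  have fsum: "sum f (UNIV \<times> J) = 1"
    unfolding sum.cartesian_product' f_def by (simp add: sum_distrib_left[symmetric] w1)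
  have fs: "0 < w (x, u) \<and> 0 < q u \<and> 0 < pmf Q x" if "0 < f (x, u)" for x u
  proof -
    have "f (x, u) \<le> q u"
      unfolding q_def f_def using w0 by (simp, intro member_le_sum) auto
    then have "0 < q u" using that by linarith
    then show ?thesis using that w0[of "(x, u)"] by (auto simp: f_def zero_less_mult_iff)
  qed
  have fr: "0 < s z" if "0 < f z" for z
    using fs[of "fst z" "snd z"] that by (simp add: s_def case_prod_unfold)
  have Hf: "(\<Sum>z\<in>UNIV \<times> J. f z * (- ln (s z))) \<le> R"
  proof -
    have tm: "f (x, u) * (- ln (s (x, u))) = pmf Q x * xl (w (x, u)) - pmf Q x * w (x, u) * ln (q u)" for x u
    proof (cases "f (x, u) = 0")
      case False
      then have "0 < f (x, u)" using f0[of "(x, u)"] by linarith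
      from fs[OF this] show ?thesis by (simp add: f_def s_def ln_div xl_def algebra_simps)
    qed (auto simp: f_def)
    have "(\<Sum>z\<in>UNIV \<times> J. f z * (- ln (s z)))
        = (\<Sum>x\<in>UNIV. \<Sum>u\<in>J. pmf Q x * xl (w (x, u)) - pmf Q x * w (x, u) * ln (q u))"
      unfolding sum.cartesian_product' tm ..
    also have "\<dots> = (\<Sum>u\<in>J. \<Sum>x\<in>UNIV. pmf Q x * xl (w (x, u)) - pmf Q x * w (x, u) * ln (q u))"
      by (rule sum.swap)
    also have "\<dots> = (\<Sum>u\<in>J. (\<Sum>x\<in>UNIV. pmf Q x * xl (w (x, u))) - xl (q u))"
      by (simp add: sum_subtractf sum_distrib_right[symmetric] q_def[symmetric] xl_def)
    also have "\<dots> = mutual_info (joint_XU Q W)"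
      unfolding mutual_info_columns[OF J sub] by (simp add: col_info_def q_def w_def)
    finally show ?thesis using W by (simp add: test_channels_def)
  qed
  obtain V' where V'0: "0 \<le> V'" and V': "\<And>n. 0 < n \<Longrightarrow>
      (\<Sum>zs\<in>words (UNIV \<times> J) n. iid f zs * of_bool (iid s zs < exp (- (real n * (R + \<delta>))))) \<le> V' / n"
    using iid_ge_exp_likely[of "UNIV \<times> J" f s R \<delta>] f0 fsum fr Hf \<delta> by blast
  \<comment> \<open>\<open>V'\<close> pays for large information density, \<open>V i\<close> for
    atypical side words, and 1 for the threshold \<kappa>.\<close>
  define K where "K = V' + (\<Sum>i\<in>I. V i) + 1"
  have K0: "0 \<le> K" using V'0 V0 by (auto simp: K_def intro!: add_nonneg_nonneg sum_nonneg)
  show ?thesis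
  proof (intro exI[of _ K] conjI K0 allI impI)
    fix n :: nat assume n: "0 < n"
    let ?X = "words UNIV n :: 'x list set" and ?Y = "words UNIV n :: 'y list set"
    let ?U = "words J n"
    define \<gamma> where "\<gamma> = real n * (R + \<delta>)"
    \<comment> \<open>Every listed word has conditional weight at least exp(-n(h + \<delta>)) and
      the weights sum to at most 1, which bounds the list size.\<close>
    define T where "T i us = {ys \<in> ?Y. length us = n \<and> exp (- (real n * (h + \<delta>))) \<le> iid (r i) (zip ys us)}" for i us
    have T: "T i us \<subseteq> ?Y \<and> real (card (T i us)) \<le> exp (n * (h + \<delta>))" if i: "i \<in> I" for i us
    proof (cases "length us = n")
      case True
      have "real (card (T i us)) * exp (- (real n * (h + \<delta>))) = (\<Sum>ys\<in>T i us. exp (- (real n * (h + \<delta>))))"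
        by simp
      also have "\<dots> \<le> (\<Sum>ys\<in>T i us. iid (r i) (zip ys us))" by (intro sum_mono) (auto simp: T_def)
      also have "\<dots> \<le> (\<Sum>ys\<in>?Y. iid (r i) (zip ys us))"
        by (intro sum_mono2) (auto simp: T_def intro!: iid_nonneg r0)
      also have "\<dots> = iid (\<lambda>u. \<Sum>y\<in>UNIV. r i (y, u)) us" by (rule sum_iid_zip'[OF True])
      also have "\<dots> \<le> 1" using r0 r1[OF i] by (intro iid_le_1 sum_nonneg) auto
      finally have *: "real (card (T i us)) * exp (- (real n * (h + \<delta>))) \<le> 1" .
      have "c \<le> exp t" if "c * exp (- t) \<le> 1" for c t :: real
        using that by (simp add: exp_minus field_simps)
      from this[OF *] have "real (card (T i us)) \<le> exp (real n * (h + \<delta>))" .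
      then show ?thesis by (auto simp: T_def)
    qed (auto simp: T_def)
    \<comment> \<open>The conditional probability, given \<open>xs\<close>, that Y^n misses the list
      of \<open>us\<close>.\<close>
    define \<pi> where "\<pi> i xs us = (\<Sum>ys\<in>?Y. iid (v i) (zip xs ys) * of_bool (ys \<notin> T i us))" for i xs us
    have \<pi>0: "0 \<le> \<pi> i xs us" for i xs us
      unfolding \<pi>_def by (intro sum_nonneg mult_nonneg_nonneg iid_nonneg v0) auto
    have \<pi>1: "\<pi> i xs us \<le> 1" if "i \<in> I" "xs \<in> ?X" for i xs us
    proof -
      have len: "length xs = n" using that by (simp add: words_def)
      have "\<pi> i xs us \<le> (\<Sum>ys\<in>?Y. iid (v i) (zip xs ys))"
        unfolding \<pi>_def by (intro sum_mono) (auto intro!: iid_nonneg v0)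
      also have "\<dots> = iid (\<lambda>x. \<Sum>y\<in>UNIV. v i (x, y)) xs" by (rule sum_iid_zip[OF len])
      also have "\<dots> \<le> 1" using v0 v1[OF that(1)] by (intro iid_le_1 sum_nonneg) auto
      finally show ?thesis .
    qed
    have iidP: "iid (pmf (P i)) (zip xs ys) = iid (pmf Q) xs * iid (v i) (zip xs ys)"
      if "i \<in> I" "xs \<in> ?X" "ys \<in> ?Y" for i xs ys
    proof -
      have "pmf (P i) = (\<lambda>(x, y). pmf Q x * v i (x, y))" using Pv[OF that(1)] by auto
      then show ?thesis using iid_fst_zip[of xs ys "pmf Q" "v i"] that by (simp add: words_def)
    qed
    have iidf: "iid f (zip xs us) = iid (pmf Q) xs * iid w (zip xs us)" if "xs \<in> ?X" "us \<in> ?U" for xs us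
      unfolding f_def using iid_fst_zip[of xs us "pmf Q" w] that by (simp add: words_def)
    \<comment> \<open>Averaged over (X^n, U^n), \<pi> becomes the probability that (Y^n, U^n) is
      atypical.\<close>
    have avg: "(\<Sum>xs\<in>?X. \<Sum>us\<in>?U. iid f (zip xs us) * \<pi> i xs us) \<le> V i / n" if i: "i \<in> I" for i
    proof -
      have "(\<Sum>xs\<in>?X. \<Sum>us\<in>?U. iid f (zip xs us) * \<pi> i xs us)
          = (\<Sum>xs\<in>?X. \<Sum>us\<in>?U. \<Sum>ys\<in>?Y. iid (pmf (P i)) (zip xs ys) * iid w (zip xs us) * of_bool (ys \<notin> T i us))"
        unfolding \<pi>_def sum_distrib_left
        by (intro sum.cong refl) (simp add: iidf iidP[OF i] mult_ac)
      also have "\<dots> = (\<Sum>us\<in>?U. \<Sum>xs\<in>?X. \<Sum>ys\<in>?Y. iid (pmf (P i)) (zip xs ys) * iid w (zip xs us) * of_bool (ys \<notin> T i us))"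
        by (rule sum.swap)
      also have "\<dots> = (\<Sum>us\<in>?U. \<Sum>ys\<in>?Y. \<Sum>xs\<in>?X. iid (pmf (P i)) (zip xs ys) * iid w (zip xs us) * of_bool (ys \<notin> T i us))"
        by (intro sum.cong refl sum.swap)
      also have "\<dots> = (\<Sum>ys\<in>?Y. \<Sum>us\<in>?U. \<Sum>xs\<in>?X. iid (pmf (P i)) (zip xs ys) * iid w (zip xs us) * of_bool (ys \<notin> T i us))"
        by (rule sum.swap)
      also have "\<dots> = (\<Sum>ys\<in>?Y. \<Sum>us\<in>?U. iid (k i) (zip ys us) * of_bool (iid (r i) (zip ys us) < exp (- (real n * (h + \<delta>)))))"
      proof (intro sum.cong refl)
        fix ys us assume yu: "ys \<in> ?Y" "us \<in> ?U"
        then have len: "length ys = n" "length us = n" by (auto simp: words_def)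
        have "(\<Sum>xs\<in>?X. iid (pmf (P i)) (zip xs ys) * iid w (zip xs us) * of_bool (ys \<notin> T i us))
            = iid (k i) (zip ys us) * of_bool (ys \<notin> T i us)"
          unfolding sum_distrib_right[symmetric] sum_iid_zip2[OF len] k_def ..
        then show "(\<Sum>xs\<in>?X. iid (pmf (P i)) (zip xs ys) * iid w (zip xs us) * of_bool (ys \<notin> T i us))
            = iid (k i) (zip ys us) * of_bool (iid (r i) (zip ys us) < exp (- (real n * (h + \<delta>))))"
          using yu len by (simp add: T_def not_le)
      qed
      also have "\<dots> \<le> V i / n"
        using V[OF i n] by (simp add: sum_words_zip)
      finally show ?thesis .
    qed
    \<comment> \<open>By Markov's inequality \<pi> exceeds \<kappa> with probability at most V/(n
      \<kappa>) = V \<kappa>; this choice balances that failure against the tolerated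
      \<kappa>.\<close>
    define \<kappa> where "\<kappa> = 1 / sqrt n"
    have \<kappa>: "0 < \<kappa>" using n by (simp add: \<kappa>_def)
    define G where "G xs = {us \<in> ?U. iid w (zip xs us) \<le> exp \<gamma> * iid q us \<and> (\<forall>i\<in>I. \<pi> i xs us \<le> \<kappa>)}" for xs
    define b where "b xs = (\<Sum>us\<in>?U. iid w (zip xs us) * of_bool (us \<in> G xs))" for xs
    define a where "a xs = (\<Sum>us\<in>?U. iid q us * of_bool (us \<in> G xs))" for xs
    have wsum: "(\<Sum>us\<in>?U. iid w (zip xs us)) = 1" if "xs \<in> ?X" for xs
    proof -
      have "length xs = n" using that by (simp add: words_def)
      from sum_iid_zip[OF this, of w J] show ?thesis by (simp add: w1 iid_one)
    qed
    have b0: "0 \<le> b xs" for xs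
      unfolding b_def by (intro sum_nonneg mult_nonneg_nonneg iid_nonneg w0) auto
    have b1: "b xs \<le> 1" if "xs \<in> ?X" for xs
    proof -
      have "b xs \<le> (\<Sum>us\<in>?U. iid w (zip xs us))"
        unfolding b_def by (intro sum_mono) (auto intro!: iid_nonneg w0)
      then show ?thesis using wsum[OF that] by simp
    qed
    have qsum: "(\<Sum>us\<in>?U. iid q us) = 1" by (simp add: sum_iid q1)
    have a1: "a xs \<le> 1" for xs
    proof -
      have "a xs \<le> (\<Sum>us\<in>?U. iid q us)"
        unfolding a_def by (intro sum_mono) (auto intro!: iid_nonneg q0)
      then show ?thesis using qsum by simp
    qed
    \<comment> \<open>Change of measure: on good words the channel law is at most exp \<gamma> times
      the codebook law.\<close>
    have ab: "exp (- \<gamma>) * b xs \<le> a xs" for xs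
      unfolding a_def b_def sum_distrib_left
    proof (intro sum_mono)
      fix us
      show "exp (- \<gamma>) * (iid w (zip xs us) * of_bool (us \<in> G xs)) \<le> iid q us * of_bool (us \<in> G xs)"
        by (auto simp: G_def exp_minus field_simps)
    qed
    \<comment> \<open>The codebook exceeds exp \<gamma> by the factor exp(n \<delta>), so missing
      becomes doubly exponentially unlikely.\<close>
    define M where "M = nat \<lceil>exp (real n * (R + 2 * \<delta>))\<rceil>"
    have M: "exp (real n * (R + 2 * \<delta>)) \<le> real M" "real M \<le> exp (real n * (R + 2 * \<delta>)) + 1"
      unfolding M_def by (simp_all add: of_nat_nat)
    have "exp (real n * \<delta>) = exp (real n * (R + 2 * \<delta>)) * exp (- \<gamma>)"
      by (simp add: \<gamma>_def exp_add[symmetric] algebra_simps)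
    also have "\<dots> \<le> real M * exp (- \<gamma>)" using M(1) by (intro mult_right_mono) auto
    finally have Mt: "exp (real n * \<delta>) \<le> real M * exp (- \<gamma>)" .
    have pw: "(1 - a xs) ^ M \<le> 1 - b xs + exp (- exp (n * \<delta>))" if "xs \<in> ?X" for xs
      by (rule one_minus_mult_power_le[OF b0 b1[OF that] ab a1 Mt])
    have bad: "(\<Sum>xs\<in>?X. iid (pmf Q) xs * (1 - b xs)) \<le> (V' + (\<Sum>i\<in>I. V i)) * \<kappa>"
    proof -
      have "(\<Sum>xs\<in>?X. iid (pmf Q) xs * (1 - b xs))
          = (\<Sum>xs\<in>?X. \<Sum>us\<in>?U. iid f (zip xs us) * of_bool (us \<notin> G xs))"
      proof (intro sum.cong refl)
        fix xs assume xs: "xs \<in> ?X"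
        have "1 - b xs = (\<Sum>us\<in>?U. iid w (zip xs us) * of_bool (us \<notin> G xs))"
          unfolding b_def wsum[OF xs, symmetric] sum_subtractf[symmetric]
          by (intro sum.cong) auto
        then show "iid (pmf Q) xs * (1 - b xs) = (\<Sum>us\<in>?U. iid f (zip xs us) * of_bool (us \<notin> G xs))"
          using xs by (simp add: sum_distrib_left iidf mult.assoc)
      qed
      \<comment> \<open>Union bound over the ways of leaving \<open>G\<close>: large information
        density, or \<pi> above \<kappa> for some component.\<close>
      also have "\<dots> \<le> (\<Sum>xs\<in>?X. \<Sum>us\<in>?U. iid f (zip xs us) * of_bool (iid s (zip xs us) < exp (- \<gamma>))
          + (\<Sum>i\<in>I. iid f (zip xs us) * \<pi> i xs us / \<kappa>))"
      proof (intro sum_mono)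
        fix xs us assume xu: "xs \<in> ?X" "us \<in> ?U"
        then have len: "length xs = length us" by (simp add: words_def)
        let ?f = "iid f (zip xs us)"
        have f: "0 \<le> ?f" by (intro iid_nonneg f0)
        have nn: "0 \<le> ?f * \<pi> i xs us / \<kappa>" for i using f \<pi>0 \<kappa> by simp
        have nns: "0 \<le> (\<Sum>i\<in>I. ?f * \<pi> i xs us / \<kappa>)" by (intro sum_nonneg nn)
        show "?f * of_bool (us \<notin> G xs) \<le> ?f * of_bool (iid s (zip xs us) < exp (- \<gamma>))
            + (\<Sum>i\<in>I. ?f * \<pi> i xs us / \<kappa>)"
        proof (cases "us \<in> G xs")
          case True
          then show ?thesis using f nns by simp
        next
          case nG: False
          show ?thesis
          proof (cases "\<forall>i\<in>I. \<pi> i xs us \<le> \<kappa>")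
            case True
            then have gt: "exp \<gamma> * iid q us < iid w (zip xs us)"
              using nG xu by (auto simp: G_def not_le)
            have "0 \<le> exp \<gamma> * iid q us" by (simp add: iid_nonneg q0)
            then have "0 < iid w (zip xs us)" using gt by linarith
            then have "iid q us / iid w (zip xs us) < exp (- \<gamma>)"
              using gt by (simp add: exp_minus field_simps)
            then have "iid s (zip xs us) < exp (- \<gamma>)"
              unfolding s_def iid_divide iid_zip_snd[OF len] .
            then show ?thesis using nG nns by simp
          next
            case False
            then obtain i where i: "i \<in> I" "\<kappa> < \<pi> i xs us" by (auto simp: not_le)
            have "?f * 1 \<le> ?f * (\<pi> i xs us / \<kappa>)" using i \<kappa> f by (intro mult_left_mono) auto
            also have "\<dots> \<le> (\<Sum>i\<in>I. ?f * \<pi> i xs us / \<kappa>)"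
              using i(1) I nn member_le_sum[of i I "\<lambda>i. ?f * \<pi> i xs us / \<kappa>"] by simp
            finally show ?thesis using f nG by simp
          qed
        qed
      qed
      also have "\<dots> = (\<Sum>xs\<in>?X. \<Sum>us\<in>?U. iid f (zip xs us) * of_bool (iid s (zip xs us) < exp (- \<gamma>)))
          + (\<Sum>xs\<in>?X. \<Sum>us\<in>?U. \<Sum>i\<in>I. iid f (zip xs us) * \<pi> i xs us / \<kappa>)"
        by (simp only: sum.distrib)
      also have "(\<Sum>xs\<in>?X. \<Sum>us\<in>?U. \<Sum>i\<in>I. iid f (zip xs us) * \<pi> i xs us / \<kappa>)
          = (\<Sum>i\<in>I. (\<Sum>xs\<in>?X. \<Sum>us\<in>?U. iid f (zip xs us) * \<pi> i xs us) / \<kappa>)"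
      proof -
        have "(\<Sum>xs\<in>?X. \<Sum>us\<in>?U. \<Sum>i\<in>I. iid f (zip xs us) * \<pi> i xs us / \<kappa>)
            = (\<Sum>xs\<in>?X. \<Sum>i\<in>I. \<Sum>us\<in>?U. iid f (zip xs us) * \<pi> i xs us / \<kappa>)"
          by (intro sum.cong refl sum.swap)
        also have "\<dots> = (\<Sum>i\<in>I. \<Sum>xs\<in>?X. \<Sum>us\<in>?U. iid f (zip xs us) * \<pi> i xs us / \<kappa>)"
          by (rule sum.swap)
        finally show ?thesis by (simp only: sum_divide_distrib)
      qed
      also have "(\<Sum>xs\<in>?X. \<Sum>us\<in>?U. iid f (zip xs us) * of_bool (iid s (zip xs us) < exp (- \<gamma>)))
          + (\<Sum>i\<in>I. (\<Sum>xs\<in>?X. \<Sum>us\<in>?U. iid f (zip xs us) * \<pi> i xs us) / \<kappa>)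
          \<le> V' / n + (\<Sum>i\<in>I. V i / n / \<kappa>)"
        using V'[OF n] \<kappa> by (intro add_mono sum_mono divide_right_mono avg) (auto simp: sum_words_zip \<gamma>_def)
      also have "\<dots> \<le> V' * \<kappa> + (\<Sum>i\<in>I. V i * \<kappa>)"
      proof (intro add_mono sum_mono)
        have sq: "sqrt n * sqrt n = n" by simp
        have "1 \<le> sqrt n" using n by simp
        then have "sqrt n * 1 \<le> sqrt n * sqrt n" by (intro mult_left_mono) auto
        then have "1 / real n \<le> \<kappa>" unfolding \<kappa>_def sq using n by (simp add: frac_le)
        from mult_left_mono[OF this V'0] show "V' / n \<le> V' * \<kappa>" by simp
        have "1 / real n / \<kappa> = \<kappa>" unfolding \<kappa>_def using n by (simp add: real_div_sqrt field_simps)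
        then show "V i / n / \<kappa> \<le> V i * \<kappa>" for i
          by (metis divide_divide_eq_left mult.commute order_refl times_divide_eq_right mult_1)
      qed
      finally show ?thesis by (simp add: distrib_right sum_distrib_right)
    qed
    have Qsum: "(\<Sum>xs\<in>?X. iid (pmf Q) xs) = 1" by (simp add: sum_iid)
    have Q0: "0 \<le> iid (pmf Q) xs" for xs by (intro iid_nonneg) auto
    obtain C where C: "C \<subseteq> ?U" "card C \<le> M"
      "(\<Sum>xs\<in>?X. iid (pmf Q) xs * of_bool (C \<inter> G xs = {})) \<le> (\<Sum>xs\<in>?X. iid (pmf Q) xs * (1 - a xs) ^ M)"
      using greedy_cover[of ?U "iid q" ?X "iid (pmf Q)" M G] J qsum Q0 unfolding a_def
      by (auto simp: iid_nonneg q0)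
    have "(\<Sum>xs\<in>?X. iid (pmf Q) xs * (1 - a xs) ^ M)
        \<le> (\<Sum>xs\<in>?X. iid (pmf Q) xs * (1 - b xs + exp (- exp (n * \<delta>))))"
      by (intro sum_mono mult_left_mono pw Q0)
    also have "\<dots> = (\<Sum>xs\<in>?X. iid (pmf Q) xs * (1 - b xs)) + (\<Sum>xs\<in>?X. iid (pmf Q) xs) * exp (- exp (n * \<delta>))"
      by (simp only: distrib_left sum.distrib sum_distrib_right)
    finally have unc: "(\<Sum>xs\<in>?X. iid (pmf Q) xs * of_bool (C \<inter> G xs = {}))
        \<le> (V' + (\<Sum>i\<in>I. V i)) * \<kappa> + exp (- exp (n * \<delta>))"
      using C(3) bad Qsum by simp
    \<comment> \<open>A default codeword for uncovered words; together with the rounding of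
      \<open>M\<close> it explains the \<open>+ 2\<close>.\<close>
    define us0 where "us0 = replicate n (0 :: nat)"
    define \<phi> where "\<phi> xs = (if C \<inter> G xs = {} then us0 else (SOME us. us \<in> C \<inter> G xs))" for xs
    have \<phi>G: "\<phi> xs \<in> C \<inter> G xs" if "C \<inter> G xs \<noteq> {}" for xs
      using that someI_ex[of "\<lambda>us. us \<in> C \<inter> G xs"] by (auto simp: \<phi>_def)
    have "finite C" using C(1) J finite_subset finite_words by metis
    have "real (card (insert us0 C)) \<le> exp (n * (R + 2 * \<delta>)) + 2"
      using card_insert_le_m1[of "Suc M" C us0] C(2) M(2) by simp
    moreover have "\<phi> xs \<in> insert us0 C" for xs
      using \<phi>G[of xs] by (cases "C \<inter> G xs = {}") (auto simp: \<phi>_def)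
    moreover have "(\<Sum>xs\<in>?X. \<Sum>ys\<in>?Y. iid (pmf (P i)) (zip xs ys) * of_bool (ys \<notin> T i (\<phi> xs)))
        \<le> K / sqrt n + exp (- exp (n * \<delta>))" if i: "i \<in> I" for i
    proof -
      have "(\<Sum>xs\<in>?X. \<Sum>ys\<in>?Y. iid (pmf (P i)) (zip xs ys) * of_bool (ys \<notin> T i (\<phi> xs)))
          = (\<Sum>xs\<in>?X. iid (pmf Q) xs * \<pi> i xs (\<phi> xs))"
        unfolding \<pi>_def sum_distrib_left by (intro sum.cong refl) (simp add: iidP[OF i] mult.assoc)
      also have "\<dots> \<le> (\<Sum>xs\<in>?X. iid (pmf Q) xs * (of_bool (C \<inter> G xs = {}) + \<kappa>))"
      proof (intro sum_mono mult_left_mono Q0)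
        fix xs assume xs: "xs \<in> ?X"
        show "\<pi> i xs (\<phi> xs) \<le> of_bool (C \<inter> G xs = {}) + \<kappa>"
        proof (cases "C \<inter> G xs = {}")
          case True
          then show ?thesis using \<pi>1[OF i xs, of "\<phi> xs"] \<kappa> by simp
        next
          case False
          from \<phi>G[OF this] have "\<pi> i xs (\<phi> xs) \<le> \<kappa>" using i by (auto simp: G_def)
          then show ?thesis by simp
        qed
      qed
      also have "\<dots> = (\<Sum>xs\<in>?X. iid (pmf Q) xs * of_bool (C \<inter> G xs = {})) + (\<Sum>xs\<in>?X. iid (pmf Q) xs) * \<kappa>"
        by (simp only: distrib_left sum.distrib sum_distrib_right)
      also have "\<dots> \<le> (V' + (\<Sum>i\<in>I. V i)) * \<kappa> + exp (- exp (n * \<delta>)) + \<kappa>"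
        using unc Qsum by simp
      also have "\<dots> = K / sqrt n + exp (- exp (n * \<delta>))"
        by (simp add: K_def \<kappa>_def add_divide_distrib)
      finally show ?thesis .
    qed
    ultimately show "\<exists>(C :: nat list set) \<phi> T. finite C \<and>
      real (card C) \<le> exp (n * (R + 2 * \<delta>)) + 2 \<and> \<phi> \<in> ?X \<rightarrow> C \<and>
      (\<forall>i\<in>I. \<forall>us. T i us \<subseteq> ?Y \<and> real (card (T i us)) \<le> exp (n * (h + \<delta>))) \<and>
      (\<forall>i\<in>I. (\<Sum>xs\<in>?X. \<Sum>ys\<in>?Y. iid (pmf (P i)) (zip xs ys) * of_bool (ys \<notin> T i (\<phi> xs)))
        \<le> K / sqrt n + exp (- exp (n * \<delta>)))"
      using \<open>finite C\<close> T by (intro exI[of _ "insert us0 C"] exI[of _ \<phi>] exI[of _ T]) auto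
  qed
qed


section \<open>Achievability for the mixed source\<close>

text \<open>A constant factor in the size of the message set disappears from the rate.\<close>

lemma limsup_rate_le:
  fixes N :: "nat \<Rightarrow> nat"
  assumes a: "0 < a" and N: "\<And>n. 0 < n \<Longrightarrow> 0 < N n \<and> real (N n) \<le> a * exp (real n * R)"
  shows "limsup (\<lambda>n. ereal (ln (real (N n)) / real n)) \<le> ereal R"
proof -
  have "limsup (\<lambda>n. ereal (ln (real (N n)) / real n)) \<le> limsup (\<lambda>n. ereal (ln a / real n + R))"
  proof (intro Limsup_mono eventually_sequentiallyI[of 1])
    fix n :: nat assume "1 \<le> n"
    then have n: "0 < n" by simp
    have "ln (real (N n)) \<le> ln (a * exp (real n * R))"
      using N[OF n] a by (subst ln_le_cancel_iff) auto
    also have "\<dots> = ln a + real n * R" using a by (simp add: ln_mult)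
    finally have "ln (real (N n)) / real n \<le> (ln a + real n * R) / real n"
      using n by (intro divide_right_mono) auto
    then show "ereal (ln (real (N n)) / real n) \<le> ereal (ln a / real n + R)"
      using n by (simp add: add_divide_distrib)
  qed
  also have "\<dots> = ereal R"
  proof (rule lim_imp_Limsup)
    have "(\<lambda>n. ln a / real n + R) \<longlonglongrightarrow> 0 + R"
      by (intro tendsto_add tendsto_const lim_const_over_n)
    then show "(\<lambda>n. ereal (ln a / real n + R)) \<longlonglongrightarrow> ereal R" by simp
  qed simp
  finally show ?thesis .
qed

lemma pmf_mixed_source':
  assumes "\<forall>i\<in>{1..m}. 0 < \<nu> i" and "(\<Sum>i=1..m. \<nu> i) = 1"
  shows "pmf (mixed_source m \<nu> P n) z = (\<Sum>i=1..m. \<nu> i * pmf (iid_source (P i) n) z)"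
  by (rule pmf_mixed_source) (use assms in auto)

lemma set_mixed_source:
  assumes "\<forall>i\<in>{1..m}. 0 < \<nu> i" and "(\<Sum>i=1..m. \<nu> i) = 1"
  shows "set_pmf (mixed_source m \<nu> P n) \<subseteq> words UNIV n \<times> words UNIV n"
proof
  fix z assume "z \<in> set_pmf (mixed_source m \<nu> P n)"
  then have "(\<Sum>i=1..m. \<nu> i * pmf (iid_source (P i) n) z) \<noteq> 0"
    by (simp add: set_pmf_iff pmf_mixed_source'[OF assms])
  then obtain i where "pmf (iid_source (P i) n) z \<noteq> 0"
    by (cases "\<forall>i. pmf (iid_source (P i) n) z = 0") auto
  then show "z \<in> words UNIV n \<times> words UNIV n"
    using set_iid_source[of "P i" n] by (auto simp: set_pmf_iff)
qed

lemma error_prob_mixed_source: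
  fixes P :: "nat \<Rightarrow> ('x::finite \<times> 'y::finite) pmf"
  assumes "\<forall>i\<in>{1..m}. 0 < \<nu> i" and "(\<Sum>i=1..m. \<nu> i) = 1"
  shows "error_prob (mixed_source m \<nu> P n) c = (\<Sum>i=1..m. \<nu> i * error_prob (iid_source (P i) n) c)"
proof -
  let ?b = "\<lambda>xs ys. of_bool (dec c (enc1 c xs, enc2 c ys) \<noteq> ys) :: real"
  let ?X = "words UNIV n :: 'x list set" and ?Y = "words UNIV n :: 'y list set"
  have "error_prob (mixed_source m \<nu> P n) c
      = (\<Sum>xs\<in>?X. \<Sum>ys\<in>?Y. (\<Sum>i=1..m. \<nu> i * pmf (iid_source (P i) n) (xs, ys)) * ?b xs ys)"
    unfolding error_prob_sum[OF set_mixed_source[OF assms]] pmf_mixed_source'[OF assms] ..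
  also have "\<dots> = (\<Sum>xs\<in>?X. \<Sum>ys\<in>?Y. \<Sum>i=1..m. \<nu> i * (pmf (iid_source (P i) n) (xs, ys) * ?b xs ys))"
    by (simp only: sum_distrib_right mult.assoc)
  also have "\<dots> = (\<Sum>xs\<in>?X. \<Sum>i=1..m. \<Sum>ys\<in>?Y. \<nu> i * (pmf (iid_source (P i) n) (xs, ys) * ?b xs ys))"
    by (intro sum.cong refl sum.swap)
  also have "\<dots> = (\<Sum>i=1..m. \<Sum>xs\<in>?X. \<Sum>ys\<in>?Y. \<nu> i * (pmf (iid_source (P i) n) (xs, ys) * ?b xs ys))"
    by (rule sum.swap)
  finally show ?thesis
    by (simp only: error_prob_sum[OF set_iid_source] sum_distrib_left)
qed

lemma finite_marginals: "finite (marginals m P)"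
  by (simp add: marginals_def)

lemma finite_components: "finite (components m P Q)"
  by (simp add: components_def)

lemma components_nonempty: "Q \<in> marginals m P \<Longrightarrow> components m P Q \<noteq> {}"
  by (auto simp: marginals_def components_def)

text \<open>The helper sends the selected marginal together with a codeword for it. The decoder's
  list is the union over the components with that marginal. Both unions cost at most a factor
  \<open>m\<close>, and the bins are the same whatever the marginal.\<close>

lemma mixed_source_codes:
  fixes P :: "nat \<Rightarrow> ('x::finite \<times> 'y::finite) pmf"
  assumes \<nu>: "\<forall>i\<in>{1..m}. 0 < \<nu> i" "(\<Sum>i=1..m. \<nu> i) = 1"
    and Rc: "0 < Rc" and h: "0 \<le> h" and \<delta>: "0 < \<delta>"
    and W: "\<forall>Q\<in>marginals m P. W Q \<in> test_channels Rc Q \<and>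
      (\<forall>i\<in>components m P Q. cond_entropy (joint_YU (P i) (W Q)) \<le> h)"
  shows "\<exists>e. e \<longlonglongrightarrow> 0 \<and> (\<forall>n>0. \<exists>k. is_wak_code n k \<and>
    real (card (msgs1 k)) \<le> 3 * real m * exp (n * (Rc + 2 * \<delta>)) \<and>
    real (card (msgs2 k)) \<le> 2 * exp (n * (h + 2 * \<delta>)) \<and> error_prob (mixed_source m \<nu> P n) k \<le> e n)"
proof -
  let ?Qs = "marginals m P"
  define Qi where "Qi i = map_pmf fst (P i)" for i
  have Qi: "Qi i \<in> ?Qs" "i \<in> components m P (Qi i)" if "i \<in> {1..m}" for i
    using that by (auto simp: Qi_def marginals_def components_def)
  have cardQ: "card ?Qs \<le> m"
    unfolding marginals_def using card_image_le[of "{1..m}" "\<lambda>i. map_pmf fst (P i)"] by simp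
  \<comment> \<open>Names the conclusion of \<open>covering_code\<close> for one block length, so
    that \<open>K Q\<close> is chosen before \<open>n\<close> and the codes after it.\<close>
  define cov where "cov n Q K C \<phi> T \<longleftrightarrow> finite C \<and>
    real (card C) \<le> exp (n * (Rc + 2 * \<delta>)) + 2 \<and> \<phi> \<in> words UNIV n \<rightarrow> C \<and>
    (\<forall>i\<in>components m P Q. \<forall>us. T i us \<subseteq> words UNIV n \<and> real (card (T i us)) \<le> exp (n * (h + \<delta>))) \<and>
    (\<forall>i\<in>components m P Q. (\<Sum>xs\<in>words UNIV n. \<Sum>ys\<in>words UNIV n. iid (pmf (P i)) (zip xs ys) * of_bool (ys \<notin> T i (\<phi> xs)))
      \<le> K / sqrt n + exp (- exp (n * \<delta>)))"
    for n :: nat and Q K and C :: "nat list set" and \<phi> T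
  have "\<forall>Q\<in>?Qs. \<exists>K\<ge>0. \<forall>n>0. \<exists>C \<phi> T. cov n Q K C \<phi> T"
  proof
    fix Q assume Q: "Q \<in> ?Qs"
    show "\<exists>K\<ge>0. \<forall>n>0. \<exists>C \<phi> T. cov n Q K C \<phi> T"
      unfolding cov_def
      by (rule covering_code[of _ P Q "W Q" Rc h \<delta>])
        (use W Q \<delta> in \<open>auto simp: components_def\<close>)
  qed
  then obtain K where K: "\<forall>Q\<in>?Qs. 0 \<le> K Q \<and> (\<forall>n>0. \<exists>C \<phi> T. cov n Q (K Q) C \<phi> T)"
    by metis
  define ok where "ok Q Q' \<rho> \<longleftrightarrow> 0 \<le> \<rho> \<and> \<rho> < 1 \<and>
    (\<forall>n. (\<Sum>xs\<in>words UNIV n. iid (pmf Q) xs * of_bool (iid (pmf Q) xs \<le> iid (pmf Q') xs)) \<le> \<rho> ^ n)"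
    for Q Q' :: "'x pmf" and \<rho>
  define \<rho> where "\<rho> Q Q' = (SOME r. ok Q Q' r)" for Q Q'
  have "ok Q Q' (\<rho> Q Q')" if "Q \<noteq> Q'" for Q Q'
    unfolding \<rho>_def by (rule someI_ex) (unfold ok_def, rule likelihood_error[OF that])
  then have \<rho>: "0 \<le> \<rho> Q Q' \<and> \<rho> Q Q' < 1"
    and \<rho>n: "(\<Sum>xs\<in>words UNIV n. iid (pmf Q) xs * of_bool (iid (pmf Q) xs \<le> iid (pmf Q') xs)) \<le> \<rho> Q Q' ^ n"
    if "Q \<noteq> Q'" for Q Q' n
    using that unfolding ok_def by simp_all
  \<comment> \<open>Per component: a wrong marginal, then a failed covering or an atypical word. The
    final term bounds bin collisions.\<close>
  define e where "e n = (\<Sum>i=1..m. (\<Sum>Q'\<in>?Qs - {Qi i}. \<rho> (Qi i) Q' ^ n)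
      + (K (Qi i) / sqrt n + exp (- exp (n * \<delta>)))) + m * exp (- (n * \<delta>))" for n :: nat
  have "e \<longlonglongrightarrow> (\<Sum>i=1..m. (\<Sum>Q'\<in>?Qs - {Qi i}. 0) + (0 + 0)) + real m * 0"
    unfolding e_def
  proof (intro tendsto_add tendsto_sum tendsto_mult tendsto_const)
    show "(\<lambda>n. \<rho> (Qi i) Q' ^ n) \<longlonglongrightarrow> 0" if "Q' \<in> ?Qs - {Qi i}" for i Q'
      using \<rho>[of "Qi i" Q'] that by (intro LIMSEQ_power_zero) auto
    show "(\<lambda>n. K (Qi i) / sqrt (real n)) \<longlonglongrightarrow> 0" for i by real_asymp
    show "(\<lambda>n. exp (- exp (real n * \<delta>))) \<longlonglongrightarrow> 0" using \<delta> by real_asymp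
    show "(\<lambda>n. exp (- (real n * \<delta>))) \<longlonglongrightarrow> 0" using \<delta> by real_asymp
  qed
  then have e: "e \<longlonglongrightarrow> 0" by simp
  have "\<exists>k. is_wak_code n k \<and>
    real (card (msgs1 k)) \<le> 3 * real m * exp (n * (Rc + 2 * \<delta>)) \<and>
    real (card (msgs2 k)) \<le> 2 * exp (n * (h + 2 * \<delta>)) \<and> error_prob (mixed_source m \<nu> P n) k \<le> e n"
    if n: "0 < n" for n
  proof -
    let ?X = "words UNIV n :: 'x list set" and ?Y = "words UNIV n :: 'y list set"
    let ?S = "mixed_source m \<nu> P n"
    have "\<forall>Q\<in>?Qs. \<exists>C \<phi> T. cov n Q (K Q) C \<phi> T" using K n by blast
    then obtain C \<phi> T where cov: "\<And>Q. Q \<in> ?Qs \<Longrightarrow> cov n Q (K Q) (C Q) (\<phi> Q) (T Q)" by metis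
    have C: "finite (C Q)" "real (card (C Q)) \<le> exp (n * (Rc + 2 * \<delta>)) + 2" "\<phi> Q \<in> ?X \<rightarrow> C Q"
      if "Q \<in> ?Qs" for Q using cov[OF that] unfolding cov_def by blast+
    have T: "T Q i us \<subseteq> ?Y" "real (card (T Q i us)) \<le> exp (n * (h + \<delta>))"
      if "Q \<in> ?Qs" "i \<in> components m P Q" for Q i us
      using cov[OF that(1)] that(2) unfolding cov_def by blast+
    have err: "(\<Sum>xs\<in>?X. \<Sum>ys\<in>?Y. iid (pmf (P i)) (zip xs ys) * of_bool (ys \<notin> T Q i (\<phi> Q xs)))
      \<le> K Q / sqrt n + exp (- exp (n * \<delta>))" if "Q \<in> ?Qs" "i \<in> components m P Q" for Q i
      using cov[OF that(1)] that(2) unfolding cov_def by blast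
    have "\<exists>Q\<in>?Qs. \<forall>Q'\<in>?Qs. iid (pmf Q') xs \<le> iid (pmf Q) xs" for xs
    proof -
      have "1 \<le> m" using \<nu>(2) by (cases m) auto
      then have ne: "?Qs \<noteq> {}" by (auto simp: marginals_def)
      then obtain Q where "Q \<in> ?Qs" "Max ((\<lambda>Q. iid (pmf Q) xs) ` ?Qs) = iid (pmf Q) xs"
        using Max_in[of "(\<lambda>Q. iid (pmf Q) xs) ` ?Qs"] finite_marginals by fastforce
      then show ?thesis
        using finite_marginals by (intro bexI[of _ Q]) (auto intro!: Max_ge simp flip: \<open>Max _ = _\<close>)
    qed
    then obtain sel where sel: "\<And>xs. sel xs \<in> ?Qs" "\<And>xs Q'. Q' \<in> ?Qs \<Longrightarrow> iid (pmf Q') xs \<le> iid (pmf (sel xs)) xs"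
      by metis
    define D where "D = Sigma ?Qs C"
    define \<psi> where "\<psi> xs = (sel xs, \<phi> (sel xs) xs)" for xs
    define L where "L = (\<lambda>(Q, us). \<Union>i\<in>components m P Q. T Q i us)"
    \<comment> \<open>More bins than list words by the factor exp(n \<delta>) / m, which leaves
      collision probability at most m exp(-n \<delta>).\<close>
    define M where "M = nat \<lceil>exp (real n * (h + 2 * \<delta>))\<rceil>"
    have M: "exp (real n * (h + 2 * \<delta>)) \<le> real M" "real M \<le> exp (real n * (h + 2 * \<delta>)) + 1"
      unfolding M_def by (simp_all add: of_nat_nat)
    have M0: "0 < M" using M(1) exp_gt_zero[of "real n * (h + 2 * \<delta>)"] by (cases M) auto
    have finD: "finite D" unfolding D_def using C(1) finite_marginals by blast
    have \<psi>: "\<psi> \<in> ?X \<rightarrow> D" using sel(1) funcset_mem[OF C(3)[OF sel(1)]] by (auto simp: \<psi>_def D_def)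
    have LY: "L c \<subseteq> ?Y" if "c \<in> D" for c
      using that T(1) by (fastforce simp: L_def D_def)
    have Lcard: "real (card (L c)) \<le> m * exp (n * (h + \<delta>))" if "c \<in> D" for c
    proof -
      obtain Q us where c: "c = (Q, us)" by (cases c)
      then have Q: "Q \<in> ?Qs" using that by (auto simp: D_def)
      have "real (card (L c)) \<le> real (\<Sum>i\<in>components m P Q. card (T Q i us))"
        unfolding c L_def prod.case of_nat_le_iff by (rule card_UN_le[OF finite_components])
      also have "\<dots> \<le> (\<Sum>i\<in>components m P Q. exp (n * (h + \<delta>)))"
        using T(2)[OF Q] by (simp only: of_nat_sum) (intro sum_mono, auto)
      also have "\<dots> = card (components m P Q) * exp (n * (h + \<delta>))" by simp
      also have "\<dots> \<le> m * exp (n * (h + \<delta>))"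
      proof (intro mult_right_mono)
        have "card (components m P Q) \<le> card {1..m}"
          by (rule card_mono) (auto simp: components_def)
        then show "real (card (components m P Q)) \<le> real m" by simp
      qed simp
      finally show ?thesis .
    qed
    have "\<exists>k. is_wak_code n k \<and> card (msgs1 k) = card D \<and> card (msgs2 k) = M \<and>
      error_prob ?S k \<le> (\<Sum>xs\<in>?X. \<Sum>ys\<in>?Y. pmf ?S (xs, ys) * of_bool (ys \<notin> L (\<psi> xs))) + m * exp (n * (h + \<delta>)) / M"
      by (rule binning_code[OF set_mixed_source[OF \<nu>] finD \<psi> LY Lcard M0])
    then obtain k where k: "is_wak_code n k" "card (msgs1 k) = card D" "card (msgs2 k) = M"
      "error_prob ?S k \<le> (\<Sum>xs\<in>?X. \<Sum>ys\<in>?Y. pmf ?S (xs, ys) * of_bool (ys \<notin> L (\<psi> xs))) + m * exp (n * (h + \<delta>)) / M"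
      by blast
    have "real (card D) = (\<Sum>Q\<in>?Qs. real (card (C Q)))"
      unfolding D_def using finite_marginals C(1) by (subst card_SigmaI) auto
    also have "\<dots> \<le> (\<Sum>Q\<in>?Qs. 3 * exp (n * (Rc + 2 * \<delta>)))"
    proof (intro sum_mono)
      fix Q assume Q: "Q \<in> ?Qs"
      \<comment> \<open>The exponential is at least 1, so the additive 2 is absorbed into the factor
        3; the factor 2 for the bins arises alike.\<close>
      have "1 \<le> exp (n * (Rc + 2 * \<delta>))" using Rc \<delta> by simp
      then show "real (card (C Q)) \<le> 3 * exp (n * (Rc + 2 * \<delta>))" using C(2)[OF Q] by linarith
    qed
    also have "\<dots> \<le> 3 * real m * exp (n * (Rc + 2 * \<delta>))" using cardQ by simp
    finally have m1: "real (card (msgs1 k)) \<le> 3 * real m * exp (n * (Rc + 2 * \<delta>))" by (simp only: k(2))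
    have "1 \<le> exp (n * (h + 2 * \<delta>))" using h \<delta> by simp
    then have m2: "real (card (msgs2 k)) \<le> 2 * exp (n * (h + 2 * \<delta>))" unfolding k(3) using M(2) by linarith
    have comp: "(\<Sum>xs\<in>?X. \<Sum>ys\<in>?Y. iid (pmf (P i)) (zip xs ys) * of_bool (ys \<notin> L (\<psi> xs)))
        \<le> (\<Sum>Q'\<in>?Qs - {Qi i}. \<rho> (Qi i) Q' ^ n) + (K (Qi i) / sqrt n + exp (- exp (n * \<delta>)))"
      if i: "i \<in> {1..m}" for i
    proof -
      let ?p = "\<lambda>xs ys. iid (pmf (P i)) (zip xs ys)"
      let ?b = "\<lambda>xs. \<Sum>Q'\<in>?Qs - {Qi i}. of_bool (iid (pmf (Qi i)) xs \<le> iid (pmf Q') xs) :: real"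
      have p0: "0 \<le> ?p xs ys" for xs ys by (intro iid_nonneg) auto
      have "(\<Sum>xs\<in>?X. \<Sum>ys\<in>?Y. ?p xs ys * of_bool (ys \<notin> L (\<psi> xs)))
          \<le> (\<Sum>xs\<in>?X. \<Sum>ys\<in>?Y. ?p xs ys * (?b xs + of_bool (ys \<notin> T (Qi i) i (\<phi> (Qi i) xs))))"
      proof (intro sum_mono mult_left_mono p0)
        fix xs ys
        have b0: "0 \<le> ?b xs" by (intro sum_nonneg) auto
        show "of_bool (ys \<notin> L (\<psi> xs)) \<le> ?b xs + of_bool (ys \<notin> T (Qi i) i (\<phi> (Qi i) xs))"
        proof (cases "sel xs = Qi i")
          case True
          then have "T (Qi i) i (\<phi> (Qi i) xs) \<subseteq> L (\<psi> xs)"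
            using Qi(2)[OF i] by (auto simp: L_def \<psi>_def)
          then show ?thesis using b0 by (auto simp: of_bool_def)
        next
          \<comment> \<open>If another marginal is selected, the true one is at most as likely as
            it, so one indicator of the union bound equals 1.\<close>
          case False
          then have mem: "sel xs \<in> ?Qs - {Qi i}" using sel(1) by simp
          have "of_bool (iid (pmf (Qi i)) xs \<le> iid (pmf (sel xs)) xs) \<le> ?b xs"
            by (rule member_le_sum[OF mem]) (auto simp: finite_marginals)
          then have "1 \<le> ?b xs" using sel(2)[OF Qi(1)[OF i]] by simp
          then show ?thesis by (auto simp: of_bool_def)
        qed
      qed
      also have "\<dots> = (\<Sum>xs\<in>?X. (\<Sum>ys\<in>?Y. ?p xs ys) * ?b xs)
          + (\<Sum>xs\<in>?X. \<Sum>ys\<in>?Y. ?p xs ys * of_bool (ys \<notin> T (Qi i) i (\<phi> (Qi i) xs)))"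
        by (simp only: distrib_left sum.distrib sum_distrib_right)
      also have "(\<Sum>xs\<in>?X. (\<Sum>ys\<in>?Y. ?p xs ys) * ?b xs)
          = (\<Sum>xs\<in>?X. \<Sum>Q'\<in>?Qs - {Qi i}. iid (pmf (Qi i)) xs * of_bool (iid (pmf (Qi i)) xs \<le> iid (pmf Q') xs))"
      proof (intro sum.cong refl)
        fix xs assume "xs \<in> ?X"
        then have len: "length xs = n" by (simp add: words_def)
        have "(\<Sum>ys\<in>?Y. ?p xs ys) = iid (pmf (Qi i)) xs"
          unfolding sum_iid_zip[OF len] Qi_def by (simp add: pmf_map_fst_sum[abs_def])
        then show "(\<Sum>ys\<in>?Y. ?p xs ys) * ?b xs
            = (\<Sum>Q'\<in>?Qs - {Qi i}. iid (pmf (Qi i)) xs * of_bool (iid (pmf (Qi i)) xs \<le> iid (pmf Q') xs))"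
          by (simp only: sum_distrib_left)
      qed
      also have "\<dots> = (\<Sum>Q'\<in>?Qs - {Qi i}. \<Sum>xs\<in>?X. iid (pmf (Qi i)) xs * of_bool (iid (pmf (Qi i)) xs \<le> iid (pmf Q') xs))"
        by (rule sum.swap)
      also have "\<dots> \<le> (\<Sum>Q'\<in>?Qs - {Qi i}. \<rho> (Qi i) Q' ^ n)"
        by (intro sum_mono \<rho>n) auto
      finally show ?thesis using err[OF Qi[OF i]] by simp
    qed
    have \<nu>1: "\<nu> i \<le> 1" if "i \<in> {1..m}" for i
    proof -
      have "\<nu> i \<le> sum \<nu> {1..m}" using that \<nu>(1) by (intro member_le_sum) (auto simp: less_imp_le)
      then show ?thesis by (simp only: \<nu>(2))
    qed
    have "(\<Sum>xs\<in>?X. \<Sum>ys\<in>?Y. pmf ?S (xs, ys) * of_bool (ys \<notin> L (\<psi> xs)))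
        = (\<Sum>xs\<in>?X. \<Sum>ys\<in>?Y. \<Sum>i=1..m. \<nu> i * (iid (pmf (P i)) (zip xs ys) * of_bool (ys \<notin> L (\<psi> xs))))"
    proof (intro sum.cong refl)
      fix xs ys assume "xs \<in> ?X" "ys \<in> ?Y"
      then show "pmf ?S (xs, ys) * of_bool (ys \<notin> L (\<psi> xs))
          = (\<Sum>i=1..m. \<nu> i * (iid (pmf (P i)) (zip xs ys) * of_bool (ys \<notin> L (\<psi> xs))))"
        unfolding pmf_mixed_source'[OF \<nu>] by (simp add: pmf_iid_source words_def sum_distrib_right mult.assoc)
    qed
    also have "\<dots> = (\<Sum>xs\<in>?X. \<Sum>i=1..m. \<Sum>ys\<in>?Y. \<nu> i * (iid (pmf (P i)) (zip xs ys) * of_bool (ys \<notin> L (\<psi> xs))))"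
      by (intro sum.cong refl sum.swap)
    also have "\<dots> = (\<Sum>i=1..m. \<Sum>xs\<in>?X. \<Sum>ys\<in>?Y. \<nu> i * (iid (pmf (P i)) (zip xs ys) * of_bool (ys \<notin> L (\<psi> xs))))"
      by (rule sum.swap)
    also have "\<dots> = (\<Sum>i=1..m. \<nu> i * (\<Sum>xs\<in>?X. \<Sum>ys\<in>?Y. iid (pmf (P i)) (zip xs ys) * of_bool (ys \<notin> L (\<psi> xs))))"
      by (simp only: sum_distrib_left)
    also have "\<dots> \<le> (\<Sum>i=1..m. (\<Sum>Q'\<in>?Qs - {Qi i}. \<rho> (Qi i) Q' ^ n) + (K (Qi i) / sqrt n + exp (- exp (n * \<delta>))))"
    proof (intro sum_mono)
      fix i assume i: "i \<in> {1..m}"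
      let ?s = "\<Sum>xs\<in>?X. \<Sum>ys\<in>?Y. iid (pmf (P i)) (zip xs ys) * of_bool (ys \<notin> L (\<psi> xs))"
      have "0 \<le> ?s" by (intro sum_nonneg mult_nonneg_nonneg iid_nonneg) auto
      then have "\<nu> i * ?s \<le> 1 * ?s" by (intro mult_right_mono \<nu>1 i)
      with comp[OF i] show "\<nu> i * ?s \<le> (\<Sum>Q'\<in>?Qs - {Qi i}. \<rho> (Qi i) Q' ^ n) + (K (Qi i) / sqrt n + exp (- exp (n * \<delta>)))"
        by simp
    qed
    finally have "error_prob ?S k \<le> (\<Sum>i=1..m. (\<Sum>Q'\<in>?Qs - {Qi i}. \<rho> (Qi i) Q' ^ n)
        + (K (Qi i) / sqrt n + exp (- exp (n * \<delta>)))) + m * exp (n * (h + \<delta>)) / M"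
      using k(4) by simp
    also have "m * exp (n * (h + \<delta>)) / M \<le> m * exp (- (n * \<delta>))"
    proof -
      have "exp (n * (h + \<delta>)) = exp (- (n * \<delta>)) * exp (real n * (h + 2 * \<delta>))"
        by (simp add: exp_add[symmetric] algebra_simps)
      also have "\<dots> \<le> exp (- (n * \<delta>)) * M" using M(1) by (intro mult_left_mono) auto
      finally have "exp (n * (h + \<delta>)) / M \<le> exp (- (n * \<delta>))" using M0 by (simp add: divide_le_eq)
      from mult_left_mono[OF this, of "real m"] show ?thesis by simp
    qed
    finally have "error_prob ?S k \<le> e n" by (simp add: e_def)
    with k(1) m1 m2 show ?thesis by blast
  qed
  with e show ?thesis by blast
qed

lemma card_msgs_pos:
  assumes "is_wak_code n (c :: ('x, 'y) wak_code)"
  shows "0 < card (msgs1 c)" and "0 < card (msgs2 c)"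
proof -
  obtain xs :: "'x list" and ys :: "'y list" where "length xs = n" "length ys = n"
    using Ex_list_of_length by metis
  then have "enc1 c xs \<in> msgs1 c" "enc2 c ys \<in> msgs2 c"
    using assms by (auto simp: is_wak_code_def Pi_iff)
  then show "0 < card (msgs1 c)" "0 < card (msgs2 c)"
    using assms by (auto simp: is_wak_code_def card_gt_0_iff)
qed

lemma mixed_source_achievable:
  fixes P :: "nat \<Rightarrow> ('x::finite \<times> 'y::finite) pmf"
  assumes \<nu>: "\<forall>i\<in>{1..m}. 0 < \<nu> i" "(\<Sum>i=1..m. \<nu> i) = 1"
    and Rc: "0 < Rc" and h: "0 \<le> h" and \<delta>: "0 < \<delta>"
    and W: "\<forall>Q\<in>marginals m P. W Q \<in> test_channels Rc Q \<and>
      (\<forall>i\<in>components m P Q. cond_entropy (joint_YU (P i) (W Q)) \<le> h)"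
  shows "(Rc + 2 * \<delta>, h + 2 * \<delta>) \<in> wak_achievable 0 (mixed_source m \<nu> P)"
proof -
  obtain e where e: "e \<longlonglongrightarrow> 0" and "\<forall>n>0. \<exists>k. is_wak_code n k \<and>
    real (card (msgs1 k)) \<le> 3 * real m * exp (n * (Rc + 2 * \<delta>)) \<and>
    real (card (msgs2 k)) \<le> 2 * exp (n * (h + 2 * \<delta>)) \<and> error_prob (mixed_source m \<nu> P n) k \<le> e n"
    using mixed_source_codes[OF \<nu> Rc h \<delta> W] by blast
  then obtain c where c: "\<And>n. 0 < n \<Longrightarrow> is_wak_code n (c n) \<and>
    real (card (msgs1 (c n))) \<le> 3 * real m * exp (n * (Rc + 2 * \<delta>)) \<and>
    real (card (msgs2 (c n))) \<le> 2 * exp (n * (h + 2 * \<delta>)) \<and> error_prob (mixed_source m \<nu> P n) (c n) \<le> e n"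
    by metis
  \<comment> \<open>Achievability asks for a code at every block length, including 0, where the
    previous bounds say nothing.\<close>
  define c0 :: "('x, 'y) wak_code" where
    "c0 = \<lparr>msgs1 = {0}, msgs2 = {0}, enc1 = \<lambda>_. 0, enc2 = \<lambda>_. 0, dec = \<lambda>_. []\<rparr>"
  define d where "d n = (if n = 0 then c0 else c n)" for n
  have d: "is_wak_code n (d n)" for n
    using c by (cases "n = 0") (auto simp: d_def c0_def is_wak_code_def)
  have m: "0 < m" using \<nu>(2) by (cases m) auto
  have "limsup (\<lambda>n. ereal (ln (real (card (msgs1 (d n)))) / real n)) \<le> ereal (Rc + 2 * \<delta>)"
  proof (rule limsup_rate_le[of "3 * real m"])
    show "0 < card (msgs1 (d n)) \<and> real (card (msgs1 (d n))) \<le> 3 * real m * exp (real n * (Rc + 2 * \<delta>))"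
      if "0 < n" for n
      using c[OF that] card_msgs_pos(1)[OF d[of n]] that by (simp add: d_def)
  qed (use m in simp)
  moreover have "limsup (\<lambda>n. ereal (ln (real (card (msgs2 (d n)))) / real n)) \<le> ereal (h + 2 * \<delta>)"
  proof (rule limsup_rate_le[of 2])
    show "0 < card (msgs2 (d n)) \<and> real (card (msgs2 (d n))) \<le> 2 * exp (real n * (h + 2 * \<delta>))"
      if "0 < n" for n
      using c[OF that] card_msgs_pos(2)[OF d[of n]] that by (simp add: d_def)
  qed simp
  moreover have "limsup (\<lambda>n. ereal (error_prob (mixed_source m \<nu> P n) (d n))) \<le> ereal 0"
  proof -
    have "limsup (\<lambda>n. ereal (error_prob (mixed_source m \<nu> P n) (d n))) \<le> limsup (\<lambda>n. ereal (e n))"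
      using c by (intro Limsup_mono eventually_sequentiallyI[of 1]) (auto simp: d_def)
    also have "\<dots> = ereal 0" using e by (intro lim_imp_Limsup) auto
    finally show ?thesis .
  qed
  ultimately show ?thesis unfolding wak_achievable_def using d by blast
qed


section \<open>Converse for the mixed source\<close>

text \<open>One long block of the code gives the family. The slack \<open>3 * \<epsilon>\<close>
  consists of ln 2 / n, the excess rate and the Fano term, each at most \<epsilon>.\<close>

lemma mixed_source_converse:
  fixes P :: "nat \<Rightarrow> ('x::finite \<times> 'y::finite) pmf"
  assumes \<nu>: "\<forall>i\<in>{1..m}. 0 < \<nu> i" "(\<Sum>i=1..m. \<nu> i) = 1"
    and R: "(R1, R2) \<in> wak_achievable 0 (mixed_source m \<nu> P)" and \<epsilon>: "0 < \<epsilon>"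
  shows "\<exists>A B. column_family Q P 1 A B \<and> A \<le> R1 + \<epsilon> \<and> (\<forall>i\<in>components m P Q. B i \<le> R2 + 3 * \<epsilon>)"
proof -
  let ?S = "mixed_source m \<nu> P"
  obtain c where c: "\<forall>n. is_wak_code n (c n)"
    "limsup (\<lambda>n. ereal (ln (real (card (msgs1 (c n)))) / real n)) \<le> ereal R1"
    "limsup (\<lambda>n. ereal (ln (real (card (msgs2 (c n)))) / real n)) \<le> ereal R2"
    "limsup (\<lambda>n. ereal (error_prob (?S n) (c n))) \<le> ereal 0"
    using R unfolding wak_achievable_def by blast
  \<comment> \<open>Adding 1 keeps the divisor positive even for a one-letter alphabet.\<close>
  define l where "l = ln (real CARD('y)) + 1"
  have "0 \<le> ln (real CARD('y))" using zero_less_card_finite[where 'a = 'y] by (simp add: Suc_leI)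
  then have l: "0 < l" "ln (real CARD('y)) \<le> l" unfolding l_def by linarith+
  have m: "{1..m} \<noteq> {}" using \<nu>(2) by (cases m) auto
  define \<mu> where "\<mu> = Min (\<nu> ` {1..m})"
  have \<mu>: "0 < \<mu>" "\<And>i. i \<in> {1..m} \<Longrightarrow> \<mu> \<le> \<nu> i"
    unfolding \<mu>_def using m \<nu>(1) by (auto simp: Min_gr_iff)
  \<comment> \<open>With mixture error below \<eta>, the component error is at most \<eta> / \<mu> =
    \<epsilon> / l, so its Fano term is at most \<epsilon>.\<close>
  define \<eta> where "\<eta> = \<mu> * \<epsilon> / l"
  have \<eta>: "0 < \<eta>" using \<mu> \<epsilon> l by (simp add: \<eta>_def)
  have "eventually (\<lambda>n. ereal (ln (real (card (msgs1 (c n)))) / real n) < ereal (R1 + \<epsilon>)) sequentially"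
    by (rule Limsup_lessD, rule le_less_trans[OF c(2)]) (use \<epsilon> in simp)
  moreover have "eventually (\<lambda>n. ereal (ln (real (card (msgs2 (c n)))) / real n) < ereal (R2 + \<epsilon>)) sequentially"
    by (rule Limsup_lessD, rule le_less_trans[OF c(3)]) (use \<epsilon> in simp)
  moreover have "eventually (\<lambda>n. ereal (error_prob (?S n) (c n)) < ereal \<eta>) sequentially"
    by (rule Limsup_lessD, rule le_less_trans[OF c(4)]) (use \<eta> in simp)
  moreover have "eventually (\<lambda>n. ln 2 / real n < \<epsilon>) sequentially"
    by (rule order_tendstoD(2)[OF lim_const_over_n \<epsilon>])
  ultimately have "eventually (\<lambda>n. 0 < n \<and> ln (real (card (msgs1 (c n)))) / real n < R1 + \<epsilon> \<and>
      ln (real (card (msgs2 (c n)))) / real n < R2 + \<epsilon> \<and> error_prob (?S n) (c n) < \<eta> \<and> ln 2 / real n < \<epsilon>) sequentially"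
    using eventually_gt_at_top[of 0] by eventually_elim simp
  from eventually_happens'[OF sequentially_bot this] obtain n where n: "0 < n" "ln (real (card (msgs1 (c n)))) / real n < R1 + \<epsilon>"
    "ln (real (card (msgs2 (c n)))) / real n < R2 + \<epsilon>" "error_prob (?S n) (c n) < \<eta>" "ln 2 / real n < \<epsilon>"
    by auto
  have "\<exists>A B. column_family Q P 1 A B \<and> A \<le> ln (card (msgs1 (c n))) / n \<and>
    (\<forall>i\<in>components m P Q. B i \<le> ln 2 / n + ln (card (msgs2 (c n))) / n + error_prob (iid_source (P i) n) (c n) * ln (CARD('y)))"
    by (rule code_column_family) (use c(1) n(1) in \<open>auto simp: components_def\<close>)
  then obtain A B where AB: "column_family Q P 1 A B" "A \<le> ln (card (msgs1 (c n))) / n"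
    "\<And>i. i \<in> components m P Q \<Longrightarrow> B i \<le> ln 2 / n + ln (card (msgs2 (c n))) / n + error_prob (iid_source (P i) n) (c n) * ln (CARD('y))"
    by auto
  have "B i \<le> R2 + 3 * \<epsilon>" if i: "i \<in> components m P Q" for i
  proof -
    let ?e = "\<lambda>i. error_prob (iid_source (P i) n) (c n)"
    have im: "i \<in> {1..m}" using i by (simp add: components_def)
    have e0: "0 \<le> ?e j" for j by (simp add: error_prob_def)
    have "\<nu> i * ?e i \<le> (\<Sum>j=1..m. \<nu> j * ?e j)"
      using im \<nu>(1) e0 by (intro member_le_sum) (auto simp: less_imp_le)
    then have "\<nu> i * ?e i \<le> \<eta>"
      using n(4) unfolding error_prob_mixed_source[OF \<nu>] by linarith
    then have "\<mu> * ?e i \<le> \<mu> * (\<epsilon> / l)"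
      using mult_right_mono[OF \<mu>(2)[OF im] e0[of i]] by (simp add: \<eta>_def)
    then have "?e i \<le> \<epsilon> / l" using \<mu>(1) by (rule mult_left_le_imp_le)
    then have "?e i * l \<le> \<epsilon>" using l by (simp add: le_divide_eq)
    moreover have "?e i * ln (CARD('y)) \<le> ?e i * l" using l e0 by (intro mult_left_mono)
    ultimately show ?thesis using AB(3)[OF i] n(3,5) by linarith
  qed
  moreover have "A \<le> R1 + \<epsilon>" using AB(2) n(2) by linarith
  ultimately show ?thesis using AB(1) by blast
qed

lemma column_family_worst_le:
  fixes P :: "nat \<Rightarrow> ('x::finite \<times> 'y::finite) pmf"
  assumes Q: "Q \<in> marginals m P" and fam: "column_family Q P 1 A B" and A: "A \<le> Rc"
    and B: "\<forall>i\<in>components m P Q. B i \<le> b"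
    and opt: "\<forall>W\<in>test_channels Rc Q. w \<le> worst_cond_entropy m P Q W"
  shows "w \<le> b"
proof -
  obtain W where W: "\<And>x. finite (set_pmf (W x))" "mutual_info (joint_XU Q W) = A"
    "\<And>i. cond_entropy (joint_YU (P i) W) = B i"
    by (rule channel_of_column_family[OF fam]) blast
  have "w \<le> worst_cond_entropy m P Q W"
    using W A by (intro bspec[OF opt]) (simp add: test_channels_def)
  also have "\<dots> \<le> b"
    unfolding worst_cond_entropy_def W(3)
    using finite_components[of m P Q] components_nonempty[OF Q] B by (subst Max_le_iff) auto
  finally show ?thesis .
qed

text \<open>
  Passing from the achievable set to its closure needs right continuity in \<open>Rc\<close>; it comes from
  replacing the auxiliary variable by an erasure (the constant column) with small probability.
\<close>

lemma mixed_source_region_converse: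
  fixes P :: "nat \<Rightarrow> ('x::finite \<times> 'y::finite) pmf"
  assumes \<nu>: "\<forall>i\<in>{1..m}. 0 < \<nu> i" "(\<Sum>i=1..m. \<nu> i) = 1" and Rc: "0 < Rc"
    and R: "(Rc, R2) \<in> wak_region 0 (mixed_source m \<nu> P)" and Q: "Q \<in> marginals m P"
    and opt: "\<forall>W\<in>test_channels Rc Q. w \<le> worst_cond_entropy m P Q W"
  shows "w \<le> R2"
proof -
  define E where "E = (MAX i\<in>components m P Q. col_ent (P i) (\<lambda>_. 1))"
  have E: "col_ent (P i) (\<lambda>_. 1) \<le> E" if "i \<in> components m P Q" for i
    unfolding E_def using that finite_components[of m P Q] by (intro Max_ge) auto
  \<comment> \<open>One \<epsilon> comes from approximating the point of the closure;
    \<open>mixed_source_converse\<close> adds one more to the helper rate and three to the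
    other.\<close>
  have bound: "w \<le> Rc / (Rc + 2 * \<epsilon>) * (R2 + 4 * \<epsilon>) + 2 * \<epsilon> / (Rc + 2 * \<epsilon>) * E" if \<epsilon>: "0 < \<epsilon>" for \<epsilon>
  proof -
    obtain R1' R2' where R': "(R1', R2') \<in> wak_achievable 0 (mixed_source m \<nu> P)"
      "dist (R1', R2') (Rc, R2) < \<epsilon>"
      using R \<epsilon> unfolding wak_region_def closure_approachable by fast
    have "R1' < Rc + \<epsilon>" "R2' < R2 + \<epsilon>"
      using R'(2) dist_fst_le[of "(R1', R2')" "(Rc, R2)"] dist_snd_le[of "(R1', R2')" "(Rc, R2)"]
      by (auto simp: dist_real_def)
    moreover obtain A B where AB: "column_family Q P 1 A B" "A \<le> R1' + \<epsilon>"
      "\<And>i. i \<in> components m P Q \<Longrightarrow> B i \<le> R2' + 3 * \<epsilon>"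
      using mixed_source_converse[OF \<nu> R'(1) \<epsilon>, of Q] by blast
    ultimately have A: "A \<le> Rc + 2 * \<epsilon>" and B: "\<And>i. i \<in> components m P Q \<Longrightarrow> B i \<le> R2 + 4 * \<epsilon>"
      by fastforce+
    \<comment> \<open>The constant column has zero information, so this weight brings the
      information back to \<open>Rc\<close>; the weight 1 - \<theta> it leaves costs at most
      \<open>E\<close> per unit.\<close>
    define \<theta> where "\<theta> = Rc / (Rc + 2 * \<epsilon>)"
    have \<theta>: "0 \<le> \<theta>" "0 \<le> 1 - \<theta>" "1 - \<theta> = 2 * \<epsilon> / (Rc + 2 * \<epsilon>)" "\<theta> * (Rc + 2 * \<epsilon>) = Rc"
      using Rc \<epsilon> by (auto simp: \<theta>_def field_simps)
    have "column_family Q P 1 0 (\<lambda>i. col_ent (P i) (\<lambda>_. 1))"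
      using column_family_finite[of "{()}" "\<lambda>_ _. 1" 1 Q P] by (simp add: col_info_const)
    then have "column_family Q P (\<theta> * 1 + (1 - \<theta>) * 1) (\<theta> * A + (1 - \<theta>) * 0)
        (\<lambda>i. \<theta> * B i + (1 - \<theta>) * col_ent (P i) (\<lambda>_. 1))"
      using \<theta> AB(1) by (intro column_family_add column_family_scale)
    then have fam: "column_family Q P 1 (\<theta> * A) (\<lambda>i. \<theta> * B i + (1 - \<theta>) * col_ent (P i) (\<lambda>_. 1))"
      by simp
    have "\<theta> * A \<le> Rc" using mult_left_mono[OF A \<theta>(1)] \<theta>(4) by simp
    then have "w \<le> \<theta> * (R2 + 4 * \<epsilon>) + (1 - \<theta>) * E"
      using column_family_worst_le[OF Q fam _ _ opt] B E \<theta>(1,2) by (simp add: add_mono mult_left_mono)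
    then show ?thesis unfolding \<theta>(3) by (simp add: \<theta>_def)
  qed
  have "((\<lambda>\<epsilon>. Rc / (Rc + 2 * \<epsilon>) * (R2 + 4 * \<epsilon>) + 2 * \<epsilon> / (Rc + 2 * \<epsilon>) * E) \<longlongrightarrow> R2) (at_right 0)"
    using Rc by (auto intro!: tendsto_eq_intros)
  then show ?thesis
    by (rule tendsto_lowerbound) (use bound in \<open>auto simp: eventually_at_right_less eventually_at intro!: exI[of _ 1]\<close>)
qed


theorem mainTheorem6:
  fixes P :: "nat \<Rightarrow> ('x::finite \<times> 'y::finite) pmf"
    and \<nu> :: "nat \<Rightarrow> real" and m :: nat and Rc :: real
  assumes "\<And>i. i \<in> {1..m} \<Longrightarrow> 0 < \<nu> i"
    and "(\<Sum>i=1..m. \<nu> i) = 1"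
    and "0 < Rc"
  shows "(\<forall>Q\<in>marginals m P. \<exists>W.
            is_arg_min (worst_cond_entropy m P Q) (\<lambda>W. W \<in> test_channels Rc Q) W) \<and>
         min_rate 0 (mixed_source m \<nu> P) Rc =
           (MAX Q\<in>marginals m P. INF W\<in>test_channels Rc Q. worst_cond_entropy m P Q W)"
proof -
  have "\<exists>W\<in>test_channels Rc Q. \<forall>W'\<in>test_channels Rc Q. worst_cond_entropy m P Q W \<le> worst_cond_entropy m P Q W'"
    if "Q \<in> marginals m P" for Q
    unfolding worst_cond_entropy_def
    by (rule min_worst_cond_entropy_attained[OF finite_components components_nonempty[OF that]])
      (use assms(3) in simp)
  then obtain W where W: "\<And>Q. Q \<in> marginals m P \<Longrightarrow> W Q \<in> test_channels Rc Q"
    and opt: "\<And>Q W'. Q \<in> marginals m P \<Longrightarrow> W' \<in> test_channels Rc Q \<Longrightarrow>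
      worst_cond_entropy m P Q (W Q) \<le> worst_cond_entropy m P Q W'"
    by metis
  have attained: "is_arg_min (worst_cond_entropy m P Q) (\<lambda>W. W \<in> test_channels Rc Q) (W Q)"
    if "Q \<in> marginals m P" for Q
    using W[OF that] opt[OF that] by (auto simp: is_arg_min_def not_less)
  have inf: "(INF W\<in>test_channels Rc Q. worst_cond_entropy m P Q W) = worst_cond_entropy m P Q (W Q)"
    if "Q \<in> marginals m P" for Q
    using W[OF that] opt[OF that] by (intro cInf_eq_minimum) auto
  define F where "F = (MAX Q\<in>marginals m P. worst_cond_entropy m P Q (W Q))"
  have "0 < m" using assms(2) by (cases m) auto
  then have "marginals m P \<noteq> {}" by (auto simp: marginals_def)
  have worst: "cond_entropy (joint_YU (P i) (W Q)) \<le> F" if "Q \<in> marginals m P" "i \<in> components m P Q" for Q i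
  proof -
    have "cond_entropy (joint_YU (P i) (W Q)) \<le> worst_cond_entropy m P Q (W Q)"
      unfolding worst_cond_entropy_def using that finite_components[of m P Q] by (intro Max_ge) auto
    also have "\<dots> \<le> F"
      unfolding F_def using that finite_marginals[of m P] by (intro Max_ge) auto
    finally show ?thesis .
  qed
  have "0 \<le> F"
  proof -
    obtain Q i where Q: "Q \<in> marginals m P" "i \<in> components m P Q"
      using \<open>marginals m P \<noteq> {}\<close> components_nonempty by blast
    have fin: "finite (\<Union>x. set_pmf (W Q x))"
      using W[OF Q(1)] by (auto simp: test_channels_def)
    have "0 \<le> cond_entropy (joint_YU (P i) (W Q))"
      by (subst cond_entropy_columns[OF fin]) (auto intro!: sum_nonneg col_ent_nonneg)
    with worst[OF Q] show ?thesis by linarith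
  qed
  \<comment> \<open>The coding theorem needs a positive margin in both rates; (Rc, F) is reached as
    a limit, using that the region is a closure.\<close>
  have region: "(Rc, F) \<in> wak_region 0 (mixed_source m \<nu> P)"
    unfolding wak_region_def closure_sequential
  proof (intro exI conjI allI)
    let ?\<delta> = "\<lambda>k::nat. 1 / (real k + 1)"
    show "(Rc + 2 * ?\<delta> k, F + 2 * ?\<delta> k) \<in> wak_achievable 0 (mixed_source m \<nu> P)" for k
      using assms W worst \<open>0 \<le> F\<close> by (intro mixed_source_achievable[where W = W]) auto
    have "?\<delta> \<longlonglongrightarrow> 0" by real_asymp
    then have "(\<lambda>k. (Rc + 2 * ?\<delta> k, F + 2 * ?\<delta> k)) \<longlonglongrightarrow> (Rc + 2 * 0, F + 2 * 0)"
      by (intro tendsto_Pair tendsto_add tendsto_mult tendsto_const)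
    then show "(\<lambda>k. (Rc + 2 * ?\<delta> k, F + 2 * ?\<delta> k)) \<longlonglongrightarrow> (Rc, F)" by simp
  qed
  have "F \<le> R2" if "(Rc, R2) \<in> wak_region 0 (mixed_source m \<nu> P)" for R2
    unfolding F_def using finite_marginals[of m P] \<open>marginals m P \<noteq> {}\<close>
      mixed_source_region_converse[OF _ assms(2,3) that] assms(1) opt by (subst Max_le_iff) auto
  with region have "min_rate 0 (mixed_source m \<nu> P) Rc = F"
    unfolding min_rate_def by (intro cInf_eq_minimum) auto
  also have "F = (MAX Q\<in>marginals m P. INF W\<in>test_channels Rc Q. worst_cond_entropy m P Q W)"
    unfolding F_def using inf by simp
  finally show ?thesis using attained by blast
qed

end
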